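(* Let $0\le k\le g$ with $N_k>1$. For $i\in\mathbb{N}$ let $$w_i:=\min\{\langle B,V\rangle \;:\; B\in\mathcal{B},\ b_k=i,\ f_B\neq 0\}-v_k(F),$$ with $w_i:=\infty$ if the minimum is taken over the empty set. Then the Newton polygon of $H_k$ is the lower convex hull of the points $(i,w_i)_{0\le i\le N_k}$.
   Context: Let $\mathbb{K}$ be a perfect field and $F\in\mathbb{K}[[x]][y]$ a square-free Weierstrass polynomial of degree $d$ (monic, with all lower coefficients vanishing at $x=0$), with $\mathrm{char}\,\mathbb{K}=0$ or $>d$. $v_x$ denotes the $x$-valuation (for a polynomial or series in $y$, the minimum of the valuations of its coefficients). The Newton polygon $\mathcal{N}(H)$ of $H=\sum_i a_i(x)y^i=\sum a_{ij}x^jy^i$ is the lower convex hull of the points $(i,v_x(a_i))$; its boundary polynomial is $\bar H=\sum_{(i,j)\in\mathcal{N}(H)}a_{ij}x^jy^i$. A Weierstrass polynomial $H$ over a field $\mathbb{L}$ is degenerated over $\mathbb{L}$ if $\mathcal N(H)$ is straight (one segment or one point) of slope $-m/q$, $q,m$ coprime, $q>0$, and $\bar H=(P(y^q/x^m)\,x^{m\deg P})^N$ with $N\in\mathbb{N}$ and $P\in\mathbb{L}[Z]$ monic irreducible; $(q,m,P,N)$ is then its edge data. Sequence $H_k$: $N_0=d$, $\mathbb{K}_0=\mathbb{K}$, $c_0=-\mathrm{coeff}(F,y^{d-1})/d$, $H_0=F(x,y+c_0(x))$. For $k\ge1$, if $N_{k-1}>1$ and $H_{k-1}$ is degenerated over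 $\mathbb{K}_{k-1}$, let $(q_k,m_k,P_k,N_k)$ be its edge data, $\ell_k=\deg P_k$, $\mathbb{K}_k=\mathbb{K}_{k-1}[Z_k]/(P_k(Z_k))$, $z_k$ the class of $Z_k$, and $(s_k,t_k)$ the unique integers with $q_ks_k-t_km_k=1$, $0\le t_k<q_k$. Then $H_{k-1}(z_k^{t_k}x^{q_k},x^{m_k}(y+z_k^{s_k}))=x^{q_km_k\ell_kN_k}G_kV_k$ with $V_k\in\mathbb{K}_k[[x,y]]^\times$ and $G_k\in\mathbb{K}_k[[x]][y]$ Weierstrass of degree $N_k$; put $c_k=-\mathrm{coeff}(G_k,y^{N_k-1})/N_k$ and $H_k=G_k(x,y+c_k(x))$. $g$ is the smallest index such that $N_g=1$ or $H_g$ is not degenerated over $\mathbb{K}_g$. Let $\pi_0(x,y)=(x,y+c_0(x))$, $\sigma_k(x,y)=(z_k^{t_k}x^{q_k},x^{m_k}(y+z_k^{s_k}+c_k(x)))$, $\pi_k=\pi_{k-1}\circ\sigma_k$, $\pi_k^*H=H\circ\pi_k$. Then $\pi_k(x,y)=(\mu_kx^{e_k},\alpha_kx^{r_k}y+S_k(x))$ with $e_k=q_1\cdots q_k$, $\mu_k,\alpha_k\in\mathbb{K}_k^\times$, $r_k\in\mathbb N$, $S_k\in\mathbb{K}_k[[x]]$. Put $f_k=\ell_1\cdots\ell_k$, $d_k=e_kf_k$ (so $d=N_kd_k$). The $k$-th minimal polynomial $\phi_k$ is the unique monic irreducible polynomial in $\mathbb{K}[[x]][y]$ with $\phi_k(\mu_kx^{e_k},S_k(x))=0$;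 it has degree $d_k$. Put $\phi_{-1}=x$. For $H\in\mathbb{K}[[x]][y]$ let $v_k(H)=v_x(\pi_k^*H)$ ($v_k(0)=\infty$). Fix $k$. $\Phi=(\phi_{-1},\dots,\phi_k)$, $V=(v_k(\phi_{-1}),\dots,v_k(\phi_k))$, $\mathcal{B}=\{(b_{-1},\dots,b_k)\in\mathbb{N}^{k+2}: b_{i-1}<q_i\ell_i,\ 1\le i\le k\}$, $\Phi^B=\prod_{i=-1}^k\phi_i^{b_i}$, and $\langle\,,\rangle$ is the usual scalar product. $F$ has a unique $\Phi$-adic expansion $F=\sum_{B\in\mathcal{B}}f_B\Phi^B$, $f_B\in\mathbb{K}$. *)

theory Defs
  imports
    "HOL-Analysis.Analysis"
    "HOL-Computational_Algebra.Computational_Algebra"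
begin

text \<open>
  \<open>\<bbbK>[[x]][y]\<close> is the type \<open>'k fps poly\<close>, the polynomial variable being \<open>y\<close>. The fields
  \<open>\<bbbK>\<^sub>0 \<subseteq> \<bbbK>\<^sub>1 \<subseteq> \<dots>\<close> are subfields of an arbitrary ambient field \<open>'l\<close> containing \<open>\<bbbK>\<close> via an embedding
  \<open>\<iota>\<close>. The quotient \<open>\<bbbK>\<^sub>k\<^sub>-\<^sub>1[Z]/(P\<^sub>k)\<close> is realised as \<open>\<bbbK>\<^sub>k\<^sub>-\<^sub>1[z\<^sub>k]\<close> for a root \<open>z\<^sub>k\<close> of the irreducible
  polynomial \<open>P\<^sub>k\<close>. Both \<open>'l\<close> and the roots are arbitrary, so every abstract tower is covered, up to
  isomorphism (for instance inside an algebraic closure of \<open>\<bbbK>\<close>).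
\<close>

definition field_embedding :: "('k::field \<Rightarrow> 'l::field) \<Rightarrow> bool" where
  "field_embedding \<iota> \<longleftrightarrow>
     \<iota> 1 = 1 \<and> (\<forall>a b. \<iota> (a + b) = \<iota> a + \<iota> b) \<and> (\<forall>a b. \<iota> (a * b) = \<iota> a * \<iota> b)"

definition perfect_field :: "'k::field itself \<Rightarrow> bool" where
  "perfect_field _ \<longleftrightarrow> CHAR('k) = 0 \<or> (\<forall>a::'k. \<exists>b. b ^ CHAR('k) = a)"

definition irreducible_over :: "'l::field set \<Rightarrow> 'l poly \<Rightarrow> bool" where
  "irreducible_over K P \<longleftrightarrow>
     range (coeff P) \<subseteq> K \<and> 0 < degree P \<and>
     (\<forall>A B. range (coeff A) \<subseteq> K \<longrightarrow> range (coeff B) \<subseteq> K \<longrightarrow> P = A * B \<longrightarrow>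
        degree A = 0 \<or> degree B = 0)"

definition adjoin :: "'l::field set \<Rightarrow> 'l \<Rightarrow> 'l set" where
  "adjoin K z = {poly A z | A. range (coeff A) \<subseteq> K}"


section \<open>Power series, valuations and substitutions\<close>

definition fps_embed :: "('k \<Rightarrow> 'l) \<Rightarrow> 'k fps \<Rightarrow> 'l fps" where
  "fps_embed \<iota> a = Abs_fps (\<lambda>n. \<iota> (fps_nth a n))"

definition weierstrass :: "'a::comm_ring_1 fps poly \<Rightarrow> bool" where
  "weierstrass H \<longleftrightarrow> lead_coeff H = 1 \<and> (\<forall>i<degree H. fps_nth (coeff H i) 0 = 0)"

definition poly_over :: "'a::zero set \<Rightarrow> 'a fps poly \<Rightarrow> bool" where
  "poly_over K H \<longleftrightarrow> (\<forall>i j. fps_nth (coeff H i) j \<in> K)"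

text \<open>\<open>K[[x,y]]\<close> is represented as \<open>K[[x]][[y]]\<close>, the outer variable being \<open>y\<close>.\<close>

definition unit_over :: "'a::comm_ring_1 set \<Rightarrow> 'a fps fps \<Rightarrow> bool" where
  "unit_over K V \<longleftrightarrow>
     (\<forall>i j. fps_nth (fps_nth V i) j \<in> K) \<and>
     (\<exists>W. (\<forall>i j. fps_nth (fps_nth W i) j \<in> K) \<and> V * W = 1)"

definition fps_val :: "'a::zero fps \<Rightarrow> enat" where
  "fps_val a = (if a = 0 then \<infinity> else enat (subdegree a))"

definition poly_val :: "'a::zero fps poly \<Rightarrow> enat" where
  "poly_val H = (INF i. fps_val (coeff H i))"

text \<open>\<open>subst_xy X Y H\<close> is \<open>H(X(x), Y(x,y))\<close>; it is only meaningful if \<open>X(0) = 0\<close>.\<close>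

definition subst_xy :: "'a::comm_ring_1 fps \<Rightarrow> 'a fps poly \<Rightarrow> 'a fps poly \<Rightarrow> 'a fps poly" where
  "subst_xy X Y H = map_poly (\<lambda>a. a oo X) H \<circ>\<^sub>p Y"

definition tschirnhaus :: "'a::field fps poly \<Rightarrow> nat \<Rightarrow> 'a fps" where
  "tschirnhaus H n = fps_const (- 1 / of_nat n) * coeff H (n - 1)"


section \<open>Newton polygons and degeneracy\<close>

definition lower_convex_hull :: "(real \<times> real) set \<Rightarrow> (real \<times> real) set" where
  "lower_convex_hull A =
     {(u, v). (u, v) \<in> convex hull A \<and> (\<forall>v'. (u, v') \<in> convex hull A \<longrightarrow> v \<le> v')}"

text \<open>Points at infinite height do not contribute.\<close>

definition finite_points :: "nat \<Rightarrow> (nat \<Rightarrow> ereal) \<Rightarrow> (real \<times> real) set" where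
  "finite_points n w = {(real i, r) | i r. i \<le> n \<and> w i = ereal r}"

definition newton_polygon :: "'a::zero fps poly \<Rightarrow> (real \<times> real) set" where
  "newton_polygon H =
     lower_convex_hull (finite_points (degree H) (\<lambda>i. ereal_of_enat (fps_val (coeff H i))))"

definition boundary_poly :: "'a::comm_ring_1 fps poly \<Rightarrow> 'a fps poly" where
  "boundary_poly H =
     (\<Sum>i\<le>degree H. monom (Abs_fps (\<lambda>j.
        if (real i, real j) \<in> newton_polygon H then fps_nth (coeff H i) j else 0)) i)"

text \<open>\<open>P(y\<^sup>q/x\<^sup>m) x\<^bsup>m deg P\<^esup>\<close>, with denominators cleared.\<close>

definition edge_form :: "nat \<Rightarrow> nat \<Rightarrow> 'a::comm_ring_1 poly \<Rightarrow> 'a fps poly" where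
  "edge_form q m P =
     (\<Sum>i\<le>degree P. monom (fps_const (coeff P i) * fps_X ^ (m * (degree P - i))) (q * i))"

text \<open>A single point is the segment with \<open>a = b\<close>.\<close>

definition edge_data ::
  "'l::field set \<Rightarrow> 'l fps poly \<Rightarrow> nat \<Rightarrow> nat \<Rightarrow> 'l poly \<Rightarrow> nat \<Rightarrow> bool" where
  "edge_data K H q m P N \<longleftrightarrow>
     0 < q \<and> coprime q m \<and>
     (\<exists>a b. newton_polygon H = closed_segment a b \<and>
            snd b - snd a = - (real m / real q) * (fst b - fst a)) \<and>
     lead_coeff P = 1 \<and> irreducible_over K P \<and>
     boundary_poly H = edge_form q m P ^ N"

definition degenerated :: "'l::field set \<Rightarrow> 'l fps poly \<Rightarrow> bool" where
  "degenerated K H \<longleftrightarrow> (\<exists>q m P N. edge_data K H q m P N)"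


section \<open>The sequence \<open>H\<^sub>k\<close>\<close>

primrec tower :: "('k::field \<Rightarrow> 'l::field) \<Rightarrow> (nat \<Rightarrow> 'l) \<Rightarrow> nat \<Rightarrow> 'l set" where
  "tower \<iota> z 0 = range \<iota>"
| "tower \<iota> z (Suc k) = adjoin (tower \<iota> z k) (z (Suc k))"

text \<open>
  Entries of \<open>q, m, P, z, s, t, G\<close> at index \<open>0\<close>, and entries of all sequences beyond \<open>g\<close>, are
  unconstrained and irrelevant.
\<close>

locale H_sequence =
  fixes \<iota> :: "'k::field \<Rightarrow> 'l::field"
    and F :: "'k fps poly"
    and g :: nat
    and q m N :: "nat \<Rightarrow> nat"
    and P :: "nat \<Rightarrow> 'l poly"
    and z :: "nat \<Rightarrow> 'l"
    and s t :: "nat \<Rightarrow> int"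
    and G H :: "nat \<Rightarrow> 'l fps poly"
    and c :: "nat \<Rightarrow> 'l fps"
  assumes N_0: "N 0 = degree F"
    and c_0: "c 0 = fps_embed \<iota> (tschirnhaus F (degree F))"
    and H_0: "H 0 = map_poly (fps_embed \<iota>) F \<circ>\<^sub>p [:c 0, 1:]"
    and step_N: "\<And>k. 1 \<le> k \<Longrightarrow> k \<le> g \<Longrightarrow> N (k - 1) > 1"
    and step_edge: "\<And>k. 1 \<le> k \<Longrightarrow> k \<le> g \<Longrightarrow>
      edge_data (tower \<iota> z (k - 1)) (H (k - 1)) (q k) (m k) (P k) (N k)"
    and step_z: "\<And>k. 1 \<le> k \<Longrightarrow> k \<le> g \<Longrightarrow> poly (P k) (z k) = 0"
    and step_st: "\<And>k. 1 \<le> k \<Longrightarrow> k \<le> g \<Longrightarrow>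
      int (q k) * s k - t k * int (m k) = 1 \<and> 0 \<le> t k \<and> t k < int (q k)"
    and step_G: "\<And>k. 1 \<le> k \<Longrightarrow> k \<le> g \<Longrightarrow>
      weierstrass (G k) \<and> degree (G k) = N k \<and> poly_over (tower \<iota> z k) (G k) \<and>
      (\<exists>V. unit_over (tower \<iota> z k) V \<and>
        fps_of_poly
          (subst_xy (fps_const (z k powi t k) * fps_X ^ q k)
             [:fps_X ^ m k * fps_const (z k powi s k), fps_X ^ m k:] (H (k - 1))) =
        fps_const (fps_X ^ (q k * m k * degree (P k) * N k)) * fps_of_poly (G k) * V)"
    and step_c: "\<And>k. 1 \<le> k \<Longrightarrow> k \<le> g \<Longrightarrow> c k = tschirnhaus (G k) (N k)"
    and step_H: "\<And>k. 1 \<le> k \<Longrightarrow> k \<le> g \<Longrightarrow> H k = G k \<circ>\<^sub>p [:c k, 1:]"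
    and stop_g: "N g = 1 \<or> \<not> degenerated (tower \<iota> z g) (H g)"

text \<open>
  The two components of \<open>\<pi>\<^sub>k = \<pi>\<^sub>k\<^sub>-\<^sub>1 \<circ> \<sigma>\<^sub>k\<close>. The first is \<open>\<mu>\<^sub>k x\<^bsup>e\<^sub>k\<^esup>\<close>, the second is
  \<open>\<alpha>\<^sub>k x\<^bsup>r\<^sub>k\<^esup> y + S\<^sub>k(x)\<close>, so that \<open>S\<^sub>k\<close> is its coefficient of \<open>y\<^sup>0\<close>.
\<close>

context
  fixes q m :: "nat \<Rightarrow> nat"
    and z :: "nat \<Rightarrow> 'l::field"
    and s t :: "nat \<Rightarrow> int"
    and c :: "nat \<Rightarrow> 'l fps"
begin

definition sigma_x :: "nat \<Rightarrow> 'l fps" where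
  "sigma_x k = fps_const (z k powi t k) * fps_X ^ q k"

definition sigma_y :: "nat \<Rightarrow> 'l fps poly" where
  "sigma_y k = [:fps_X ^ m k * (fps_const (z k powi s k) + c k), fps_X ^ m k:]"

primrec pi_x :: "nat \<Rightarrow> 'l fps" where
  "pi_x 0 = fps_X"
| "pi_x (Suc k) = pi_x k oo sigma_x (Suc k)"

primrec pi_y :: "nat \<Rightarrow> 'l fps poly" where
  "pi_y 0 = [:c 0, 1:]"
| "pi_y (Suc k) = subst_xy (sigma_x (Suc k)) (sigma_y (Suc k)) (pi_y k)"

definition S_series :: "nat \<Rightarrow> 'l fps" where
  "S_series k = coeff (pi_y k) 0"

definition pullback :: "('k::field \<Rightarrow> 'l) \<Rightarrow> nat \<Rightarrow> 'k fps poly \<Rightarrow> 'l fps poly" where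
  "pullback \<iota> k A = subst_xy (pi_x k) (pi_y k) (map_poly (fps_embed \<iota>) A)"

definition val_k :: "('k::field \<Rightarrow> 'l) \<Rightarrow> nat \<Rightarrow> 'k fps poly \<Rightarrow> enat" where
  "val_k \<iota> k A = poly_val (pullback \<iota> k A)"

definition is_minimal_polynomial :: "('k::field \<Rightarrow> 'l) \<Rightarrow> nat \<Rightarrow> 'k fps poly \<Rightarrow> bool" where
  "is_minimal_polynomial \<iota> k \<phi> \<longleftrightarrow>
     lead_coeff \<phi> = 1 \<and> irreducible \<phi> \<and>
     poly (map_poly (\<lambda>a. fps_embed \<iota> a oo pi_x k) \<phi>) (S_series k) = 0"

end


section \<open>\<open>\<Phi>\<close>-adic expansions\<close>

text \<open>
  Indices of \<open>\<Phi>\<close>, \<open>B\<close> and \<open>V\<close> are shifted by one: position \<open>0\<close> carries the index \<open>-1\<close> and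
  position \<open>Suc j\<close> carries the index \<open>j\<close>. A multi-index of length \<open>k + 2\<close> is a function vanishing
  beyond position \<open>Suc k\<close>.
\<close>

fun Phi :: "(nat \<Rightarrow> 'k::field fps poly) \<Rightarrow> nat \<Rightarrow> 'k fps poly" where
  "Phi \<phi> 0 = [:fps_X:]"
| "Phi \<phi> (Suc j) = \<phi> j"

definition Phi_power ::
  "(nat \<Rightarrow> 'k::field fps poly) \<Rightarrow> nat \<Rightarrow> (nat \<Rightarrow> nat) \<Rightarrow> 'k fps poly" where
  "Phi_power \<phi> k B = (\<Prod>i\<le>Suc k. Phi \<phi> i ^ B i)"

definition multi_indices ::
  "(nat \<Rightarrow> nat) \<Rightarrow> (nat \<Rightarrow> 'l::field poly) \<Rightarrow> nat \<Rightarrow> (nat \<Rightarrow> nat) set" where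
  "multi_indices q P k =
     {B. (\<forall>i>Suc k. B i = 0) \<and> (\<forall>i. 1 \<le> i \<and> i \<le> k \<longrightarrow> B i < q i * degree (P i))}"

text \<open>Unconditional convergence of a family in \<open>\<bbbK>[[x]][y]\<close> for the \<open>x\<close>-adic topology.\<close>

definition x_adic_has_sum :: "('i \<Rightarrow> 'k::field fps poly) \<Rightarrow> 'k fps poly \<Rightarrow> 'i set \<Rightarrow> bool" where
  "x_adic_has_sum h A I \<longleftrightarrow>
     (\<forall>n. finite {i\<in>I. \<not> [:fps_X ^ n:] dvd h i} \<and>
          [:fps_X ^ n:] dvd A - (\<Sum>i\<in>{i\<in>I. \<not> [:fps_X ^ n:] dvd h i}. h i))"

definition is_Phi_adic_expansion ::
  "(nat \<Rightarrow> nat) \<Rightarrow> (nat \<Rightarrow> 'l::field poly) \<Rightarrow> (nat \<Rightarrow> 'k::field fps poly) \<Rightarrow> nat \<Rightarrow>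
     ((nat \<Rightarrow> nat) \<Rightarrow> 'k) \<Rightarrow> 'k fps poly \<Rightarrow> bool" where
  "is_Phi_adic_expansion q P \<phi> k f F \<longleftrightarrow>
     x_adic_has_sum (\<lambda>B. smult (fps_const (f B)) (Phi_power \<phi> k B)) F (multi_indices q P k)"

end

theory Submission
  imports Defs
begin

text \<open>
  Every \<open>\<pi>\<^sub>k\<^sup>*\<phi>\<^sub>i\<close> with \<open>i < k\<close> is a power of \<open>x\<close> times a unit, and \<open>\<pi>\<^sub>k\<^sup>*\<phi>\<^sub>k\<close> is a power of \<open>x\<close> times \<open>y\<close>
  times a unit. For the latter, \<open>\<phi>\<^sub>k\<close> has degree at most \<open>d\<^sub>k\<close> because \<open>\<bbbK>\<^sub>k((x))\<close> has dimension at most \<open>d\<^sub>k\<close>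
  over \<open>\<bbbK>((\<mu>\<^sub>k x\<^bsup>e\<^sub>k\<^esup>))\<close>, while the order in \<open>y\<close> at \<open>x = 0\<close> of the reduced transform of a polynomial drops by
  a factor of at least \<open>q\<^sub>k \<ell>\<^sub>k\<close> at each step. Hence \<open>\<pi>\<^sub>k\<^sup>*\<Phi>\<^sup>B = x\<^bsup>\<langle>B,V\<rangle>\<^esup> y\<^bsup>b\<^sub>k\<^esup> U\<^sup>B\<close> with units \<open>U\<^sup>B\<close>, and for
  fixed \<open>\<langle>B,V\<rangle>\<close> and \<open>b\<^sub>k\<close> the constants \<open>U\<^sup>B(0,0)\<close> are linearly independent over \<open>\<bbbK>\<close>, so no cancellation
  occurs at the minimal points \<open>(b\<^sub>k, \<langle>B,V\<rangle>)\<close>. Comparing with \<open>\<pi>\<^sub>k\<^sup>*F = x\<^bsup>v\<^sub>k(F)\<^esup> H\<^sub>k V\<^sub>k\<close>, where the unit \<open>V\<^sub>k\<close>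
  is a polynomial in \<open>y\<close>, the two point sets dominate each other componentwise. Both contain
  \<open>(N\<^sub>k, 0)\<close> and lie above height \<open>0\<close>, so their lower convex hulls agree.
\<close>

section \<open>Ring homomorphisms and substitution\<close>

text \<open>The definition of \<phi>_k offers only irreducibility and a root, while the shape of its
  transform is a statement about multiplicity. As \<phi>_k changes with k, the induction carries a
  bound for every monic polynomial: the y-order of its reduced transform times d_k is at most its
  degree. The factor q l, with l = deg P, counts lattice points: on a line m a + q b = w consecutive
  points differ by q in a, and multiplicity r at the new center uses up r l such steps. The
  multiplicity must not grow when y^q / \<zeta>^m is substituted, so this map has to be unramified
  at the center and P separable. The bound on the characteristic gives both, because q_k and l_k
  divide N_(k-1), which is at most d. Square-freeness rules out H_k = y^(N_k), where the edge has no
  slope and z_(k+1) could be 0. Units and non-minimal terms alter the coefficients, so H_k itself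
  cannot be read off the expansion. What survives is the set of minimal support points, hence the
  comparison by domination.\<close>

definition ring_hom_fun :: "('a::comm_ring_1 \<Rightarrow> 'b::comm_ring_1) \<Rightarrow> bool" where
  "ring_hom_fun h \<longleftrightarrow>
     h 0 = 0 \<and> h 1 = 1 \<and> (\<forall>a b. h (a + b) = h a + h b) \<and> (\<forall>a b. h (a * b) = h a * h b)"

lemma ring_hom_funD:
  assumes "ring_hom_fun h"
  shows "h 0 = 0" "h 1 = 1" "h (a + b) = h a + h b" "h (a * b) = h a * h b"
  using assms by (auto simp: ring_hom_fun_def)

lemma ring_hom_fun_uminus: "ring_hom_fun h \<Longrightarrow> h (- a) = - h a"
  using ring_hom_funD(3)[of h a "- a"] ring_hom_funD(1)[of h]
  by (simp add: eq_neg_iff_add_eq_0 add.commute)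

lemma ring_hom_fun_diff: "ring_hom_fun h \<Longrightarrow> h (a - b) = h a - h b"
  using ring_hom_funD(3)[of h a "- b"] by (simp add: ring_hom_fun_uminus)

lemma ring_hom_fun_power: "ring_hom_fun h \<Longrightarrow> h (a ^ n) = h a ^ n"
  by (induction n) (auto simp: ring_hom_funD)

lemma ring_hom_fun_sum: "ring_hom_fun h \<Longrightarrow> h (\<Sum>i\<in>I. f i) = (\<Sum>i\<in>I. h (f i))"
  by (induction I rule: infinite_finite_induct) (auto simp: ring_hom_funD)

lemma ring_hom_fun_prod: "ring_hom_fun h \<Longrightarrow> h (\<Prod>i\<in>I. f i) = (\<Prod>i\<in>I. h (f i))"
  by (induction I rule: infinite_finite_induct) (auto simp: ring_hom_funD)

lemma ring_hom_fun_of_nat: "ring_hom_fun h \<Longrightarrow> h (of_nat n) = of_nat n"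
  by (induction n) (auto simp: ring_hom_funD)

lemma ring_hom_fun_comp: "ring_hom_fun h \<Longrightarrow> ring_hom_fun h' \<Longrightarrow> ring_hom_fun (\<lambda>a. h' (h a))"
  by (simp add: ring_hom_fun_def)

lemma ring_hom_fun_inj:
  fixes h :: "'a::field \<Rightarrow> 'b::field"
  assumes "ring_hom_fun h" shows "h a = 0 \<longleftrightarrow> a = 0"
proof
  assume "h a = 0"
  show "a = 0"
  proof (rule ccontr)
    assume "a \<noteq> 0"
    then have "h (a * inverse a) = 1" using ring_hom_funD(2)[OF assms] by simp
    then show False using \<open>h a = 0\<close> ring_hom_funD(4)[OF assms] by simp
  qed
qed (simp add: ring_hom_funD[OF assms])

lemma field_embedding_ring_hom_fun:
  assumes "field_embedding \<iota>" shows "ring_hom_fun \<iota>"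
proof -
  have "\<iota> (0 + 0) = \<iota> 0 + \<iota> 0" using assms unfolding field_embedding_def by blast
  then have "\<iota> 0 = 0" by (simp only: add_0_right add_cancel_right_right)
  then show ?thesis using assms by (auto simp: ring_hom_fun_def field_embedding_def)
qed


text \<open>Pullbacks, reduction modulo x, coefficient maps and composition in y are all instances
  of this map, so \<open>poly_subst_poly_subst\<close> settles how any two of them compose.\<close>

definition poly_subst :: "('a::comm_ring_1 \<Rightarrow> 'b::comm_ring_1) \<Rightarrow> 'b poly \<Rightarrow> 'a poly \<Rightarrow> 'b poly" where
  "poly_subst h Y A = map_poly h A \<circ>\<^sub>p Y"

lemma poly_subst_0 [simp]: "poly_subst h Y 0 = 0"
  by (simp add: poly_subst_def)

lemma poly_subst_pCons:
  assumes "ring_hom_fun h"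
  shows "poly_subst h Y (pCons a A) = [:h a:] + Y * poly_subst h Y A"
proof -
  have "map_poly h (pCons a A) = pCons (h a) (map_poly h A)"
    by (rule poly_eqI) (auto simp: coeff_map_poly coeff_pCons ring_hom_funD[OF assms] split: nat.splits)
  then show ?thesis by (simp add: poly_subst_def pcompose_pCons)
qed

lemma poly_subst_const: "ring_hom_fun h \<Longrightarrow> poly_subst h Y [:a:] = [:h a:]"
  by (simp add: poly_subst_pCons)

lemma poly_subst_1: "ring_hom_fun h \<Longrightarrow> poly_subst h Y 1 = 1"
  using poly_subst_const[of h Y 1] by (simp add: ring_hom_funD one_pCons)

lemma poly_subst_var: "ring_hom_fun h \<Longrightarrow> poly_subst h Y [:0, 1:] = Y"
  by (simp add: poly_subst_pCons ring_hom_funD)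

lemma poly_subst_add:
  assumes "ring_hom_fun h"
  shows "poly_subst h Y (A + B) = poly_subst h Y A + poly_subst h Y B"
proof -
  have "map_poly h (A + B) = map_poly h A + map_poly h B"
    by (rule poly_eqI) (simp add: coeff_map_poly ring_hom_funD[OF assms])
  then show ?thesis by (simp add: poly_subst_def pcompose_add)
qed

lemma poly_subst_smult:
  assumes "ring_hom_fun h"
  shows "poly_subst h Y (smult a A) = smult (h a) (poly_subst h Y A)"
proof -
  have "map_poly h (smult a A) = smult (h a) (map_poly h A)"
    by (rule poly_eqI) (simp add: coeff_map_poly ring_hom_funD[OF assms])
  then show ?thesis by (simp add: poly_subst_def pcompose_smult)
qed

lemma poly_subst_mult:
  assumes "ring_hom_fun h"
  shows "poly_subst h Y (A * B) = poly_subst h Y A * poly_subst h Y B"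
proof (induction A)
  case (pCons a A)
  show ?case
    by (simp add: mult_pCons_left poly_subst_add[OF assms] poly_subst_smult[OF assms]
        poly_subst_pCons[OF assms] ring_hom_funD[OF assms] pCons.IH algebra_simps)
qed simp

lemma ring_hom_fun_poly_subst: "ring_hom_fun h \<Longrightarrow> ring_hom_fun (poly_subst h Y)"
  by (simp add: ring_hom_fun_def poly_subst_1 poly_subst_add poly_subst_mult)

lemma poly_subst_poly_subst:
  assumes "ring_hom_fun h" "ring_hom_fun h'"
  shows "poly_subst h' Y' (poly_subst h Y A) = poly_subst (\<lambda>a. h' (h a)) (poly_subst h' Y' Y) A"
  by (induction A)
    (simp_all add: poly_subst_pCons assms ring_hom_fun_comp[OF assms] poly_subst_add poly_subst_mult)

lemma ring_hom_fun_id: "ring_hom_fun (\<lambda>a. a)"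
  by (simp add: ring_hom_fun_def)

lemma pcompose_conv_poly_subst: "A \<circ>\<^sub>p Y = poly_subst (\<lambda>a. a) Y A"
  by (simp add: poly_subst_def map_poly_idI)

lemma map_poly_conv_poly_subst: "map_poly h A = poly_subst h [:0, 1:] A"
  by (simp add: poly_subst_def pcompose_idR)

lemma coeff_0_poly_subst: "coeff (poly_subst h Y A) 0 = poly (map_poly h A) (coeff Y 0)"
  by (simp add: poly_subst_def poly_pcompose flip: poly_0_coeff_0)

text \<open>By Gauss's lemma the polynomials over \<open>'k fps\<close> then form a factorial ring,
  which makes each irreducible \<phi>_j a prime element.\<close>

instance fps :: (field) semiring_gcd_mult_normalize ..

section \<open>Subrings and subfields\<close>

definition subring_set :: "'a::comm_ring_1 set \<Rightarrow> bool" where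
  "subring_set R \<longleftrightarrow>
     1 \<in> R \<and> (\<forall>a\<in>R. - a \<in> R) \<and> (\<forall>a\<in>R. \<forall>b\<in>R. a + b \<in> R) \<and> (\<forall>a\<in>R. \<forall>b\<in>R. a * b \<in> R)"

lemma subring_setD:
  assumes "subring_set R"
  shows "1 \<in> R" "a \<in> R \<Longrightarrow> - a \<in> R" "a \<in> R \<Longrightarrow> b \<in> R \<Longrightarrow> a + b \<in> R"
    "a \<in> R \<Longrightarrow> b \<in> R \<Longrightarrow> a * b \<in> R"
  using assms by (auto simp: subring_set_def)

lemma subring_set_0: "subring_set R \<Longrightarrow> 0 \<in> R"
  using subring_setD(1,2)[of R] subring_setD(3)[of R 1 "- 1"] by auto

lemma subring_set_diff: "subring_set R \<Longrightarrow> a \<in> R \<Longrightarrow> b \<in> R \<Longrightarrow> a - b \<in> R"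
  using subring_setD(3)[of R a "- b"] subring_setD(2)[of R b] by simp

lemma subring_set_power: "subring_set R \<Longrightarrow> a \<in> R \<Longrightarrow> a ^ n \<in> R"
  by (induction n) (auto intro: subring_setD)

lemma subring_set_sum: "subring_set R \<Longrightarrow> (\<And>i. i \<in> I \<Longrightarrow> f i \<in> R) \<Longrightarrow> (\<Sum>i\<in>I. f i) \<in> R"
  by (induction I rule: infinite_finite_induct) (auto intro: subring_setD subring_set_0)

lemma subring_set_prod: "subring_set R \<Longrightarrow> (\<And>i. i \<in> I \<Longrightarrow> f i \<in> R) \<Longrightarrow> (\<Prod>i\<in>I. f i) \<in> R"
  by (induction I rule: infinite_finite_induct) (auto intro: subring_setD)

lemma subring_set_of_nat: "subring_set R \<Longrightarrow> of_nat n \<in> R"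
  by (induction n) (auto intro: subring_setD subring_set_0)

definition polys_over :: "'a::comm_ring_1 set \<Rightarrow> 'a poly set" where
  "polys_over R = {A. \<forall>i. coeff A i \<in> R}"

definition fps_over :: "'a::comm_ring_1 set \<Rightarrow> 'a fps set" where
  "fps_over R = {a. \<forall>n. fps_nth a n \<in> R}"

lemma range_coeff_subset_iff: "range (coeff A) \<subseteq> R \<longleftrightarrow> A \<in> polys_over R"
  by (auto simp: polys_over_def)

lemma poly_over_iff: "poly_over R A \<longleftrightarrow> A \<in> polys_over (fps_over R)"
  by (auto simp: polys_over_def fps_over_def poly_over_def)

lemma subring_polys_over: "subring_set R \<Longrightarrow> subring_set (polys_over R)"
  unfolding subring_set_def[of "polys_over R"]
  by (auto simp: polys_over_def coeff_mult coeff_1 intro!: subring_set_sum subring_setD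
      dest: subring_setD subring_set_0)

lemma subring_fps_over: "subring_set R \<Longrightarrow> subring_set (fps_over R)"
  unfolding subring_set_def[of "fps_over R"]
  by (auto simp: fps_over_def fps_mult_nth intro!: subring_set_sum subring_setD
      dest: subring_setD subring_set_0)

lemma pCons_in_polys_over: "pCons a A \<in> polys_over R \<longleftrightarrow> a \<in> R \<and> A \<in> polys_over R"
  by (auto simp: polys_over_def coeff_pCons split: nat.splits)

lemma const_in_polys_over: "subring_set R \<Longrightarrow> a \<in> R \<Longrightarrow> [:a:] \<in> polys_over R"
  using subring_set_0[of R] by (auto simp: polys_over_def coeff_pCons split: nat.splits)

lemma fps_const_in_fps_over: "subring_set R \<Longrightarrow> a \<in> R \<Longrightarrow> fps_const a \<in> fps_over R"
  using subring_set_0[of R] by (auto simp: fps_over_def)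

lemma fps_X_power_in_fps_over: "subring_set R \<Longrightarrow> fps_X ^ n \<in> fps_over R"
  using subring_set_0[of R] subring_setD(1)[of R] by (auto simp: fps_over_def fps_X_power_nth)

lemma monom_in_polys_over: "subring_set R \<Longrightarrow> a \<in> R \<Longrightarrow> monom a n \<in> polys_over R"
  by (auto simp: polys_over_def intro: subring_set_0)

lemma poly_subst_in_polys_over:
  assumes "ring_hom_fun h" "subring_set R'" "\<And>a. a \<in> R \<Longrightarrow> h a \<in> R'"
    and "Y \<in> polys_over R'" "A \<in> polys_over R"
  shows "poly_subst h Y A \<in> polys_over R'"
  using assms(5)
proof (induction A)
  case 0
  then show ?case using subring_set_0[OF subring_polys_over[OF assms(2)]] by simp
next
  case (pCons a A)
  then show ?case
    unfolding poly_subst_pCons[OF assms(1)] pCons_in_polys_over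
    by (intro subring_setD[OF subring_polys_over[OF assms(2)]] const_in_polys_over assms) auto
qed

section \<open>Subfields of the ambient field and simple extensions\<close>

definition subfield_set :: "'a::field set \<Rightarrow> bool" where
  "subfield_set K \<longleftrightarrow> subring_set K \<and> (\<forall>a\<in>K. inverse a \<in> K)"

lemma subfield_setD:
  assumes "subfield_set K"
  shows "subring_set K" "a \<in> K \<Longrightarrow> inverse a \<in> K"
  using assms by (auto simp: subfield_set_def)

lemma subfield_set_divide: "subfield_set K \<Longrightarrow> a \<in> K \<Longrightarrow> b \<in> K \<Longrightarrow> a / b \<in> K"
  by (simp add: divide_inverse subfield_setD subring_setD)

lemma subfield_set_powi: "subfield_set K \<Longrightarrow> a \<in> K \<Longrightarrow> a powi n \<in> K"
  by (auto simp: power_int_def intro!: subfield_setD subring_set_power)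

text \<open>Division in the ambient field does not record that quotient and remainder have
  coefficients in \<open>K\<close>, so the elimination of leading terms is carried out inside
  \<open>K\<close>.\<close>

lemma subfield_polys_division:
  assumes K: "subfield_set K" and A: "A \<in> polys_over K" "A \<noteq> 0" and P: "P \<in> polys_over K"
  obtains Q R where "Q \<in> polys_over K" "R \<in> polys_over K" "P = A * Q + R"
    "R = 0 \<or> degree R < degree A"
proof -
  note S = subfield_setD(1)[OF K]
  note SP = subring_polys_over[OF S]
  have "\<exists>Q R. Q \<in> polys_over K \<and> R \<in> polys_over K \<and> P = A * Q + R \<and> (R = 0 \<or> degree R < degree A)"
    using P
  proof (induction "degree P" arbitrary: P rule: less_induct)
    case less
    show ?case
    proof (cases "P = 0 \<or> degree P < degree A")
      case True
      then show ?thesis using less.prems subring_set_0[OF SP]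
        by (intro exI[of _ 0] exI[of _ P]) auto
    next
      case False
      define M where "M = monom (lead_coeff P / lead_coeff A) (degree P - degree A)"
      have M: "M \<in> polys_over K"
        unfolding M_def using less.prems A
        by (intro monom_in_polys_over[OF S] subfield_set_divide[OF K]) (auto simp: polys_over_def)
      have lc: "lead_coeff P / lead_coeff A \<noteq> 0" using False A by auto
      have AM: "A * M \<noteq> 0" "degree (A * M) = degree P"
        using lc A False
        by (auto simp: M_def degree_mult_eq degree_monom_eq monom_eq_0_iff)
      have "lead_coeff (A * M) = lead_coeff A * lead_coeff M" by (rule lead_coeff_mult)
      also have "\<dots> = lead_coeff P" using A lc by (simp add: M_def degree_monom_eq)
      finally have AM3: "lead_coeff (A * M) = lead_coeff P" .
      note AM = AM AM3
      define P' where "P' = P - A * M"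
      have P': "P' \<in> polys_over K" unfolding P'_def
        by (intro subring_set_diff[OF SP] subring_setD[OF SP] less.prems A M)
      have "P' = 0 \<or> degree P' < degree P"
      proof (cases "degree P = 0")
        case True
        then have "degree P' = 0" using AM degree_diff_le_max[of P "A * M"] by (simp add: P'_def)
        moreover have "coeff P' 0 = 0" using AM True by (simp add: P'_def)
        ultimately have "P' = 0" by (metis leading_coeff_0_iff)
        then show ?thesis by simp
      next
        case False
        then show ?thesis using AM degree_diff_le_max[of P "A * M"]
          by (metis P'_def coeff_diff eq_iff_diff_eq_0 le_neq_implies_less leading_coeff_0_iff max.idem)
      qed
      then obtain Q R where QR: "Q \<in> polys_over K" "R \<in> polys_over K" "P' = A * Q + R"
        "R = 0 \<or> degree R < degree A"
        using less.hyps[OF _ P'] subring_set_0[OF SP] by (metis add.right_neutral mult_zero_right)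
      then show ?thesis
        by (intro exI[of _ "Q + M"] exI[of _ R])
          (auto simp: P'_def algebra_simps intro!: subring_setD[OF SP] M)
    qed
  qed
  then show ?thesis using that by blast
qed

lemma irreducible_overD:
  assumes "irreducible_over K P" "A \<in> polys_over K" "B \<in> polys_over K" "P = A * B"
  shows "degree A = 0 \<or> degree B = 0"
proof -
  have "\<forall>A B. A \<in> polys_over K \<longrightarrow> B \<in> polys_over K \<longrightarrow> P = A * B \<longrightarrow> degree A = 0 \<or> degree B = 0"
    using assms(1) unfolding irreducible_over_def range_coeff_subset_iff by (elim conjE)
  from this[rule_format, OF assms(2-4)] show ?thesis .
qed

text \<open>Dividing \<open>P\<close> by \<open>A\<close> leaves a remainder of smaller degree that
  also vanishes at \<open>z\<close>, so it is zero by induction. A nonzero \<open>A\<close> would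
  then be a nonconstant factor of \<open>P\<close> of too small a degree.\<close>

lemma irreducible_over_min_degree:
  assumes K: "subfield_set K" and P: "irreducible_over K P" "poly P z = 0"
    and A: "A \<in> polys_over K" "degree A < degree P" "poly A z = 0"
  shows "A = 0"
  using A
proof (induction "degree A" arbitrary: A rule: less_induct)
  case less
  show ?case
  proof (rule ccontr)
    assume "A \<noteq> 0"
    have "P \<in> polys_over K" using P by (simp add: irreducible_over_def range_coeff_subset_iff)
    then obtain Q R where QR: "Q \<in> polys_over K" "R \<in> polys_over K" "P = A * Q + R"
      "R = 0 \<or> degree R < degree A"
      using subfield_polys_division[OF K less.prems(1) \<open>A \<noteq> 0\<close>] by blast
    have "poly R z = 0" using QR(3) P(2) less.prems(3) by simp
    then have "R = 0" using less.hyps[OF _ QR(2)] QR(4) less.prems by fastforce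
    then have "P = A * Q" using QR by simp
    then have "degree A = 0 \<or> degree Q = 0"
      by (rule irreducible_overD[OF P(1) less.prems(1) QR(1)])
    moreover have "degree A \<noteq> 0"
    proof
      assume "degree A = 0"
      then obtain a where "A = [:a:]" by (rule degree_eq_zeroE)
      then show False using \<open>A \<noteq> 0\<close> less.prems(3) by simp
    qed
    ultimately have "degree P \<le> degree A" using \<open>P = A * Q\<close> degree_mult_le[of A Q] by simp
    then show False using less.prems by simp
  qed
qed

lemma subfield_range: "ring_hom_fun \<iota> \<Longrightarrow> subfield_set (range (\<iota> :: 'k::field \<Rightarrow> 'l::field))"
proof -
  assume h: "ring_hom_fun \<iota>"
  have inv: "inverse (\<iota> a) = \<iota> (inverse a)" for a
  proof (cases "a = 0")
    case False
    then have "\<iota> a * \<iota> (inverse a) = 1" using ring_hom_funD[OF h] by (metis right_inverse)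
    then show ?thesis by (simp add: inverse_unique)
  qed (simp add: ring_hom_funD[OF h])
  have "1 \<in> range \<iota>" using ring_hom_funD(2)[OF h] by (metis rangeI)
  moreover have "- \<iota> a \<in> range \<iota>" for a using ring_hom_fun_uminus[OF h] by (metis rangeI)
  moreover have "\<iota> a + \<iota> b \<in> range \<iota>" for a b using ring_hom_funD(3)[OF h] by (metis rangeI)
  moreover have "\<iota> a * \<iota> b \<in> range \<iota>" for a b using ring_hom_funD(4)[OF h] by (metis rangeI)
  ultimately show ?thesis
    unfolding subfield_set_def subring_set_def using inv by auto
qed

lemma adjoin_conv_polys_over: "adjoin K z = (\<lambda>A. poly A z) ` polys_over K"
  by (auto simp: adjoin_def range_coeff_subset_iff)

lemma adjoin_base: "subring_set K \<Longrightarrow> K \<subseteq> adjoin K z"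
proof
  fix a assume "subring_set K" "a \<in> K"
  then have "[:a:] \<in> polys_over K" by (rule const_in_polys_over)
  then show "a \<in> adjoin K z" unfolding adjoin_conv_polys_over
    by (intro image_eqI[of _ _ "[:a:]"]) auto
qed

lemma adjoin_generator: "subring_set K \<Longrightarrow> z \<in> adjoin K z"
proof -
  assume "subring_set K"
  then have "[:0, 1:] \<in> polys_over K"
    by (simp add: pCons_in_polys_over subring_setD subring_set_0 subring_polys_over)
  then show ?thesis unfolding adjoin_conv_polys_over
    by (intro image_eqI[of _ _ "[:0, 1:]"]) auto
qed

lemma subring_adjoin:
  assumes "subring_set K" shows "subring_set (adjoin K z)"
proof -
  note SP = subring_polys_over[OF assms]
  show ?thesis
    unfolding subring_set_def adjoin_conv_polys_over
  proof (intro conjI ballI)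
    show "1 \<in> (\<lambda>A. poly A z) ` polys_over K" using subring_setD(1)[OF SP] by (metis imageI poly_1)
  next
    fix a assume "a \<in> (\<lambda>A. poly A z) ` polys_over K"
    then show "- a \<in> (\<lambda>A. poly A z) ` polys_over K"
      using subring_setD(2)[OF SP] by (auto simp: image_iff) (metis poly_minus)
  next
    fix a b assume "a \<in> (\<lambda>A. poly A z) ` polys_over K" "b \<in> (\<lambda>A. poly A z) ` polys_over K"
    then obtain A B where "A \<in> polys_over K" "B \<in> polys_over K" "a = poly A z" "b = poly B z"
      by blast
    then show "a + b \<in> (\<lambda>A. poly A z) ` polys_over K" "a * b \<in> (\<lambda>A. poly A z) ` polys_over K"
      using subring_setD(3,4)[OF SP]
      by (intro image_eqI[of _ _ "A + B"] image_eqI[of _ _ "A * B"]; simp)+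
  qed
qed

lemma adjoin_reduce:
  assumes K: "subfield_set K" and P: "irreducible_over K P" "poly P z = 0" and a: "a \<in> adjoin K z"
  obtains A where "A \<in> polys_over K" "degree A < degree P" "a = poly A z"
proof -
  obtain B where B: "B \<in> polys_over K" "a = poly B z" using a by (auto simp: adjoin_conv_polys_over)
  have PK: "P \<in> polys_over K" "degree P > 0" "P \<noteq> 0"
    using P by (auto simp: irreducible_over_def range_coeff_subset_iff)
  obtain Q R where "Q \<in> polys_over K" and R: "R \<in> polys_over K" and B': "B = P * Q + R"
    and "R = 0 \<or> degree R < degree P"
    by (rule subfield_polys_division[OF K PK(1,3) B(1)])
  then have "degree R < degree P" using PK(2) by auto
  moreover have "a = poly R z" using B(2) B' P(2) by simp
  ultimately show ?thesis using that R by blast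
qed

lemma subfield_adjoin:
  assumes K: "subfield_set K" and P: "irreducible_over K P" "poly P z = 0"
  shows "subfield_set (adjoin K z)"
  unfolding subfield_set_def
proof (intro conjI ballI)
  note S = subfield_setD(1)[OF K]
  show SA: "subring_set (adjoin K z)" by (rule subring_adjoin[OF S])
  have PK: "P \<in> polys_over K" using P by (simp add: irreducible_over_def range_coeff_subset_iff)
  \<comment> \<open>Euclid's algorithm: writing P = A Q + R gives A(z) Q(z) = - R(z), and R(z) is
    nonzero and already invertible by induction on the degree.\<close>
  have *: "inverse (poly A z) \<in> adjoin K z" if "A \<in> polys_over K" "degree A < degree P" for A
    using that
  proof (induction "degree A" arbitrary: A rule: less_induct)
    case less
    show ?case
    proof (cases "degree A = 0")
      case True
      then obtain a where "A = [:a:]" by (rule degree_eq_zeroE)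
      then show ?thesis using less.prems adjoin_base[OF S] subfield_setD(2)[OF K]
        by (auto simp: pCons_in_polys_over)
    next
      case False
      then have "A \<noteq> 0" by auto
      then obtain Q R where QR: "Q \<in> polys_over K" "R \<in> polys_over K" "P = A * Q + R"
        "R = 0 \<or> degree R < degree A"
        using subfield_polys_division[OF K less.prems(1) _ PK] by blast
      have "R \<noteq> 0"
      proof
        assume "R = 0"
        then have "P = A * Q" using QR by simp
        then have "degree Q = 0"
          using irreducible_overD[OF P(1) less.prems(1) QR(1)] False by blast
        then have "degree P \<le> degree A" using \<open>P = A * Q\<close> degree_mult_le[of A Q] by simp
        then show False using less.prems by simp
      qed
      then have R: "degree R < degree A" using QR by simp
      have "poly R z \<noteq> 0"
        using irreducible_over_min_degree[OF K P QR(2)] R less.prems \<open>R \<noteq> 0\<close> by auto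
      moreover have "poly A z * poly Q z = - poly R z"
        using P(2) QR(3) by (simp add: eq_neg_iff_add_eq_0)
      ultimately have "poly A z * (- poly Q z * inverse (poly R z)) = 1"
        by (simp flip: mult.assoc)
      then have "inverse (poly A z) = - poly Q z * inverse (poly R z)"
        by (intro inverse_unique) simp
      moreover have "inverse (poly R z) \<in> adjoin K z"
        using less.hyps[OF R QR(2)] R less.prems by simp
      moreover have "poly Q z \<in> adjoin K z" using QR(1) by (auto simp: adjoin_conv_polys_over)
      ultimately show ?thesis using subring_setD(2,4)[OF SA] by simp
    qed
  qed
  fix a assume "a \<in> adjoin K z"
  then show "inverse a \<in> adjoin K z" by (rule adjoin_reduce[OF K P]) (simp add: *)
qed

text \<open>A relation between these powers is a polynomial vanishing at \<open>z\<close> of degree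
  below that of \<open>P\<close>. This independence is what splits relations level by level in
  \<open>free_products_Suc\<close>.\<close>

lemma adjoin_powers_free:
  assumes K: "subfield_set K" and P: "irreducible_over K P" "poly P z = 0"
    and a: "\<And>i. i < degree P \<Longrightarrow> a i \<in> K" and 0: "(\<Sum>i<degree P. a i * z ^ i) = 0"
    and i: "i < degree P"
  shows "a i = 0"
proof -
  define A where "A = (\<Sum>i<degree P. monom (a i) i)"
  note S = subfield_setD(1)[OF K]
  have "monom (a i) i \<in> polys_over K" if "i \<in> {..<degree P}" for i
    using monom_in_polys_over[OF S] a that by simp
  then have "A \<in> polys_over K" unfolding A_def by (rule subring_set_sum[OF subring_polys_over[OF S]])
  moreover have "degree A < degree P"
  proof -
    have "degree A \<le> degree P - 1" unfolding A_def
    proof (rule degree_sum_le)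
      fix j assume "j \<in> {..<degree P}"
      then show "degree (monom (a j) j) \<le> degree P - 1" using degree_monom_le[of "a j" j] by simp
    qed simp
    then show ?thesis using i by simp
  qed
  moreover have "poly A z = 0" using 0 by (simp add: A_def poly_sum poly_monom)
  ultimately have "A = 0" using irreducible_over_min_degree[OF K P] by blast
  moreover have "coeff A i = a i" using i by (simp add: A_def coeff_sum)
  ultimately show ?thesis by simp
qed

section \<open>Reduction modulo \<open>x\<close> and multiplicities\<close>

lemma ring_hom_fun_fps_compose:
  assumes "fps_nth X 0 = 0" shows "ring_hom_fun (\<lambda>a :: 'a::idom fps. a oo X)"
  using assms by (simp add: ring_hom_fun_def fps_compose_add_distrib fps_compose_mult_distrib)

lemma fps_monomial_power: "(fps_const \<zeta> * fps_X ^ q) ^ i = fps_const (\<zeta> ^ i :: 'a::comm_ring_1) * fps_X ^ (q * i)"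
  by (simp add: power_mult_distrib fps_const_power power_mult)

lemma fps_nth_compose_monomial:
  assumes "q > 0"
  shows "fps_nth (a oo (fps_const \<zeta> * fps_X ^ q)) n =
    (if q dvd n then fps_nth a (n div q) * \<zeta> ^ (n div q) else (0::'a::comm_ring_1))"
proof -
  have "fps_nth (a oo (fps_const \<zeta> * fps_X ^ q)) n =
      (\<Sum>i\<in>{0..n}. if n = q * i then fps_nth a i * \<zeta> ^ i else 0)"
    unfolding fps_compose_nth fps_monomial_power
    by (intro sum.cong refl) (simp add: fps_X_power_nth)
  also have "\<dots> = (if q dvd n then fps_nth a (n div q) * \<zeta> ^ (n div q) else 0)"
  proof (cases "q dvd n")
    case True
    then obtain j where j: "n = q * j" by auto
    then have "(\<Sum>i\<in>{0..n}. if n = q * i then fps_nth a i * \<zeta> ^ i else 0) =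
        (\<Sum>i\<in>{0..n}. if i = j then fps_nth a i * \<zeta> ^ i else 0)"
      using assms by (intro sum.cong) auto
    then show ?thesis using j assms by simp
  next
    case False
    then show ?thesis by (auto intro!: sum.neutral)
  qed
  finally show ?thesis .
qed

lemma fps_compose_monomial_in_fps_over:
  assumes "subring_set R" "q > 0" "\<zeta> \<in> R" "a \<in> fps_over R"
  shows "a oo (fps_const \<zeta> * fps_X ^ q) \<in> fps_over R"
  using assms subring_set_0[OF assms(1)] subring_set_power[OF assms(1)] subring_setD[OF assms(1)]
  by (auto simp: fps_over_def fps_nth_compose_monomial)

lemma fps_compose_monomial_compose_monomial:
  assumes "q > 0"
  shows "(fps_const \<mu> * fps_X ^ e) oo (fps_const \<zeta> * fps_X ^ q :: 'a::idom fps) =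
    fps_const (\<mu> * \<zeta> ^ e) * fps_X ^ (e * q)"
  using assms
  by (simp add: fps_compose_mult_distrib fps_X_power_compose fps_monomial_power mult_ac
      flip: fps_const_mult)


definition red :: "'a::comm_ring_1 fps poly \<Rightarrow> 'a poly" where
  "red A = map_poly (\<lambda>a. fps_nth a 0) A"

lemma ring_hom_fun_fps_nth_0: "ring_hom_fun (\<lambda>a :: 'a::comm_ring_1 fps. fps_nth a 0)"
  by (simp add: ring_hom_fun_def)

lemma coeff_red [simp]: "coeff (red A) i = fps_nth (coeff A i) 0"
  by (simp add: red_def coeff_map_poly)

lemma red_0 [simp]: "red 0 = 0"
  by (simp add: red_def)

lemma red_1 [simp]: "red 1 = 1"
  by (simp add: red_def)

lemma red_pCons [simp]: "red (pCons a A) = pCons (fps_nth a 0) (red A)"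
  by (rule poly_eqI) (simp add: coeff_pCons split: nat.splits)

lemma red_conv_poly_subst: "red A = poly_subst (\<lambda>a. fps_nth a 0) [:0, 1:] A"
  by (simp add: red_def map_poly_conv_poly_subst)

lemma red_mult: "red (A * B) = red A * red B"
  by (simp add: red_conv_poly_subst poly_subst_mult[OF ring_hom_fun_fps_nth_0])

lemma red_power: "red (A ^ n) = red A ^ n"
  by (induction n) (simp_all add: red_mult)

lemma red_smult: "red (smult a A) = smult (fps_nth a 0) (red A)"
  by (rule poly_eqI) simp

lemma red_poly_subst:
  assumes "ring_hom_fun h" "\<And>a. fps_nth (h a) 0 = fps_nth a 0"
  shows "red (poly_subst h Y A) = red A \<circ>\<^sub>p red Y"
proof -
  have "red (poly_subst h Y A) = poly_subst (\<lambda>a. fps_nth (h a) 0) (red Y) A"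
    by (simp add: red_conv_poly_subst poly_subst_poly_subst assms ring_hom_fun_fps_nth_0)
  then show ?thesis by (simp add: assms(2) poly_subst_def red_def)
qed

lemma red_pcompose: "red (A \<circ>\<^sub>p Y) = red A \<circ>\<^sub>p red Y"
  by (simp add: pcompose_conv_poly_subst[of A] red_poly_subst[OF ring_hom_fun_id])

text \<open>Dividing by the least power of x that occurs anywhere leaves some coefficient with a
  constant term. By \<open>poly_val_smult_fps_X_power\<close> the exponent is the
  x-valuation.\<close>

lemma fps_poly_primitive_part:
  fixes E :: "'a::field fps poly"
  assumes "E \<noteq> 0"
  obtains w D where "E = smult (fps_X ^ w) D" "red D \<noteq> 0"
proof -
  define Q where "Q j \<longleftrightarrow> (\<exists>i. fps_nth (coeff E i) j \<noteq> 0)" for j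
  obtain i where "coeff E i \<noteq> 0" using assms by (auto simp: poly_eq_iff)
  then obtain j where "Q j" by (auto simp: fps_eq_iff Q_def)
  define w where "w = (LEAST j. Q j)"
  have w: "Q w" "\<And>j. j < w \<Longrightarrow> \<not> Q j"
    unfolding w_def by (rule LeastI[of Q, OF \<open>Q j\<close>], rule not_less_Least)
  define D where "D = map_poly (fps_shift w) E"
  have "coeff E i = fps_X ^ w * coeff D i" for i
    using w(2) by (intro fps_ext) (auto simp: D_def coeff_map_poly fps_X_power_mult_nth Q_def)
  then have "E = smult (fps_X ^ w) D" by (intro poly_eqI) simp
  moreover have "red D \<noteq> 0"
    using w(1) by (auto simp: Q_def poly_eq_iff D_def coeff_map_poly)
  ultimately show ?thesis by (rule that)
qed

lemma smult_fps_X_power_in_polys_over: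
  assumes "smult (fps_X ^ w) D \<in> polys_over (fps_over K)"
  shows "D \<in> polys_over (fps_over (K :: 'a::field set))"
proof -
  have "fps_nth (coeff D i) j \<in> K" for i j
  proof -
    have "fps_nth (coeff (smult (fps_X ^ w) D) i) (j + w) \<in> K"
      using assms by (simp add: polys_over_def fps_over_def)
    then show ?thesis by (simp add: fps_X_power_mult_nth)
  qed
  then show ?thesis by (simp add: polys_over_def fps_over_def)
qed

lemma poly_val_smult_fps_X_power:
  fixes D :: "'a::field fps poly"
  assumes "red D \<noteq> 0"
  shows "poly_val (smult (fps_X ^ w) D) = enat w"
proof -
  obtain i where i: "fps_nth (coeff D i) 0 \<noteq> 0" using assms by (auto simp: poly_eq_iff)
  have lower: "enat w \<le> fps_val (coeff (smult (fps_X ^ w) D) j)" for j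
    by (auto simp: fps_val_def)
  have attained: "fps_val (coeff (smult (fps_X ^ w) D) i) = enat w"
    using i by (auto simp: fps_val_def subdegree_eq_0_iff)
  show ?thesis
    unfolding poly_val_def
  proof (rule antisym)
    show "(INF j. fps_val (coeff (smult (fps_X ^ w) D) j)) \<le> enat w"
      unfolding attained[symmetric] by (rule INF_lower) simp
  qed (rule INF_greatest, rule lower)
qed


section \<open>Orders of vanishing of polynomials in one variable\<close>

lemma order_eq_1I:
  fixes p :: "'a::idom poly"
  assumes "poly p a = 0" "poly (pderiv p) a \<noteq> 0"
  shows "order a p = 1"
proof -
  have "p \<noteq> 0" using assms by auto
  moreover have "\<not> [:- a, 1:] ^ 2 dvd p"
  proof
    assume "[:- a, 1:] ^ 2 dvd p"
    then obtain u where "p = [:- a, 1:] ^ 2 * u" by (rule dvdE)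
    then have "p = [:- a, 1:] * ([:- a, 1:] * u)" by (simp only: power2_eq_square mult.assoc)
    then have "poly (pderiv p) a = 0" by (simp only: pderiv_mult poly_add poly_mult) simp
    then show False using assms(2) by simp
  qed
  ultimately have "\<not> 2 \<le> order a p" "order a p \<noteq> 0"
    using assms(1) by (auto simp: order_divides order_root)
  then show ?thesis by simp
qed

lemma order_power:
  fixes p :: "'a::idom poly"
  shows "p \<noteq> 0 \<Longrightarrow> order a (p ^ n) = n * order a p"
  by (induction n) (auto simp: order_mult order_0I)

lemma pcompose_power: "(p ^ n) \<circ>\<^sub>p u = (p \<circ>\<^sub>p u) ^ n" for p :: "'a::comm_ring_1 poly"
  by (induction n) (simp_all add: pcompose_mult pcompose_1)

lemma order_pcompose_translate:
  fixes p :: "'a::idom poly"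
  assumes "p \<noteq> 0"
  shows "order 0 (p \<circ>\<^sub>p [:\<eta>, 1:]) = order \<eta> p"
proof -
  obtain u where u: "p = [:- \<eta>, 1:] ^ order \<eta> p * u" "\<not> [:- \<eta>, 1:] dvd u"
    using order_decomp[OF assms] by blast
  have "p \<circ>\<^sub>p [:\<eta>, 1:] = ([:- \<eta>, 1:] ^ order \<eta> p * u) \<circ>\<^sub>p [:\<eta>, 1:]"
    by (subst u(1)) (rule refl)
  also have "\<dots> = [:0, 1:] ^ order \<eta> p * (u \<circ>\<^sub>p [:\<eta>, 1:])"
    by (simp add: pcompose_mult pcompose_power pcompose_pCons)
  finally have 1: "p \<circ>\<^sub>p [:\<eta>, 1:] = [:0, 1:] ^ order \<eta> p * (u \<circ>\<^sub>p [:\<eta>, 1:])" .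
  have 2: "poly (u \<circ>\<^sub>p [:\<eta>, 1:]) 0 \<noteq> 0" using u(2) by (simp add: poly_pcompose poly_eq_0_iff_dvd)
  then have "u \<circ>\<^sub>p [:\<eta>, 1:] \<noteq> 0" by auto
  then show ?thesis
    unfolding 1 using 2 order_power_n_n[of 0 "order \<eta> p"] by (simp add: order_mult order_0I)
qed

lemma coeff_pcompose_monom:
  assumes "q > 0"
  shows "coeff (R \<circ>\<^sub>p monom u q) j = (if q dvd j then coeff R (j div q) * u ^ (j div q) else (0::'a::comm_ring_1))"
proof (induction R arbitrary: j)
  case (pCons a R)
  show ?case
  proof (cases "j < q")
    case True
    then show ?thesis using assms
      by (auto simp: pcompose_pCons coeff_monom_mult coeff_pCons dvd_imp_le split: nat.splits dest: dvd_imp_le)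
  next
    case False
    then have "j div q = Suc ((j - q) div q)" using assms by (simp add: le_div_geq)
    then show ?thesis using False assms pCons.IH[of "j - q"]
      by (auto simp: pcompose_pCons coeff_monom_mult coeff_pCons mult_ac dvd_minus_self split: nat.splits)
  qed
qed simp

lemma coeff_poly_subst_monomial:
  assumes "ring_hom_fun h"
  shows "coeff (poly_subst h [:0, b:] A) i = h (coeff A i) * b ^ i"
proof (induction A arbitrary: i)
  case (pCons a A)
  then show ?case by (cases i) (simp_all add: poly_subst_pCons[OF assms] mult_ac coeff_pCons)
qed (simp add: ring_hom_funD[OF assms])

text \<open>A polynomial over \<open>K\<close> that vanishes at \<open>z\<close> is divisible by
  \<open>P\<close>, since the remainder has too small a degree. Factors \<open>P\<close> are removed
  until the value at \<open>z\<close> is nonzero.\<close>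

lemma irreducible_over_multiplicity:
  assumes K: "subfield_set K" and P: "irreducible_over K P" "poly P z = 0"
    and R: "R \<in> polys_over K" "R \<noteq> 0"
  obtains r R' where "R = P ^ r * R'" "R' \<in> polys_over K" "poly R' z \<noteq> 0"
proof -
  have PK: "P \<in> polys_over K" "degree P > 0" "P \<noteq> 0"
    using P by (auto simp: irreducible_over_def range_coeff_subset_iff)
  have "\<exists>r R'. R = P ^ r * R' \<and> R' \<in> polys_over K \<and> poly R' z \<noteq> 0"
    using R
  proof (induction "degree R" arbitrary: R rule: less_induct)
    case less
    show ?case
    proof (cases "poly R z = 0")
      case True
      obtain Q S where QS: "Q \<in> polys_over K" "S \<in> polys_over K" "R = P * Q + S"
        "S = 0 \<or> degree S < degree P"
        by (rule subfield_polys_division[OF K PK(1,3) less.prems(1)])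
      have "poly S z = 0" using True P(2) QS(3) by simp
      then have "S = 0" using irreducible_over_min_degree[OF K P QS(2)] QS(4) by blast
      then have R: "R = P * Q" using QS by simp
      then have "Q \<noteq> 0" using less.prems by auto
      then have "degree Q < degree R" using R PK by (simp add: degree_mult_eq)
      then obtain r R' where "Q = P ^ r * R'" "R' \<in> polys_over K" "poly R' z \<noteq> 0"
        using less.hyps[OF _ QS(1) \<open>Q \<noteq> 0\<close>] by blast
      then show ?thesis using R by (intro exI[of _ "Suc r"] exI[of _ R']) (simp add: mult.assoc)
    next
      case False
      then show ?thesis using less.prems by (intro exI[of _ 0] exI[of _ R]) simp
    qed
  qed
  then show ?thesis using that by blast
qed

text \<open>
  The monomials of \<open>W(\<zeta> x\<^sup>q, x\<^sup>m Y)\<close> of least \<open>x\<close>-order form \<open>\<zeta>\<^sup>b Y\<^sup>a R(Y\<^sup>q/\<zeta>\<^sup>m)\<close> with \<open>R\<close> over \<open>K\<close> and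
  \<open>a + q deg R\<close> at most the order of \<open>W(0,y)\<close>. Since \<open>\<eta>\<^sup>q/\<zeta>\<^sup>m = z\<close>, the order at \<open>\<eta>\<close> is the multiplicity of \<open>P\<close> in \<open>R\<close>.
\<close>

lemma order_red_sigma_transform:
  fixes W :: "'a::field fps poly" and s t :: int
  assumes K: "subfield_set K" and W: "W \<in> polys_over (fps_over K)" "red W \<noteq> 0"
    and P: "irreducible_over K P" "poly P z = 0" "poly (pderiv P) z \<noteq> 0" "z \<noteq> 0"
    and q: "q > 0" "of_nat q \<noteq> (0::'a)" and m: "m > 0"
    and st: "int q * s - t * int m = 1"
    and c: "fps_nth c 0 = 0"
  obtains w W1 where
    "subst_xy (fps_const (z powi t) * fps_X ^ q)
       [:fps_X ^ m * (fps_const (z powi s) + c), fps_X ^ m:] W = smult (fps_X ^ w) W1"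
    "red W1 \<noteq> 0" "order 0 (red W1) * (q * degree P) \<le> order 0 (red W)"
proof -
  define \<zeta> \<eta> where "\<zeta> = z powi t" and "\<eta> = z powi s"
  have nz: "\<zeta> \<noteq> 0" "\<eta> \<noteq> 0" using P(4) by (auto simp: \<zeta>_def \<eta>_def)
  have "\<eta> ^ q = z powi (s * int q)"
    by (simp add: \<eta>_def power_int_mult)
  also have "s * int q = 1 + t * int m" using st by (simp add: algebra_simps)
  also have "z powi \<dots> = z * \<zeta> ^ m"
    using P(4) by (simp add: \<zeta>_def power_int_add power_int_mult)
  finally have \<eta>q: "\<eta> ^ q = z * \<zeta> ^ m" .
  define X where "X = fps_const \<zeta> * fps_X ^ q"
  have X0: "fps_nth X 0 = 0" using q by (simp add: X_def)
  note hX = ring_hom_fun_fps_compose[OF X0]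
  define n where "n = order 0 (red W)"
  have Wn: "fps_nth (coeff W n) 0 \<noteq> 0"
  proof -
    have "\<not> monom 1 (Suc n) dvd red W" "monom 1 n dvd red W"
      using W(2) by (auto simp: n_def monom_1_dvd_iff)
    then show ?thesis by (auto simp: monom_1_dvd_iff' less_Suc_eq)
  qed
  \<comment> \<open>The transform is split into the scaling by (\<zeta> x^q, x^m y) and a
    translation in y. After the scaling alone the lattice of exponents is still visible.\<close>
  define E where "E = poly_subst (\<lambda>a. a oo X) [:0, fps_X ^ m:] W"
  have E: "coeff E a = (coeff W a oo X) * fps_X ^ (m * a)" for a
    by (simp add: E_def coeff_poly_subst_monomial[OF hX] power_mult)
  have subst: "subst_xy X [:fps_X ^ m * (fps_const \<eta> + c), fps_X ^ m:] W = E \<circ>\<^sub>p [:fps_const \<eta> + c, 1:]"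
    by (simp add: E_def subst_xy_def poly_subst_def pcompose_assoc[symmetric] pcompose_pCons)
  have En: "fps_nth (coeff E n) (m * n) \<noteq> 0"
    using Wn by (simp add: E fps_X_power_mult_right_nth)
  then have "E \<noteq> 0" by auto
  then obtain w D where D: "E = smult (fps_X ^ w) D" "red D \<noteq> 0" by (rule fps_poly_primitive_part)
  define p where "p = red D"
  \<comment> \<open>W(0,y) contains y^n, which contributes a term x^(m n) y^n to
    \<open>E\<close>.\<close>
  have wn: "w \<le> m * n"
  proof (rule ccontr)
    assume "\<not> w \<le> m * n"
    then show False using En by (simp add: D(1) fps_X_power_mult_nth)
  qed
  \<comment> \<open>\<open>p\<close> collects the terms x^b y^a of \<open>W\<close> on the line m a
    + q b = w, each weighted by \<zeta>^b.\<close>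
  have p: "coeff p a = (if m * a \<le> w \<and> q dvd (w - m * a)
      then fps_nth (coeff W a) ((w - m * a) div q) * \<zeta> ^ ((w - m * a) div q) else 0)" for a
  proof -
    have "coeff p a = fps_nth (coeff E a) w" by (simp add: p_def D(1) fps_X_power_mult_nth)
    then show ?thesis
      by (auto simp: E fps_X_power_mult_right_nth X_def fps_nth_compose_monomial[OF q(1)])
  qed
  obtain a0 where a0: "coeff p a0 \<noteq> 0" "\<And>a. coeff p a \<noteq> 0 \<Longrightarrow> a0 \<le> a"
  proof -
    obtain a where "coeff p a \<noteq> 0" using D(2) by (auto simp: p_def poly_eq_iff)
    then show ?thesis
      by (intro that[of "LEAST a. coeff p a \<noteq> 0"]) (rule LeastI, assumption, rule Least_le)
  qed
  define b0 where "b0 = (w - m * a0) div q"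
  have w: "w = m * a0 + q * b0"
    using a0(1) by (auto simp: p b0_def split: if_splits)
  have copr: "coprime (int q) (int m)"
  proof (rule coprimeI)
    fix d assume "d dvd int q" "d dvd int m"
    then have "d dvd int q * s - t * int m" by simp
    then show "is_unit d" using st by simp
  qed
  \<comment> \<open>As q and m are coprime, the points of the line that can occur are (a0 + q
    \<alpha>, b0 - m \<alpha>), and \<open>R\<close> lists the coefficients there. The guard is
    needed because natural subtraction truncates.\<close>
  define R where "R = (\<Sum>\<alpha>\<le>b0. monom (if m * \<alpha> \<le> b0
      then fps_nth (coeff W (a0 + q * \<alpha>)) (b0 - m * \<alpha>) else 0) \<alpha>)"
  have R: "coeff R \<alpha> = (if m * \<alpha> \<le> b0 then fps_nth (coeff W (a0 + q * \<alpha>)) (b0 - m * \<alpha>) else 0)" for \<alpha>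
  proof -
    have "\<alpha> \<le> m * \<alpha>" using m by simp
    then have "m * \<alpha> \<le> b0 \<Longrightarrow> \<alpha> \<le> b0" by (rule order.trans)
    then show ?thesis by (auto simp: R_def coeff_sum)
  qed
  define u where "u = inverse (\<zeta> ^ m)"
  have pR: "coeff p (a0 + q * \<alpha>) = \<zeta> ^ b0 * (coeff R \<alpha> * u ^ \<alpha>)" for \<alpha>
  proof -
    have 1: "m * (a0 + q * \<alpha>) \<le> w \<longleftrightarrow> m * \<alpha> \<le> b0"
    proof -
      have "m * (a0 + q * \<alpha>) \<le> w \<longleftrightarrow> q * (m * \<alpha>) \<le> q * b0" by (simp add: w algebra_simps)
      then show ?thesis using q by simp
    qed
    have 2: "w - m * (a0 + q * \<alpha>) = q * (b0 - m * \<alpha>)"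
      by (simp add: w algebra_simps diff_mult_distrib2)
    have "\<zeta> ^ (b0 - m * \<alpha>) = \<zeta> ^ b0 * u ^ \<alpha>" if "m * \<alpha> \<le> b0"
      using that nz by (simp add: u_def power_diff power_inverse divide_inverse flip: power_mult)
    then show ?thesis unfolding p 1 2 R using q by simp
  qed
  define M where "M = monom u q"
  have pRM: "p = smult (\<zeta> ^ b0) (monom 1 a0 * (R \<circ>\<^sub>p M))"
  proof (rule poly_eqI)
    fix a
    show "coeff p a = coeff (smult (\<zeta> ^ b0) (monom 1 a0 * (R \<circ>\<^sub>p M))) a"
    proof (cases "a0 \<le> a \<and> q dvd a - a0")
      case True
      then obtain \<alpha> where "a = a0 + q * \<alpha>" by (metis dvdE le_add_diff_inverse)
      then show ?thesis
        using q by (simp add: pR coeff_monom_mult M_def coeff_pcompose_monom)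
    next
      case False
      have "coeff p a = 0"
      proof (rule ccontr)
        assume nz: "coeff p a \<noteq> 0"
        then have "a0 \<le> a" using a0(2) by simp
        have "m * a \<le> w" "q dvd w - m * a" using nz by (auto simp: p split: if_splits)
        then have "int q dvd int w - int m * int a"
          by (metis int_dvd_int_iff of_nat_diff of_nat_mult)
        then have "int q dvd (int m * int a0 + int q * int b0) - int m * int a" by (simp add: w)
        moreover have "int q dvd int q * int b0" by simp
        ultimately have "int q dvd int q * int b0 - ((int m * int a0 + int q * int b0) - int m * int a)"
          by (rule dvd_diff[rotated])
        also have "\<dots> = int m * int (a - a0)" using \<open>a0 \<le> a\<close> by (simp add: algebra_simps of_nat_diff)
        finally have "int q dvd int (a - a0)" using copr by (simp add: coprime_dvd_mult_right_iff)
        then have "q dvd a - a0" by (simp only: int_dvd_int_iff)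
        then show False using False \<open>a0 \<le> a\<close> by simp
      qed
      moreover have "coeff (smult (\<zeta> ^ b0) (monom 1 a0 * (R \<circ>\<^sub>p M))) a = 0"
        using False q by (auto simp: coeff_monom_mult M_def coeff_pcompose_monom)
      ultimately show ?thesis by simp
    qed
  qed
  have "p \<noteq> 0" using D(2) by (simp add: p_def)
  then have "R \<noteq> 0" using pRM by auto
  have RK: "R \<in> polys_over K"
    using W(1) subring_set_0[OF subfield_setD(1)[OF K]] by (auto simp: polys_over_def fps_over_def R)
  \<comment> \<open>The leading term of \<open>R\<close> sits at a point of the line, whose first
    coordinate times m is at most w and hence at most m n.\<close>
  have degR: "q * degree R \<le> n"
  proof -
    have "coeff p (a0 + q * degree R) \<noteq> 0"
      using nz \<open>R \<noteq> 0\<close> by (simp add: pR u_def)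
    then have "m * (a0 + q * degree R) \<le> w" by (auto simp: p split: if_splits)
    then have "m * (a0 + q * degree R) \<le> m * n" using wn by (rule order.trans)
    then show ?thesis using m by simp
  qed
  obtain r R' where R': "R = P ^ r * R'" "R' \<in> polys_over K" "poly R' z \<noteq> 0"
    by (rule irreducible_over_multiplicity[OF K P(1,2) RK \<open>R \<noteq> 0\<close>])
  have "R' \<noteq> 0" "P \<noteq> 0" using R' P by auto
  have M\<eta>: "poly M \<eta> = z" using nz by (simp add: M_def poly_monom \<eta>q u_def)
  \<comment> \<open>The map M(y) = y^q / \<zeta>^m is unramified at \<eta>, since q is nonzero in
    the field and \<eta> is nonzero. With separability of \<open>P\<close> at \<open>z\<close>, the
    composite has a simple root at \<eta>, so multiplicities are preserved exactly.\<close>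
  have "poly (pderiv M) \<eta> \<noteq> 0"
    using nz q by (simp add: M_def pderiv_monom poly_monom u_def)
  then have dPM: "poly (pderiv (P \<circ>\<^sub>p M)) \<eta> \<noteq> 0"
    using P(3) by (simp add: pderiv_pcompose poly_pcompose M\<eta>)
  then have "order \<eta> (P \<circ>\<^sub>p M) = 1"
    using P(2) by (intro order_eq_1I) (simp_all add: poly_pcompose M\<eta>)
  moreover have RM: "R \<circ>\<^sub>p M = (P \<circ>\<^sub>p M) ^ r * (R' \<circ>\<^sub>p M)"
    by (simp add: R'(1) pcompose_mult pcompose_power)
  moreover have "R \<circ>\<^sub>p M \<noteq> 0" using \<open>p \<noteq> 0\<close> pRM by auto
  moreover have "order \<eta> (R' \<circ>\<^sub>p M) = 0"
    using R'(3) by (intro order_0I) (simp add: poly_pcompose M\<eta>)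
  moreover have "P \<circ>\<^sub>p M \<noteq> 0" using dPM by auto
  ultimately have oR: "order \<eta> (R \<circ>\<^sub>p M) = r"
    by (simp add: order_mult order_power)
  have "order \<eta> (monom 1 a0) = 0" using nz by (intro order_0I) (simp add: poly_monom)
  then have op: "order \<eta> p = r"
    using \<open>R \<circ>\<^sub>p M \<noteq> 0\<close> nz oR unfolding pRM
    by (subst order_smult) (auto simp: order_mult monom_eq_0_iff)
  \<comment> \<open>\<open>c\<close> has no constant term, so modulo x the translation is by \<eta>
    alone.\<close>
  have redD: "red (D \<circ>\<^sub>p [:fps_const \<eta> + c, 1:]) = p \<circ>\<^sub>p [:\<eta>, 1:]"
    using c by (simp add: red_pcompose p_def)
  then have o1: "order 0 (red (D \<circ>\<^sub>p [:fps_const \<eta> + c, 1:])) = r"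
    using op order_pcompose_translate[OF \<open>p \<noteq> 0\<close>] by simp
  have "p \<circ>\<^sub>p [:\<eta>, 1:] \<noteq> 0" using \<open>p \<noteq> 0\<close> by (simp add: pcompose_eq_0_iff)
  have degP: "r * degree P \<le> degree R"
    using \<open>R' \<noteq> 0\<close> \<open>P \<noteq> 0\<close> by (simp add: R'(1) degree_mult_eq degree_power_eq)
  have "r * (q * degree P) \<le> q * degree R"
    using mult_le_mono2[OF degP, of q] by (simp add: mult_ac)
  then have rn: "r * (q * degree P) \<le> n" using degR by (rule order.trans)
  show ?thesis
  proof (rule that)
    show "subst_xy (fps_const (z powi t) * fps_X ^ q)
        [:fps_X ^ m * (fps_const (z powi s) + c), fps_X ^ m:] W =
        smult (fps_X ^ w) (D \<circ>\<^sub>p [:fps_const \<eta> + c, 1:])"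
      using subst by (simp add: X_def \<zeta>_def \<eta>_def D(1) pcompose_smult)
    show "red (D \<circ>\<^sub>p [:fps_const \<eta> + c, 1:]) \<noteq> 0"
      unfolding redD by fact
    show "order 0 (red (D \<circ>\<^sub>p [:fps_const \<eta> + c, 1:])) * (q * degree P) \<le> order 0 (red W)"
      using rn by (simp only: o1 n_def)
  qed
qed

section \<open>Newton polygons and Weierstrass polynomials\<close>

definition upward :: "(real \<times> real) set \<Rightarrow> (real \<times> real) set" where
  "upward C = {(u, v). \<exists>v'\<le>v. (u, v') \<in> C}"

lemma convex_upward:
  assumes "convex C" shows "convex (upward C)"
proof (rule convexI)
  fix x y and a b :: real
  assume xy: "x \<in> upward C" "y \<in> upward C" and ab: "0 \<le> a" "0 \<le> b" "a + b = 1"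
  obtain x1 x2 x' where x: "x = (x1, x2)" "x' \<le> x2" "(x1, x') \<in> C" using xy(1) by (auto simp: upward_def)
  obtain y1 y2 y' where y: "y = (y1, y2)" "y' \<le> y2" "(y1, y') \<in> C" using xy(2) by (auto simp: upward_def)
  have "a *\<^sub>R (x1, x') + b *\<^sub>R (y1, y') \<in> C" by (rule convexD[OF assms x(3) y(3) ab])
  moreover have "a * x' + b * y' \<le> a * x2 + b * y2"
    using x(2) y(2) ab by (intro add_mono mult_left_mono) auto
  ultimately show "a *\<^sub>R x + b *\<^sub>R y \<in> upward C" by (auto simp: upward_def x(1) y(1))
qed

text \<open>The lower hull depends only on the region above the convex hull. That region is convex,
  so inclusions between regions need to be tested on the generating points only.\<close>

lemma lower_convex_hull_eqI:
  assumes "A \<subseteq> upward (convex hull B)" "B \<subseteq> upward (convex hull A)"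
  shows "lower_convex_hull A = lower_convex_hull B"
proof -
  have sub: "lower_convex_hull A \<subseteq> lower_convex_hull B"
    if "A \<subseteq> upward (convex hull B)" "B \<subseteq> upward (convex hull A)" for A B
  proof -
    have 1: "convex hull A \<subseteq> upward (convex hull B)" "convex hull B \<subseteq> upward (convex hull A)"
      by (intro hull_minimal that convex_upward convex_convex_hull)+
    show ?thesis
    proof (rule subrelI)
      fix u v assume uv: "(u, v) \<in> lower_convex_hull A"
      then have v: "(u, v) \<in> convex hull A" "\<And>v'. (u, v') \<in> convex hull A \<Longrightarrow> v \<le> v'"
        by (auto simp: lower_convex_hull_def)
      obtain v' where v': "v' \<le> v" "(u, v') \<in> convex hull B"
        using 1(1) v(1) by (auto simp: upward_def)
      have min: "v \<le> w" if "(u, w) \<in> convex hull B" for w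
      proof -
        obtain w' where "w' \<le> w" "(u, w') \<in> convex hull A" using 1(2) \<open>(u, w) \<in> _\<close> by (auto simp: upward_def)
        then show ?thesis using v(2) by force
      qed
      have "v' = v" using min[OF v'(2)] v'(1) by simp
      then show "(u, v) \<in> lower_convex_hull B" using v'(2) min by (auto simp: lower_convex_hull_def)
    qed
  qed
  show ?thesis using sub[OF assms] sub[OF assms(2,1)] by simp
qed

text \<open>Componentwise domination alone is too weak, because the dominating point (a, b) may lie
  strictly to the left of i. The segment from (a, b) to the common point (N, 0) descends and passes
  over i at a height of at most b, hence at most r.\<close>

lemma dominated_subset_upward:
  fixes N :: real
  assumes "(N, 0) \<in> B"
    and "\<And>i r. (i, r) \<in> A \<Longrightarrow> i \<le> N \<and> 0 \<le> r \<and> (\<exists>a b. (a, b) \<in> B \<and> a \<le> i \<and> b \<le> r \<and> 0 \<le> b)"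
  shows "A \<subseteq> upward (convex hull B)"
proof (rule subrelI)
  fix i r assume "(i, r) \<in> A"
  then obtain a b where ab: "i \<le> N" "0 \<le> r" "(a, b) \<in> B" "a \<le> i" "b \<le> r" "0 \<le> b"
    using assms(2) by blast
  show "(i, r) \<in> upward (convex hull B)"
  proof (cases "a = N")
    case True
    then have "i = N" using ab by simp
    then show ?thesis using assms(1) ab(2) hull_inc[of _ B convex] by (auto simp: upward_def)
  next
    case False
    then have "a < N" using ab by simp
    define l where "l = (i - a) / (N - a)"
    have l: "0 \<le> l" "l \<le> 1" "(1 - l) * a + l * N = i"
      using ab \<open>a < N\<close> by (auto simp: l_def divide_simps) (simp_all add: algebra_simps)
    have "(1 - l) *\<^sub>R (a, b) + l *\<^sub>R (N, 0) \<in> convex hull B"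
      using l ab(3) assms(1) by (intro convexD[OF convex_convex_hull]) (auto intro: hull_inc)
    then have "(i, (1 - l) * b) \<in> convex hull B" using l by simp
    moreover have "(1 - l) * b \<le> r"
      using l ab mult_right_mono[of "1 - l" 1 b] by simp
    ultimately show ?thesis by (auto simp: upward_def)
  qed
qed

text \<open>The points that are lexicographically at least (x0, y0) form a convex set, so the hull
  acquires no point below (x0, y0) on its vertical line.\<close>

lemma leftmost_in_lower_convex_hull:
  assumes "(x0, y0) \<in> A" "\<And>u v. (u, v) \<in> A \<Longrightarrow> x0 < u \<or> u = x0 \<and> y0 \<le> v"
  shows "(x0, y0) \<in> lower_convex_hull A"
proof -
  let ?C = "{(u, v). x0 < u \<or> u = x0 \<and> y0 \<le> v} :: (real \<times> real) set"
  have "convex ?C"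
  proof (rule convexI)
    fix x y and a b :: real
    assume xy: "x \<in> ?C" "y \<in> ?C" and ab: "0 \<le> a" "0 \<le> b" "a + b = 1"
    obtain x1 x2 y1 y2 where [simp]: "x = (x1, x2)" "y = (y1, y2)" by (cases x, cases y)
    have b: "b = 1 - a" using ab by simp
    show "a *\<^sub>R x + b *\<^sub>R y \<in> ?C"
    proof (cases "a = 0 \<or> a = 1 \<or> x1 = x0 \<and> y1 = x0")
      case True
      have "y0 \<le> a * x2 + (1 - a) * y2" if "y0 \<le> x2" "y0 \<le> y2"
      proof -
        have "y0 = a * y0 + (1 - a) * y0" by (simp add: algebra_simps)
        also have "\<dots> \<le> a * x2 + (1 - a) * y2"
          using that ab by (intro add_mono mult_left_mono) auto
        finally show ?thesis .
      qed
      moreover have "a * x0 + (1 - a) * x0 = x0" by (simp add: algebra_simps)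
      ultimately show ?thesis using True xy by (auto simp: b)
    next
      case False
      then have a: "0 < a" "0 < 1 - a" using ab by auto
      have "x0 = a * x0 + (1 - a) * x0" by (simp add: algebra_simps)
      also have "\<dots> < a * x1 + (1 - a) * y1"
      proof (cases "x0 < x1")
        case True
        then show ?thesis using xy a by (intro add_less_le_mono mult_strict_left_mono mult_left_mono) auto
      next
        case x: False
        then have "x1 = x0" "x0 < y1" using xy False by auto
        then show ?thesis using a by simp
      qed
      finally show ?thesis by (simp add: b)
    qed
  qed
  then have "convex hull A \<subseteq> ?C" using assms(2) by (intro hull_minimal) auto
  then show ?thesis using hull_inc[OF assms(1), of convex] by (auto simp: lower_convex_hull_def)
qed

lemma rightmost_in_lower_convex_hull:
  assumes "(x0, 0) \<in> A" "\<And>u v. (u, v) \<in> A \<Longrightarrow> 0 \<le> v"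
  shows "(x0, 0) \<in> lower_convex_hull A"
proof -
  have "convex {(u, v :: real). 0 \<le> v} "
    by (auto simp: convex_def)
  then have "convex hull A \<subseteq> {(u, v). 0 \<le> v}" using assms(2) by (intro hull_minimal) auto
  then show ?thesis using hull_inc[OF assms(1), of convex] by (auto simp: lower_convex_hull_def)
qed

section \<open>Weierstrass polynomials and their edges\<close>

lemma finite_points_coeffs:
  "finite_points n (\<lambda>i. ereal_of_enat (fps_val (coeff H i))) =
    {(real i, real (subdegree (coeff H i))) | i. i \<le> n \<and> coeff H i \<noteq> 0}"
  by (force simp: finite_points_def fps_val_def split: if_splits)

lemma weierstrass_red:
  assumes "weierstrass H" shows "red H = monom 1 (degree H)"
proof (rule poly_eqI)
  fix i show "coeff (red H) i = coeff (monom 1 (degree H)) i"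
    using assms by (cases i "degree H" rule: linorder_cases) (auto simp: weierstrass_def coeff_eq_0)
qed

lemma weierstrassI:
  assumes "lead_coeff H = 1" "red H = monom 1 n" "degree H = n"
  shows "weierstrass H"
  unfolding weierstrass_def
proof (intro conjI allI impI)
  fix i assume "i < degree H"
  then have "coeff (red H) i = 0" using assms by simp
  then show "fps_nth (coeff H i) 0 = 0" by simp
qed (rule assms)

lemma weierstrass_pcompose_translate:
  fixes G :: "'a::field fps poly"
  assumes "weierstrass G" "fps_nth c 0 = 0"
  shows "weierstrass (G \<circ>\<^sub>p [:c, 1:])" "degree (G \<circ>\<^sub>p [:c, 1:]) = degree G"
proof -
  show deg: "degree (G \<circ>\<^sub>p [:c, 1:]) = degree G" by (simp add: degree_pcompose)
  have "lead_coeff (G \<circ>\<^sub>p [:c, 1:]) = 1"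
    using assms(1) by (subst lead_coeff_comp) (auto simp: weierstrass_def)
  moreover have "red (G \<circ>\<^sub>p [:c, 1:]) = monom 1 (degree G)"
    using assms by (simp add: red_pcompose weierstrass_red)
  ultimately show "weierstrass (G \<circ>\<^sub>p [:c, 1:])" using deg by (rule weierstrassI)
qed

lemma degree_edge_form:
  assumes "lead_coeff P = 1" "q > 0"
  shows "degree (edge_form q m P) = q * degree P" "edge_form q m P \<noteq> (0 :: 'a::field fps poly)"
proof -
  have "coeff (edge_form q m P) (q * degree P) =
      (\<Sum>i\<le>degree P. if i = degree P then fps_const (coeff P i) * fps_X ^ (m * (degree P - i)) else 0)"
    using assms(2) unfolding edge_form_def coeff_sum by (intro sum.cong) auto
  also have "\<dots> = 1" using assms(1) by simp
  finally have 1: "coeff (edge_form q m P) (q * degree P) = 1" .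
  have "degree (edge_form q m P) \<le> q * degree P"
    unfolding edge_form_def
  proof (rule degree_sum_le)
    fix i assume "i \<in> {..degree P}"
    then have "q * i \<le> q * degree P" by simp
    then show "degree (monom (fps_const (coeff P i) * fps_X ^ (m * (degree P - i))) (q * i)) \<le> q * degree P"
      by (rule order.trans[OF degree_monom_le])
  qed simp
  moreover have "q * degree P \<le> degree (edge_form q m P)" using 1 by (intro le_degree) simp
  ultimately show "degree (edge_form q m P) = q * degree P" by simp
  show "edge_form q m P \<noteq> 0" using 1 by auto
qed

lemma coeff_boundary_poly:
  "fps_nth (coeff (boundary_poly H) i) j =
    (if i \<le> degree H \<and> (real i, real j) \<in> newton_polygon H then fps_nth (coeff H i) j else 0)"
  by (simp add: boundary_poly_def coeff_sum fps_sum_nth)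

text \<open>The polygon contains (n, 0), where n is the degree, and, as \<open>H\<close> is not y^n,
  a leftmost point of positive height. A horizontal segment cannot contain both. If P(0) = 0,
  irreducibility forces P = Z, and the boundary polynomial becomes a power of y that misses the
  leftmost point. The product formula compares degrees in y.\<close>

lemma edge_data_weierstrass:
  fixes H :: "'a::field fps poly"
  assumes e: "edge_data K H q m P N" and H: "weierstrass H" "H \<noteq> monom 1 (degree H)"
    and K: "subring_set K"
  shows "0 < m" "coeff P 0 \<noteq> 0" "q * degree P * N = degree H"
proof -
  define n where "n = degree H"
  define A where "A = finite_points n (\<lambda>i. ereal_of_enat (fps_val (coeff H i)))"
  have NP: "newton_polygon H = lower_convex_hull A" by (simp add: newton_polygon_def A_def n_def)
  have A: "A = {(real i, real (subdegree (coeff H i))) | i. i \<le> n \<and> coeff H i \<noteq> 0}"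
    by (simp add: A_def finite_points_coeffs)
  have Hn: "coeff H n = 1" using H(1) by (simp add: weierstrass_def n_def)
  have "(real n, 0) \<in> A" using Hn by (force simp: A)
  then have right: "(real n, 0) \<in> newton_polygon H"
    unfolding NP by (rule rightmost_in_lower_convex_hull) (auto simp: A)
  have q: "q > 0" and P: "lead_coeff P = 1" "irreducible_over K P"
    and bd: "boundary_poly H = edge_form q m P ^ N"
    using e by (auto simp: edge_data_def)
  have "fps_nth (coeff (boundary_poly H) n) 0 = 1"
    using right Hn by (simp add: coeff_boundary_poly n_def)
  then have "n \<le> degree (boundary_poly H)" by (intro le_degree) auto
  moreover have "degree (boundary_poly H) \<le> n"
    by (rule degree_le) (auto simp: n_def coeff_boundary_poly fps_eq_iff)
  ultimately have degb: "degree (boundary_poly H) = n" by simp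
  then show deg: "q * degree P * N = degree H"
    using degree_edge_form[OF P(1) q, of m] by (simp add: bd degree_power_eq n_def mult_ac)
  define i0 where "i0 = (LEAST i. coeff H i \<noteq> 0)"
  have i0: "coeff H i0 \<noteq> 0" "\<And>i. coeff H i \<noteq> 0 \<Longrightarrow> i0 \<le> i"
    unfolding i0_def by (rule LeastI[of _ n], simp add: Hn, rule Least_le, assumption)
  have "i0 < n"
  proof (rule ccontr)
    assume "\<not> i0 < n"
    then have "coeff H i = 0" if "i < n" for i using i0(2)[of i] that by auto
    then have "H = monom 1 n"
      using Hn by (intro poly_eqI) (metis coeff_eq_0 coeff_monom linorder_neqE_nat n_def)
    then show False using H(2) by (simp add: n_def)
  qed
  define v where "v = subdegree (coeff H i0)"
  have left: "(real i0, real v) \<in> newton_polygon H"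
    unfolding NP
  proof (rule leftmost_in_lower_convex_hull)
    show "(real i0, real v) \<in> A" using i0(1) \<open>i0 < n\<close> by (auto simp: A v_def)
    fix u w assume "(u, w) \<in> A"
    then obtain i where i: "u = real i" "w = real (subdegree (coeff H i))" "coeff H i \<noteq> 0" by (auto simp: A)
    then show "real i0 < u \<or> u = real i0 \<and> real v \<le> w" using i0(2)[OF i(3)] by (auto simp: v_def)
  qed
  have "v > 0"
    using H(1) i0(1) \<open>i0 < n\<close> by (simp add: weierstrass_def n_def v_def subdegree_eq_0_iff zero_less_iff_neq_zero)
  show "0 < m"
  proof (rule ccontr)
    assume "\<not> 0 < m"
    then obtain a b :: "real \<times> real" where ab: "newton_polygon H = closed_segment a b" "snd b = snd a"
      using e by (auto simp: edge_data_def)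
    have "snd x = snd a" if x: "x \<in> closed_segment a b" for x
    proof -
      obtain u where "x = (1 - u) *\<^sub>R a + u *\<^sub>R b" using x by (auto simp: closed_segment_def)
      then have "snd x = (1 - u) * snd a + u * snd b" by simp
      then show ?thesis by (simp add: ab(2) left_diff_distrib)
    qed
    then have "snd (real i0, real v) = snd (real n, 0 :: real)" using left right ab(1) by metis
    then show False using \<open>v > 0\<close> by simp
  qed
  have nzb: "fps_nth (coeff (boundary_poly H) i0) v \<noteq> 0"
    using left i0(1) \<open>i0 < n\<close> by (simp add: coeff_boundary_poly n_def v_def)
  show "coeff P 0 \<noteq> 0"
  proof
    assume "coeff P 0 = 0"
    then obtain B where B: "P = [:0, 1:] * B" by (cases P) auto
    have PK: "P \<in> polys_over K" using P(2) by (simp add: irreducible_over_def range_coeff_subset_iff)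
    then have "B \<in> polys_over K" by (simp add: B pCons_in_polys_over)
    moreover have "[:0, 1:] \<in> polys_over K"
      using subring_set_0[OF K] subring_setD(1)[OF K] by (auto simp: polys_over_def coeff_pCons split: nat.splits)
    ultimately have "degree B = 0" using irreducible_overD[OF P(2) _ _ B] by fastforce
    then obtain b where "B = [:b:]" by (rule degree_eq_zeroE)
    then have "P = [:0, 1:]" using P(1) B by (auto split: if_splits)
    then have "edge_form q m P = monom 1 q" by (simp add: edge_form_def)
    then have "boundary_poly H = monom 1 (q * N)" by (simp add: bd monom_power)
    then have "coeff (boundary_poly H) i0 = 0" using deg \<open>P = [:0, 1:]\<close> \<open>i0 < n\<close> by (simp add: n_def)
    then show False using nzb by simp
  qed
qed

text \<open>Let x^w be the least power of x occurring in \<open>U\<close>, say next to y^i. The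
  lower coefficients of \<open>H\<close> vanish at x = 0, so they cannot reach x^w, and the product
  keeps this coefficient at x^w y^(n+i). There \<open>R\<close> has no term.\<close>

lemma weierstrass_quotient_unique:
  fixes H R :: "'a::field fps poly"
  assumes H: "weierstrass H" and R: "R = 0 \<or> degree R < degree H"
    and eq: "fps_of_poly R = fps_of_poly H * U"
  shows "U = 0"
proof (rule ccontr)
  assume "U \<noteq> 0"
  define Q where "Q j \<longleftrightarrow> (\<exists>i. fps_nth (fps_nth U i) j \<noteq> 0)" for j
  obtain i where "fps_nth U i \<noteq> 0" using \<open>U \<noteq> 0\<close> by (auto simp: fps_eq_iff[of U])
  then obtain j where "Q j" by (auto simp: fps_eq_iff Q_def)
  define w where "w = (LEAST j. Q j)"
  have w: "Q w" "\<And>j. j < w \<Longrightarrow> \<not> Q j"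
    unfolding w_def by (rule LeastI[of Q, OF \<open>Q j\<close>], rule not_less_Least)
  obtain i where i: "fps_nth (fps_nth U i) w \<noteq> 0" using w(1) by (auto simp: Q_def)
  define n where "n = degree H"
  have 0: "fps_nth (coeff H a * fps_nth U b) w = 0" if "a < n" for a b
  proof -
    have "fps_nth (coeff H a) c * fps_nth (fps_nth U b) (w - c) = 0" if "c \<le> w" for c
    proof (cases "c = 0")
      case True
      then show ?thesis using H \<open>a < n\<close> by (simp add: weierstrass_def n_def)
    next
      case False
      then have "\<not> Q (w - c)" using w(2) \<open>c \<le> w\<close> by simp
      then show ?thesis by (simp add: Q_def)
    qed
    then show ?thesis unfolding fps_mult_nth by (intro sum.neutral) auto
  qed
  have "fps_nth (fps_nth (fps_of_poly H * U) (n + i)) w =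
      (\<Sum>a=0..n + i. fps_nth (coeff H a * fps_nth U (n + i - a)) w)"
    by (simp add: fps_mult_nth[of "fps_of_poly H"] fps_sum_nth)
  also have "\<dots> = (\<Sum>a=0..n + i. if a = n then fps_nth (fps_nth U i) w else 0)"
  proof (intro sum.cong refl)
    fix a
    show "fps_nth (coeff H a * fps_nth U (n + i - a)) w = (if a = n then fps_nth (fps_nth U i) w else 0)"
      using 0 H by (cases a n rule: linorder_cases) (auto simp: weierstrass_def n_def coeff_eq_0)
  qed
  also have "\<dots> = fps_nth (fps_nth U i) w" by simp
  finally have "fps_nth (coeff R (n + i)) w \<noteq> 0" using i by (simp flip: eq)
  moreover have "coeff R (n + i) = 0" using R by (auto simp: n_def coeff_eq_0)
  ultimately show False by simp
qed

lemma monic_division: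
  fixes A B :: "'a::idom poly"
  assumes "lead_coeff B = 1"
  obtains Q R where "A = B * Q + R" "R = 0 \<or> degree R < degree B"
proof -
  obtain Q R where QR: "pseudo_divmod A B = (Q, R)" by fastforce
  have "B \<noteq> 0" using assms by auto
  show ?thesis using pseudo_divmod[OF \<open>B \<noteq> 0\<close> QR] assms that[of Q R] by simp
qed

text \<open>The unit in \<open>step_G\<close> is only a power series in y. Division by the monic
  \<open>H\<close> and uniqueness of the quotient show that it is a polynomial, so later
  substitutions act on polynomials in y throughout.\<close>

lemma weierstrass_cofactor_polynomial:
  fixes A H :: "'a::field fps poly"
  assumes H: "weierstrass H" and eq: "fps_of_poly A = fps_of_poly H * V"
  obtains W where "V = fps_of_poly W" "A = H * W"
proof -
  obtain Q R where QR: "A = H * Q + R" "R = 0 \<or> degree R < degree H"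
    using monic_division[of H A] H unfolding weierstrass_def by blast
  have "fps_of_poly R = fps_of_poly H * (V - fps_of_poly Q)"
    using eq by (simp add: QR(1) fps_of_poly_add fps_of_poly_mult algebra_simps)
  from weierstrass_quotient_unique[OF H QR(2) this] have V: "V = fps_of_poly Q" by simp
  then have "fps_of_poly A = fps_of_poly (H * Q)" by (simp add: eq fps_of_poly_mult)
  then have "A = H * Q" by (simp only: fps_of_poly_eq_iff)
  then show ?thesis using V that by blast
qed

text \<open>Elimination without division, as the entries come from an integral domain: unknown
  \<open>p\<close> is removed by cross-multiplying with the pivot \<open>M n p\<close>. If equation
  \<open>n\<close> is void, that unknown is set to 0 instead.\<close>

lemma linear_dependence:
  fixes M :: "nat \<Rightarrow> 'j \<Rightarrow> 'a::idom"
  assumes "finite J" "n < card J"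
  shows "\<exists>a. (\<exists>j\<in>J. a j \<noteq> 0) \<and> (\<forall>i<n. (\<Sum>j\<in>J. a j * M i j) = 0)"
  using assms
proof (induction n arbitrary: J M)
  case 0
  then obtain j where "j \<in> J" by (metis card.empty less_nat_zero_code ex_in_conv)
  then show ?case by (intro exI[of _ "\<lambda>_. 1"]) auto
next
  case (Suc n)
  have "\<exists>p\<in>J. (\<forall>j\<in>J. M n j = 0) \<or> M n p \<noteq> 0"
    using Suc.prems by (metis card.empty less_nat_zero_code ex_in_conv)
  then obtain p where p: "p \<in> J" "(\<forall>j\<in>J. M n j = 0) \<or> M n p \<noteq> 0" by blast
  have J': "finite (J - {p})" "n < card (J - {p})" using Suc.prems p by auto
  show ?case
  proof (cases "\<forall>j\<in>J. M n j = 0")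
    case True
    obtain a where a: "\<exists>j\<in>J - {p}. a j \<noteq> 0" "\<And>i. i < n \<Longrightarrow> (\<Sum>j\<in>J - {p}. a j * M i j) = 0"
      using Suc.IH[OF J', of M] by blast
    define b where "b j = (if j = p then 0 else a j)" for j
    have "(\<Sum>j\<in>J. b j * M i j) = 0" if "i < Suc n" for i
    proof (cases "i = n")
      case False
      have "(\<Sum>j\<in>J. b j * M i j) = (\<Sum>j\<in>J - {p}. b j * M i j)"
        using Suc.prems p(1) by (simp add: sum.remove[of J p] b_def)
      also have "\<dots> = (\<Sum>j\<in>J - {p}. a j * M i j)" by (intro sum.cong) (auto simp: b_def)
      finally show ?thesis using a(2) that False by simp
    qed (simp add: True)
    moreover have "\<exists>j\<in>J. b j \<noteq> 0" using a(1) by (auto simp: b_def)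
    ultimately show ?thesis by blast
  next
    case False
    then have piv: "M n p \<noteq> 0" using p by blast
    define M' where "M' i j = M n p * M i j - M i p * M n j" for i j
    obtain a where a: "\<exists>j\<in>J - {p}. a j \<noteq> 0" "\<And>i. i < n \<Longrightarrow> (\<Sum>j\<in>J - {p}. a j * M' i j) = 0"
      using Suc.IH[OF J', of M'] by blast
    define b where "b j = (if j = p then - (\<Sum>j\<in>J - {p}. a j * M n j) else M n p * a j)" for j
    have "(\<Sum>j\<in>J. b j * M i j) = (\<Sum>j\<in>J - {p}. a j * M' i j)" for i
    proof -
      have "(\<Sum>j\<in>J. b j * M i j) = b p * M i p + (\<Sum>j\<in>J - {p}. b j * M i j)"
        using Suc.prems p(1) by (simp add: sum.remove)
      also have "(\<Sum>j\<in>J - {p}. b j * M i j) = (\<Sum>j\<in>J - {p}. M n p * a j * M i j)"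
        by (intro sum.cong) (auto simp: b_def)
      also have "b p * M i p = - (\<Sum>j\<in>J - {p}. a j * M n j * M i p)"
        by (simp add: b_def sum_distrib_right)
      also have "\<dots> + (\<Sum>j\<in>J - {p}. M n p * a j * M i j) = (\<Sum>j\<in>J - {p}. a j * M' i j)"
        by (simp add: M'_def sum_negf[symmetric] algebra_simps flip: sum.distrib)
      finally show ?thesis .
    qed
    moreover have "(\<Sum>j\<in>J - {p}. a j * M' n j) = 0" by (simp add: M'_def mult.commute)
    ultimately have "(\<Sum>j\<in>J. b j * M i j) = 0" if "i < Suc n" for i
      using a(2) that by (cases "i = n") auto
    moreover have "\<exists>j\<in>J. b j \<noteq> 0" using a(1) piv by (auto simp: b_def)
    ultimately show ?thesis by blast
  qed
qed

section \<open>Algebraic relations and supports\<close>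

lemma ring_hom_fun_fps_embed: "ring_hom_fun \<iota> \<Longrightarrow> ring_hom_fun (fps_embed \<iota>)"
  by (auto simp: ring_hom_fun_def fps_embed_def fps_eq_iff fps_mult_nth intro!: sum.cong
      simp: ring_hom_fun_sum[unfolded ring_hom_fun_def])

lemma fps_nth_fps_embed [simp]: "fps_nth (fps_embed \<iota> a) n = \<iota> (fps_nth a n)"
  by (simp add: fps_embed_def)

lemma order_0_pCons_0:
  fixes p :: "'a::idom poly"
  assumes "p \<noteq> 0" shows "order 0 (pCons 0 p) = Suc (order 0 p)"
proof -
  have "pCons 0 p = [:0, 1:] * p" by simp
  moreover have "order 0 [:0, 1 :: 'a:] = 1" using order_power_n_n[of "0 :: 'a" 1] by simp
  ultimately show ?thesis using assms by (metis add.left_neutral order_mult plus_1_eq_Suc mult_eq_0_iff pCons_eq_0_iff)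
qed

section \<open>Dimension count behind the degree bound for minimal polynomials\<close>

lemma sum_nested_flatten:
  fixes f l :: nat
  assumes "f > 0"
  shows "(\<Sum>i<l. \<Sum>b<f. x i b) = (\<Sum>n<l * f. x (n div f) (n mod f))"
proof -
  have "(\<Sum>i<l. \<Sum>b<f. x i b) = (\<Sum>(i, b)\<in>{..<l} \<times> {..<f}. x i b)"
    by (simp add: sum.cartesian_product)
  also have "\<dots> = (\<Sum>n<l * f. x (n div f) (n mod f))"
  proof (rule sum.reindex_bij_witness[of _ "\<lambda>n. (n div f, n mod f)" "\<lambda>(i, b). i * f + b"])
    fix ib assume ib: "ib \<in> {..<l} \<times> {..<f}"
    obtain i b where [simp]: "ib = (i, b)" by (cases ib)
    have "i * f + b < l * f"
    proof -
      have "i * f + b < Suc i * f" using ib by simp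
      also have "Suc i * f \<le> l * f" using ib by (intro mult_right_mono) auto
      finally show ?thesis .
    qed
    then show "(case ib of (i, b) \<Rightarrow> i * f + b) \<in> {..<l * f}" by simp
  qed (use assms in \<open>auto simp: less_mult_imp_div_less\<close>)
  finally show ?thesis .
qed

text \<open>Says that \<open>K\<close> has dimension at most \<open>f\<close> over the image of
  \<iota>. The spanning elements \<kappa> may lie outside \<open>K\<close>.\<close>

definition spanned_by :: "('k::field \<Rightarrow> 'l::field) \<Rightarrow> 'l set \<Rightarrow> nat \<Rightarrow> bool" where
  "spanned_by \<iota> K f \<longleftrightarrow> (\<exists>\<kappa>. \<forall>u\<in>K. \<exists>a. u = (\<Sum>b<f. \<iota> (a b) * \<kappa> b))"

lemma spanned_by_range: "ring_hom_fun \<iota> \<Longrightarrow> spanned_by \<iota> (range \<iota>) 1"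
  unfolding spanned_by_def by (intro exI[of _ "\<lambda>_. 1"]) auto

lemma spanned_by_adjoin:
  assumes K: "subfield_set K" and P: "irreducible_over K P" "poly P z = 0"
    and f: "spanned_by \<iota> K f" "f > 0"
  shows "spanned_by \<iota> (adjoin K z) (degree P * f)"
proof -
  obtain \<kappa> where \<kappa>: "\<And>u. u \<in> K \<Longrightarrow> \<exists>a. u = (\<Sum>b<f. \<iota> (a b) * \<kappa> b)"
    using f(1) unfolding spanned_by_def by blast
  define \<kappa>' where "\<kappa>' n = z ^ (n div f) * \<kappa> (n mod f)" for n
  have "\<exists>a. u = (\<Sum>n<degree P * f. \<iota> (a n) * \<kappa>' n)" if u: "u \<in> adjoin K z" for u
  proof -
    obtain A where A: "A \<in> polys_over K" "degree A < degree P" "u = poly A z"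
      using adjoin_reduce[OF K P u] .
    have "\<forall>i. \<exists>a. coeff A i = (\<Sum>b<f. \<iota> (a b) * \<kappa> b)" using A(1) \<kappa> by (simp add: polys_over_def)
    then obtain a where a: "\<And>i. coeff A i = (\<Sum>b<f. \<iota> (a i b) * \<kappa> b)" by metis
    have "u = (\<Sum>i\<le>degree A. coeff A i * z ^ i)" by (simp add: A(3) poly_altdef)
    also have "\<dots> = (\<Sum>i<degree P. coeff A i * z ^ i)"
      using A(2) by (intro sum.mono_neutral_left) (auto simp: coeff_eq_0)
    also have "\<dots> = (\<Sum>i<degree P. \<Sum>b<f. \<iota> (a i b) * (z ^ i * \<kappa> b))"
      by (simp add: a sum_distrib_left sum_distrib_right mult_ac)
    also have "\<dots> = (\<Sum>n<degree P * f. \<iota> (a (n div f) (n mod f)) * \<kappa>' n)"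
      by (simp add: sum_nested_flatten[OF f(2)] \<kappa>'_def)
    finally show ?thesis by (intro exI[of _ "\<lambda>n. a (n div f) (n mod f)"])
  qed
  then show ?thesis unfolding spanned_by_def by blast
qed

text \<open>Exponents are sorted by their residue r modulo e, so x^n is x^r times a power of x^e.
  The substitution x -> \<mu> x^e creates a factor \<mu>^(n div e), which is divided out before
  expanding the coefficient in the spanning elements.\<close>

lemma fps_decomposition:
  assumes \<iota>: "ring_hom_fun \<iota>" and K: "subfield_set K"
    and \<kappa>: "\<And>u. u \<in> K \<Longrightarrow> \<exists>a. u = (\<Sum>b<f. \<iota> (a b) * \<kappa> b)"
    and \<mu>: "\<mu> \<in> K" "\<mu> \<noteq> 0" and e: "e > 0" and u: "u \<in> fps_over K"
  shows "\<exists>U. u = (\<Sum>r<e. \<Sum>b<f. fps_X ^ r * fps_const (\<kappa> b) *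
    (fps_embed \<iota> (U r b) oo (fps_const \<mu> * fps_X ^ e)))"
proof -
  have "fps_nth u n * inverse (\<mu> ^ (n div e)) \<in> K" for n
    using u \<mu> subfield_setD[OF K] subring_set_power subring_setD(4) unfolding fps_over_def by blast
  then have "\<forall>n. \<exists>a. fps_nth u n * inverse (\<mu> ^ (n div e)) = (\<Sum>b<f. \<iota> (a b) * \<kappa> b)"
    using \<kappa> by blast
  then obtain a where a: "\<And>n. fps_nth u n * inverse (\<mu> ^ (n div e)) = (\<Sum>b<f. \<iota> (a n b) * \<kappa> b)"
    by metis
  define U where "U r b = Abs_fps (\<lambda>n. a (e * n + r) b)" for r b
  have "u = (\<Sum>r<e. \<Sum>b<f. fps_X ^ r * fps_const (\<kappa> b) *
    (fps_embed \<iota> (U r b) oo (fps_const \<mu> * fps_X ^ e)))" (is "u = ?R")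
  proof (rule fps_ext)
    fix n
    have summand: "fps_nth (fps_X ^ r * fps_const (\<kappa> b) *
        (fps_embed \<iota> (U r b) oo (fps_const \<mu> * fps_X ^ e))) n =
        (if r = n mod e then \<iota> (a n b) * \<kappa> b * \<mu> ^ (n div e) else 0)" if r: "r < e" for r b
    proof -
      have eq: "fps_nth (fps_X ^ r * fps_const (\<kappa> b) *
          (fps_embed \<iota> (U r b) oo (fps_const \<mu> * fps_X ^ e))) n =
          (if n < r then 0 else \<kappa> b * fps_nth (fps_embed \<iota> (U r b) oo (fps_const \<mu> * fps_X ^ e)) (n - r))"
        by (simp add: mult.assoc fps_X_power_mult_nth)
      show ?thesis
      proof (cases "r = n mod e")
        case True
        have "n - r = e * (n div e)" "r \<le> n" unfolding True by (simp_all add: minus_mod_eq_mult_div)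
        moreover have "e * (n div e) + r = n" "\<not> n < n mod e" unfolding True by (simp_all add: not_less)
        ultimately show ?thesis
          unfolding eq using True e by (simp add: fps_nth_compose_monomial U_def mult_ac)
      next
        case False
        have "\<not> (r \<le> n \<and> e dvd n - r)"
        proof
          assume *: "r \<le> n \<and> e dvd n - r"
          then obtain k where "n - r = e * k" by auto
          then have "n = r + e * k" using * by simp
          then have "n mod e = r" using r by simp
          then show False using False by simp
        qed
        then show ?thesis unfolding eq using False e by (auto simp: fps_nth_compose_monomial)
      qed
    qed
    have "fps_nth ?R n = (\<Sum>r<e. if r = n mod e then (\<Sum>b<f. \<iota> (a n b) * \<kappa> b * \<mu> ^ (n div e)) else 0)"
      unfolding fps_sum_nth by (intro sum.cong refl) (simp add: summand)
    also have "\<dots> = (\<Sum>b<f. \<iota> (a n b) * \<kappa> b) * \<mu> ^ (n div e)"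
      using e by (simp add: sum_distrib_right)
    also have "\<dots> = fps_nth u n" using \<mu>(2) by (simp flip: a)
    finally show "fps_nth u n = fps_nth ?R n" by simp
  qed
  then show ?thesis by blast
qed

text \<open>\<open>K[[x]]\<close> is generated over the image of \<open>\<bbbK>[[x]]\<close> under \<open>x \<mapsto> \<mu> x\<^sup>e\<close> by \<open>ef\<close> elements.\<close>

lemma algebraic_relation:
  fixes \<iota> :: "'k::field \<Rightarrow> 'l::field"
  assumes \<iota>: "ring_hom_fun \<iota>" and K: "subfield_set K" and f: "spanned_by \<iota> K f"
    and \<mu>: "\<mu> \<in> K" "\<mu> \<noteq> 0" and e: "e > 0" and S: "S \<in> fps_over K"
  obtains A where "A \<noteq> 0" "degree A \<le> e * f"
    "poly (map_poly (\<lambda>a. fps_embed \<iota> a oo (fps_const \<mu> * fps_X ^ e)) A) S = 0"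
proof -
  define h where "h a = fps_embed \<iota> a oo (fps_const \<mu> * fps_X ^ e)" for a
  have hom: "ring_hom_fun h"
    unfolding h_def using e
    by (intro ring_hom_fun_comp[OF ring_hom_fun_fps_embed[OF \<iota>] ring_hom_fun_fps_compose]) simp
  note h = ring_hom_funD[OF hom]
  obtain \<kappa> where \<kappa>: "\<And>u. u \<in> K \<Longrightarrow> \<exists>a. u = (\<Sum>b<f. \<iota> (a b) * \<kappa> b)"
    using f unfolding spanned_by_def by blast
  have Sj: "S ^ j \<in> fps_over K" for j
    using S by (intro subring_set_power subring_fps_over subfield_setD(1)[OF K])
  then have "\<forall>j. \<exists>U. S ^ j = (\<Sum>r<e. \<Sum>b<f. fps_X ^ r * fps_const (\<kappa> b) * h (U r b))"
    unfolding h_def by (intro allI fps_decomposition[OF \<iota> K \<kappa> \<mu> e Sj])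
  from choice[OF this] obtain U
    where U: "\<forall>j. S ^ j = (\<Sum>r<e. \<Sum>b<f. fps_X ^ r * fps_const (\<kappa> b) * h (U j r b))" ..
  \<comment> \<open>There are e f + 1 powers of \<open>S\<close> and only e f coordinates, so a
    nontrivial relation over the base ring exists, of degree at most e f in y.\<close>
  obtain a where a: "\<exists>j\<in>{..e * f}. a j \<noteq> 0"
    "\<And>i. i < e * f \<Longrightarrow> (\<Sum>j\<in>{..e * f}. a j * U j (i div f) (i mod f)) = 0"
    using linear_dependence[of "{..e * f}" "e * f" "\<lambda>i j. U j (i div f) (i mod f)"] by auto
  have a0: "(\<Sum>j\<le>e * f. a j * U j r b) = 0" if "r < e" "b < f" for r b
  proof -
    have "r * f + b < Suc r * f" using that by simp
    also have "Suc r * f \<le> e * f" using that by (intro mult_right_mono) auto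
    finally show ?thesis using a(2)[of "r * f + b"] that by simp
  qed
  define A where "A = (\<Sum>j\<le>e * f. monom (a j) j)"
  have coeffA: "coeff A j = (if j \<le> e * f then a j else 0)" for j by (simp add: A_def coeff_sum)
  show ?thesis
  proof (rule that)
    show "A \<noteq> 0" using a(1) coeffA by (metis atMost_iff coeff_0)
    show "degree A \<le> e * f" by (rule degree_le) (simp add: coeffA)
    have "map_poly h A = (\<Sum>j\<le>e * f. monom (h (a j)) j)"
      by (rule poly_eqI) (simp add: coeff_map_poly h coeffA coeff_sum)
    then have "poly (map_poly h A) S = (\<Sum>j\<le>e * f. h (a j) * S ^ j)"
      by (simp add: poly_sum poly_monom)
    also have "\<dots> = (\<Sum>j\<le>e * f. \<Sum>r<e. \<Sum>b<f. fps_X ^ r * fps_const (\<kappa> b) * h (a j * U j r b))"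
      by (simp only: U[rule_format] sum_distrib_left h(4) mult_ac)
    also have "\<dots> = (\<Sum>r<e. \<Sum>b<f. \<Sum>j\<le>e * f. fps_X ^ r * fps_const (\<kappa> b) * h (a j * U j r b))"
      by (subst sum.swap) (intro sum.cong refl sum.swap)
    also have "\<dots> = (\<Sum>r<e. \<Sum>b<f. fps_X ^ r * fps_const (\<kappa> b) * h (\<Sum>j\<le>e * f. a j * U j r b))"
      by (simp add: ring_hom_fun_sum[OF hom] sum_distrib_left)
    also have "\<dots> = 0" by (intro sum.neutral ballI) (simp add: a0 h)
    finally show "poly (map_poly (\<lambda>a. fps_embed \<iota> a oo (fps_const \<mu> * fps_X ^ e)) A) S = 0"
      unfolding h_def .
  qed
qed


text \<open>\<open>U\<close> is a unit of K[[x,y]], because its value at the origin is nonzero, but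
  it is kept as a polynomial in y.\<close>

definition has_shape :: "'a::field fps poly \<Rightarrow> nat \<Rightarrow> nat \<Rightarrow> 'a fps poly \<Rightarrow> bool" where
  "has_shape B v b U \<longleftrightarrow> B = smult (fps_X ^ v) (monom 1 b * U) \<and> coeff (red U) 0 \<noteq> 0"

lemma coeff_0_mult: "coeff (A * B) 0 = coeff A 0 * coeff B 0"
  by (simp add: coeff_mult)

lemma coeff_0_power: "coeff (A ^ n) 0 = coeff A 0 ^ n"
  by (induction n) (simp_all add: coeff_0_mult)

lemma coeff_0_prod: "coeff (\<Prod>i\<in>I. A i) 0 = (\<Prod>i\<in>I. coeff (A i) 0)"
  by (induction I rule: infinite_finite_induct) (simp_all add: coeff_0_mult)

lemma has_shape_1: "has_shape 1 0 0 1"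
  by (simp add: has_shape_def)

lemma has_shape_mult:
  assumes "has_shape B v b U" "has_shape B' v' b' U'"
  shows "has_shape (B * B') (v + v') (b + b') (U * U')"
proof -
  have "monom (1 :: 'a fps) (b + b') = monom 1 b * monom 1 b'" by (simp add: mult_monom)
  then show ?thesis
    using assms by (simp add: has_shape_def red_mult coeff_0_mult power_add mult_ac)
qed

lemma has_shape_power:
  assumes "has_shape B v b U" shows "has_shape (B ^ n) (n * v) (n * b) (U ^ n)"
proof (induction n)
  case 0
  then show ?case using has_shape_1 by simp
next
  case (Suc n)
  then show ?case using has_shape_mult[OF assms Suc] by simp
qed

lemma has_shape_prod:
  assumes "\<And>i. i \<in> I \<Longrightarrow> has_shape (B i) (v i) (b i) (U i)"
  shows "has_shape (\<Prod>i\<in>I. B i) (\<Sum>i\<in>I. v i) (\<Sum>i\<in>I. b i) (\<Prod>i\<in>I. U i)"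
  using assms
  by (induction I rule: infinite_finite_induct) (auto simp: has_shape_1 intro: has_shape_mult)

lemma has_shape_red:
  assumes "has_shape B v b U" shows "red (monom 1 b * U) \<noteq> 0"
proof -
  have "coeff (red (monom 1 b * U)) b \<noteq> 0" using assms by (simp add: has_shape_def coeff_monom_mult)
  then show ?thesis by (metis coeff_0)
qed

lemma has_shape_poly_val: "has_shape B v b U \<Longrightarrow> poly_val B = enat v"
  using poly_val_smult_fps_X_power has_shape_red unfolding has_shape_def by metis

lemma coeff_has_shape:
  assumes "has_shape B v b U"
  shows "fps_nth (coeff B i) j =
    (if b \<le> i \<and> v \<le> j then fps_nth (coeff U (i - b)) (j - v) else 0)"
  using assms by (auto simp: has_shape_def coeff_monom_mult fps_X_power_mult_nth)


text \<open>\<open>S\<close> lies in the union of the quadrants with corners in \<open>S'\<close>,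
  as for exponents of monomial ideals. The smaller points belong to the second argument.\<close>

definition dominates :: "(nat \<times> nat) set \<Rightarrow> (nat \<times> nat) set \<Rightarrow> bool" where
  "dominates S S' \<longleftrightarrow> (\<forall>i j. (i, j) \<in> S \<longrightarrow> (\<exists>a b. (a, b) \<in> S' \<and> a \<le> i \<and> b \<le> j))"

lemma dominates_trans: "dominates S S' \<Longrightarrow> dominates S' S'' \<Longrightarrow> dominates S S''"
  unfolding dominates_def by (meson order.trans)

text \<open>Descent on i + j ends at a minimal point below any given one. Hence cancellation has to
  be excluded at minimal points only.\<close>

lemma dominates_if_minimal_in:
  assumes "\<And>i j. (i, j) \<in> S \<Longrightarrow> (\<And>a b. (a, b) \<in> S \<Longrightarrow> a \<le> i \<Longrightarrow> b \<le> j \<Longrightarrow> a = i \<and> b = j) \<Longrightarrow> (i, j) \<in> S'"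
  shows "dominates S S'"
  unfolding dominates_def
proof (intro allI impI)
  fix i j assume "(i, j) \<in> S"
  then show "\<exists>a b. (a, b) \<in> S' \<and> a \<le> i \<and> b \<le> j"
  proof (induction "i + j" arbitrary: i j rule: less_induct)
    case less
    show ?case
    proof (cases "\<forall>a b. (a, b) \<in> S \<longrightarrow> a \<le> i \<longrightarrow> b \<le> j \<longrightarrow> a = i \<and> b = j")
      case True
      then have "(i, j) \<in> S'" by (intro assms less.prems) blast+
      then show ?thesis by blast
    next
      case False
      then obtain a b where ab: "(a, b) \<in> S" "a \<le> i" "b \<le> j" "a \<noteq> i \<or> b \<noteq> j" by blast
      then have "a + b < i + j" by linarith
      from less.hyps[OF this ab(1)] ab(2,3) show ?thesis by (meson order.trans)
    qed
  qed
qed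

definition support :: "'a::zero fps poly \<Rightarrow> (nat \<times> nat) set" where
  "support A = {(i, j). fps_nth (coeff A i) j \<noteq> 0}"

lemma coeff_mult_fps_nth:
  "fps_nth (coeff (A * B) i) j =
    (\<Sum>(a, b)\<in>{..i} \<times> {..j}. fps_nth (coeff A a) b * fps_nth (coeff B (i - a)) (j - b))"
  by (simp add: coeff_mult fps_sum_nth fps_mult_nth atLeast0AtMost sum.cartesian_product)

lemma dominates_support_mult_left: "dominates (support (A * B)) (support A)"
  unfolding dominates_def
proof (intro allI impI)
  fix i j assume "(i, j) \<in> support (A * B)"
  then have "(\<Sum>(a, b)\<in>{..i} \<times> {..j}. fps_nth (coeff A a) b * fps_nth (coeff B (i - a)) (j - b)) \<noteq> 0"
    by (simp add: support_def coeff_mult_fps_nth)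
  then obtain ab where ab: "ab \<in> {..i} \<times> {..j}"
    "(case ab of (a, b) \<Rightarrow> fps_nth (coeff A a) b * fps_nth (coeff B (i - a)) (j - b)) \<noteq> 0"
    by (rule sum.not_neutral_contains_not_neutral)
  obtain a b where [simp]: "ab = (a, b)" by (cases ab)
  show "\<exists>a b. (a, b) \<in> support A \<and> a \<le> i \<and> b \<le> j"
    using ab by (intro exI[of _ a] exI[of _ b]) (auto simp: support_def)
qed

text \<open>At a minimal point of the support of \<open>A\<close> the product receives a single
  contribution, the coefficient of \<open>A\<close> times the value of \<open>B\<close> at the
  origin.\<close>

lemma dominates_support_mult_right:
  fixes A B :: "'a::field fps poly"
  assumes "coeff (red B) 0 \<noteq> 0" shows "dominates (support A) (support (A * B))"
proof (rule dominates_if_minimal_in)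
  fix i j assume ij: "(i, j) \<in> support A"
    and min: "\<And>a b. (a, b) \<in> support A \<Longrightarrow> a \<le> i \<Longrightarrow> b \<le> j \<Longrightarrow> a = i \<and> b = j"
  have "fps_nth (coeff (A * B) i) j =
      (\<Sum>ab\<in>{..i} \<times> {..j}. if ab = (i, j) then fps_nth (coeff A i) j * fps_nth (coeff B 0) 0 else 0)"
    unfolding coeff_mult_fps_nth
  proof (intro sum.cong refl)
    fix ab assume ab: "ab \<in> {..i} \<times> {..j}"
    obtain a b where [simp]: "ab = (a, b)" by (cases ab)
    show "(case ab of (a, b) \<Rightarrow> fps_nth (coeff A a) b * fps_nth (coeff B (i - a)) (j - b)) =
        (if ab = (i, j) then fps_nth (coeff A i) j * fps_nth (coeff B 0) 0 else 0)"
    proof (cases "a = i \<and> b = j")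
      case False
      then have "(a, b) \<notin> support A" using min[of a b] ab by auto
      then show ?thesis using False by (auto simp: support_def)
    qed simp
  qed
  also have "\<dots> = fps_nth (coeff A i) j * fps_nth (coeff B 0) 0" by simp
  finally show "(i, j) \<in> support (A * B)" using ij assms by (simp add: support_def)
qed

section \<open>Freeness of the leading coefficients\<close>

text \<open>Linear independence over the base field of the products of the \<open>lam p\<close>, for
  indices with given last entry and given weight. The induction reads the same functions
  \<open>B\<close> at the lower level, where their value at \<open>Suc (Suc k)\<close> no longer
  counts. This is why \<open>B\<close> has to be determined by its entries up to
  \<open>Suc k\<close> instead of vanishing beyond them.\<close>

definition free_products ::
  "('k::field \<Rightarrow> 'l::field) \<Rightarrow> (nat \<Rightarrow> nat) \<Rightarrow> nat \<Rightarrow> (nat \<Rightarrow> nat) \<Rightarrow> (nat \<Rightarrow> 'l) \<Rightarrow> bool" where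
  "free_products \<iota> bnd k vv lam \<longleftrightarrow>
     (\<forall>D f i w. finite D \<longrightarrow>
        (\<forall>B\<in>D. (\<forall>j. 1 \<le> j \<and> j \<le> k \<longrightarrow> B j < bnd j) \<and> B (Suc k) = i \<and> (\<Sum>p\<le>Suc k. B p * vv p) = w) \<longrightarrow>
        (\<forall>B\<in>D. \<forall>B'\<in>D. (\<forall>p\<le>Suc k. B p = B' p) \<longrightarrow> B = B') \<longrightarrow>
        (\<Sum>B\<in>D. \<iota> (f B) * (\<Prod>p\<le>Suc k. lam p ^ B p)) = 0 \<longrightarrow> (\<forall>B\<in>D. f B = 0))"

lemma free_productsD:
  assumes "free_products \<iota> bnd k vv lam" "finite D"
    and "\<And>B j. B \<in> D \<Longrightarrow> 1 \<le> j \<Longrightarrow> j \<le> k \<Longrightarrow> B j < bnd j"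
    and "\<And>B. B \<in> D \<Longrightarrow> B (Suc k) = i" "\<And>B. B \<in> D \<Longrightarrow> (\<Sum>p\<le>Suc k. B p * vv p) = w"
    and "\<And>B B'. B \<in> D \<Longrightarrow> B' \<in> D \<Longrightarrow> (\<And>p. p \<le> Suc k \<Longrightarrow> B p = B' p) \<Longrightarrow> B = B'"
    and "(\<Sum>B\<in>D. \<iota> (f B) * (\<Prod>p\<le>Suc k. lam p ^ B p)) = 0" "B \<in> D"
  shows "f B = 0"
proof -
  have "\<forall>B\<in>D. (\<forall>j. 1 \<le> j \<and> j \<le> k \<longrightarrow> B j < bnd j) \<and> B (Suc k) = i \<and> (\<Sum>p\<le>Suc k. B p * vv p) = w"
    using assms(3-5) by auto
  moreover have "\<forall>B\<in>D. \<forall>B'\<in>D. (\<forall>p\<le>Suc k. B p = B' p) \<longrightarrow> B = B'"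
    using assms(6) by blast
  ultimately show ?thesis
    using assms(1,2,7,8) unfolding free_products_def by blast
qed

text \<open>At level 0 the last entry and the weight determine the remaining entry, as
  \<open>vv 0\<close> is positive. The family is a single nonzero product.\<close>

lemma free_products_0:
  assumes \<iota>: "ring_hom_fun \<iota>" and "0 < vv 0" "lam 0 \<noteq> 0" "lam (Suc 0) \<noteq> 0"
  shows "free_products \<iota> bnd 0 vv lam"
  unfolding free_products_def
proof (intro allI impI ballI)
  fix D f i w B
  assume D: "\<forall>B\<in>D. (\<forall>j. 1 \<le> j \<and> j \<le> 0 \<longrightarrow> B j < bnd j) \<and> B (Suc 0) = i \<and> (\<Sum>p\<le>Suc 0. B p * vv p) = w"
    and inj: "\<forall>B\<in>D. \<forall>B'\<in>D. (\<forall>p\<le>Suc 0. B p = B' p) \<longrightarrow> B = B'"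
    and sum: "(\<Sum>B\<in>D. \<iota> (f B) * (\<Prod>p\<le>Suc 0. lam p ^ B p)) = 0" and B: "B \<in> D"
  have "B' = B" if "B' \<in> D" for B'
  proof -
    have "B' 0 * vv 0 = B 0 * vv 0" "B' (Suc 0) = B (Suc 0)"
      using bspec[OF D B] bspec[OF D that] by auto
    then have "B' 0 = B 0" using assms(2) by simp
    with \<open>B' (Suc 0) = B (Suc 0)\<close> have "\<forall>p\<le>Suc 0. B' p = B p" by (auto simp: le_Suc_eq)
    then show ?thesis using inj B that by blast
  qed
  then have "D = {B}" using B by blast
  then have "\<iota> (f B) = 0" using sum assms(3,4) by simp
  then show "f B = 0" using ring_hom_fun_inj[OF \<iota>] by blast
qed

text \<open>
  Since \<open>q s - t m = 1\<close>, on a fixed weight the exponent of \<open>z\<close> in \<open>\<Lambda>\<^sup>B\<close> is a constant plus the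
  quotient by \<open>q\<close> of the penultimate entry of \<open>B\<close>. As that quotient is less than \<open>deg P\<close>, a relation
  splits along the free family \<open>1, z, z\<^sup>2, \<dots>\<close> into relations of the previous level.
\<close>

lemma free_products_Suc:
  fixes \<iota> :: "'k::field \<Rightarrow> 'l::field" and s t :: int
  assumes \<iota>: "ring_hom_fun \<iota>" and K: "subfield_set K" "range \<iota> \<subseteq> K"
    and P: "irreducible_over K P" "poly P z = 0" "z \<noteq> 0"
    and lam: "\<And>p. p \<le> Suc k \<Longrightarrow> lam p \<in> K"
    and free: "free_products \<iota> bnd k vv lam"
    and bnd: "bnd (Suc k) = q * degree P" and q: "q > 0" and st: "int q * s - t * int m = 1"
    and vv': "\<And>p. p \<le> Suc k \<Longrightarrow> vv' p = q * vv p + m * (if p = Suc k then 1 else 0)"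
    and lam': "\<And>p. p \<le> Suc k \<Longrightarrow>
      lam' p = (z powi t) ^ vv p * (z powi s) ^ (if p = Suc k then 1 else 0) * lam p"
    and top: "lam' (Suc (Suc k)) \<noteq> 0"
  shows "free_products \<iota> bnd (Suc k) vv' lam'"
  unfolding free_products_def
proof (intro allI impI ballI)
  fix D f i w B
  assume fin: "finite D"
    and D: "\<forall>B\<in>D. (\<forall>j. 1 \<le> j \<and> j \<le> Suc k \<longrightarrow> B j < bnd j) \<and> B (Suc (Suc k)) = i \<and>
        (\<Sum>p\<le>Suc (Suc k). B p * vv' p) = w"
    and inj: "\<forall>B\<in>D. \<forall>B'\<in>D. (\<forall>p\<le>Suc (Suc k). B p = B' p) \<longrightarrow> B = B'"
    and sum: "(\<Sum>B\<in>D. \<iota> (f B) * (\<Prod>p\<le>Suc (Suc k). lam' p ^ B p)) = 0"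
    and B: "B \<in> D"
  define S where "S B = (\<Sum>p\<le>Suc k. B p * vv p)" for B :: "nat \<Rightarrow> nat"
  define L where "L B = (\<Prod>p\<le>Suc k. lam p ^ B p)" for B :: "nat \<Rightarrow> nat"
  define E where "E B = t * int (S B) + s * int (B (Suc k))" for B :: "nat \<Rightarrow> nat"
  have weight: "q * S B + m * B (Suc k) + i * vv' (Suc (Suc k)) = w" if "B \<in> D" for B
  proof -
    have "(\<Sum>p\<le>Suc k. B p * vv' p) = (\<Sum>p\<le>Suc k. q * (B p * vv p) + (if p = Suc k then m * B p else 0))"
      by (intro sum.cong refl) (simp add: vv' algebra_simps)
    also have "\<dots> = q * S B + m * B (Suc k)"
      unfolding sum.distrib S_def by (simp add: sum_distrib_left distrib_left)
    finally show ?thesis using bspec[OF D that] by auto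
  qed
  have prod: "(\<Prod>p\<le>Suc (Suc k). lam' p ^ B p) = z powi (E B) * L B * lam' (Suc (Suc k)) ^ i"
    if "B \<in> D" for B
  proof -
    have "(\<Prod>p\<le>Suc k. lam' p ^ B p) =
        (\<Prod>p\<le>Suc k. (z powi t) ^ (B p * vv p) * (if p = Suc k then (z powi s) ^ B p else 1) * lam p ^ B p)"
      by (intro prod.cong refl) (simp add: lam' power_mult_distrib power_mult[symmetric] mult.commute)
    also have "\<dots> = (z powi t) ^ S B * (z powi s) ^ B (Suc k) * L B"
      unfolding prod.distrib S_def L_def by (simp add: power_sum del: prod.atMost_Suc sum.atMost_Suc)
    also have "(z powi t) ^ S B * (z powi s) ^ B (Suc k) = z powi E B"
      using P(3) by (simp add: E_def power_int_add power_int_mult)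
    finally show ?thesis using bspec[OF D that] by auto
  qed
  \<comment> \<open>\<open>E B\<close> is the exponent of z in the product. Equal weights give q (S
    - S') = m (b' - b) for the penultimate entries b and b', so q (E - E') = (q s - t m) (b - b') =
    b - b'.\<close>
  have qE: "int q * (E B - E B') = int (B (Suc k)) - int (B' (Suc k))" if "B \<in> D" "B' \<in> D" for B B'
  proof -
    have "int q * int (S B) + int m * int (B (Suc k)) = int q * int (S B') + int m * int (B' (Suc k))"
      using weight[OF that(1)] weight[OF that(2)] by (metis add_right_cancel of_nat_add of_nat_mult)
    then have "int q * (int (S B) - int (S B')) = int m * (int (B' (Suc k)) - int (B (Suc k)))"
      by (simp add: algebra_simps)
    then have "t * (int q * (int (S B) - int (S B'))) = t * (int m * (int (B' (Suc k)) - int (B (Suc k))))"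
      by (simp only:)
    moreover have "int q * (E B - E B') =
        t * (int q * (int (S B) - int (S B'))) + int q * s * (int (B (Suc k)) - int (B' (Suc k)))"
      by (simp add: E_def algebra_simps)
    ultimately have "int q * (E B - E B') = (int q * s - t * int m) * (int (B (Suc k)) - int (B' (Suc k)))"
      by (simp add: algebra_simps)
    then show ?thesis by (simp add: st)
  qed
  \<comment> \<open>Normalising by the index with the least penultimate entry makes the exponent
    differences \<alpha> natural numbers. They stay below the degree of \<open>P\<close> because
    that entry is below q times this degree.\<close>
  define B0 where "B0 = arg_min_on (\<lambda>B. B (Suc k)) D"
  have B0: "B0 \<in> D" "\<And>B. B \<in> D \<Longrightarrow> B0 (Suc k) \<le> B (Suc k)"
    using fin B arg_min_if_finite[of D "\<lambda>B. B (Suc k)"] unfolding B0_def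
    by (auto simp: not_less[symmetric])
  define \<alpha> where "\<alpha> B = nat (E B - E B0)" for B
  have \<alpha>: "E B = E B0 + int (\<alpha> B)" "B (Suc k) = B0 (Suc k) + q * \<alpha> B" "\<alpha> B < degree P"
    if "B \<in> D" for B
  proof -
    have 1: "int q * (E B - E B0) = int (B (Suc k)) - int (B0 (Suc k))" by (rule qE[OF that B0(1)])
    also have "\<dots> \<ge> 0" using B0(2)[OF that] by simp
    finally have "0 \<le> E B - E B0" using q by (simp add: zero_le_mult_iff)
    then show E: "E B = E B0 + int (\<alpha> B)" by (simp add: \<alpha>_def)
    have "int q * int (\<alpha> B) = int (B (Suc k)) - int (B0 (Suc k))" using 1 E by simp
    then have "int (B (Suc k)) = int (B0 (Suc k) + q * \<alpha> B)" by simp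
    then show 2: "B (Suc k) = B0 (Suc k) + q * \<alpha> B" by (simp only: of_nat_eq_iff)
    have "B (Suc k) < q * degree P" using bspec[OF D that] bnd by auto
    then have "q * \<alpha> B < q * degree P" using 2 by linarith
    then show "\<alpha> B < degree P" by simp
  qed
  have "(\<Sum>B\<in>D. \<iota> (f B) * (\<Prod>p\<le>Suc (Suc k). lam' p ^ B p)) =
      (\<Sum>B\<in>D. z powi E B0 * lam' (Suc (Suc k)) ^ i * (\<iota> (f B) * L B * z ^ \<alpha> B))"
    using P(3) by (intro sum.cong refl) (simp add: prod \<alpha>(1) power_int_add del: prod.atMost_Suc)
  then have "(\<Sum>B\<in>D. \<iota> (f B) * L B * z ^ \<alpha> B) = 0"
    using sum P(3) top by (simp flip: sum_distrib_left)
  moreover have "(\<Sum>a<degree P. \<Sum>B\<in>{B\<in>D. \<alpha> B = a}. \<iota> (f B) * L B * z ^ \<alpha> B) =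
      (\<Sum>B\<in>D. \<iota> (f B) * L B * z ^ \<alpha> B)"
    using fin \<alpha>(3) by (intro sum.group) auto
  moreover have "(\<Sum>B\<in>{B\<in>D. \<alpha> B = a}. \<iota> (f B) * L B * z ^ \<alpha> B) =
      (\<Sum>B\<in>{B\<in>D. \<alpha> B = a}. \<iota> (f B) * L B) * z ^ a" for a
    by (simp add: sum_distrib_right)
  ultimately have rel: "(\<Sum>a<degree P. (\<Sum>B\<in>{B\<in>D. \<alpha> B = a}. \<iota> (f B) * L B) * z ^ a) = 0"
    by simp
  note SK = subfield_setD(1)[OF K(1)]
  have inK: "(\<Sum>B\<in>{B\<in>D. \<alpha> B = a}. \<iota> (f B) * L B) \<in> K" for a
  proof (rule subring_set_sum[OF SK])
    fix B
    have "L B \<in> K" unfolding L_def by (rule subring_set_prod[OF SK]) (auto intro: subring_set_power[OF SK] lam)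
    then show "\<iota> (f B) * L B \<in> K" using K(2) by (intro subring_setD(4)[OF SK]) auto
  qed
  have zero: "(\<Sum>B'\<in>{B'\<in>D. \<alpha> B' = \<alpha> B}. \<iota> (f B') * L B') = 0"
    by (rule adjoin_powers_free[OF K(1) P(1,2) inK rel \<alpha>(3)[OF B]])
  show "f B = 0"
  \<comment> \<open>Fixing \<alpha> fixes the entry at \<open>Suc k\<close>, which is the last one
    at the lower level. The upper weight is given, so the lower weight is fixed too and freeness at
    level \<open>k\<close> applies to the class of \<open>B\<close>.\<close>
  proof (rule free_productsD[OF free, of "{B'\<in>D. \<alpha> B' = \<alpha> B}" "B (Suc k)" "S B" f])
    show "finite {B' \<in> D. \<alpha> B' = \<alpha> B}" using fin by simp
    show "B' j < bnd j" if "B' \<in> {B' \<in> D. \<alpha> B' = \<alpha> B}" "1 \<le> j" "j \<le> k" for B' j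
      using bspec[OF D, of B'] that by auto
    show top_eq: "B' (Suc k) = B (Suc k)" if "B' \<in> {B' \<in> D. \<alpha> B' = \<alpha> B}" for B'
      using that \<alpha>(2)[of B'] \<alpha>(2)[OF B] by simp
    show "(\<Sum>p\<le>Suc k. B' p * vv p) = S B" if "B' \<in> {B' \<in> D. \<alpha> B' = \<alpha> B}" for B'
    proof -
      have "q * S B' + m * B (Suc k) + i * vv' (Suc (Suc k)) = w"
        using weight[of B'] top_eq[OF that] that by auto
      then have "q * S B' = q * S B" using weight[OF B] by linarith
      then show ?thesis using q by (simp add: S_def)
    qed
    show "B1 = B2"
      if "B1 \<in> {B' \<in> D. \<alpha> B' = \<alpha> B}" "B2 \<in> {B' \<in> D. \<alpha> B' = \<alpha> B}" "\<And>p. p \<le> Suc k \<Longrightarrow> B1 p = B2 p" for B1 B2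
    proof -
      have "B1 (Suc (Suc k)) = B2 (Suc (Suc k))" using bspec[OF D, of B1] bspec[OF D, of B2] that(1,2) by auto
      then have "\<forall>p\<le>Suc (Suc k). B1 p = B2 p" using that(3) by (metis le_Suc_eq)
      then show ?thesis using inj that(1,2) by blast
    qed
    show "(\<Sum>B'\<in>{B' \<in> D. \<alpha> B' = \<alpha> B}. \<iota> (f B') * (\<Prod>p\<le>Suc k. lam p ^ B' p)) = 0"
      using zero by (simp add: L_def)
    show "B \<in> {B' \<in> D. \<alpha> B' = \<alpha> B}" using B by simp
  qed
qed

section \<open>The tower of transforms\<close>

text \<open>\<open>k0\<close> is the index of the theorem. The induction runs over all levels up to
  it, and \<phi>_j is known to be a minimal polynomial in that range.\<close>

locale phi_sequence = H_sequence \<iota> F g q m N P z s t G H c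
  for \<iota> :: "'k::field \<Rightarrow> 'l::field"
    and F :: "'k fps poly"
    and g :: nat
    and q m N :: "nat \<Rightarrow> nat"
    and P :: "nat \<Rightarrow> 'l poly"
    and z :: "nat \<Rightarrow> 'l"
    and s t :: "nat \<Rightarrow> int"
    and G H :: "nat \<Rightarrow> 'l fps poly"
    and c :: "nat \<Rightarrow> 'l fps" +
  fixes \<phi> :: "nat \<Rightarrow> 'k fps poly" and k0 :: nat
  assumes emb: "ring_hom_fun \<iota>"
    and weierstrass_F: "weierstrass F"
    and squarefree_F: "squarefree F"
    and char: "CHAR('k) = 0 \<or> CHAR('k) > degree F"
    and degree_F: "0 < degree F"
    and k0: "k0 \<le> g"
    and min_poly: "j \<le> k0 \<Longrightarrow> is_minimal_polynomial q m z s t c \<iota> j (\<phi> j)"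
begin

abbreviation T :: "nat \<Rightarrow> 'l set" where "T \<equiv> tower \<iota> z"
abbreviation sx :: "nat \<Rightarrow> 'l fps" where "sx \<equiv> sigma_x q z t"
abbreviation sy :: "nat \<Rightarrow> 'l fps poly" where "sy \<equiv> sigma_y m z s c"
abbreviation px :: "nat \<Rightarrow> 'l fps" where "px \<equiv> pi_x q z t"
abbreviation py :: "nat \<Rightarrow> 'l fps poly" where "py \<equiv> pi_y q m z s t c"
abbreviation pb :: "nat \<Rightarrow> 'k fps poly \<Rightarrow> 'l fps poly" where "pb k A \<equiv> pullback q m z s t c \<iota> k A"
abbreviation bnd :: "nat \<Rightarrow> nat" where "bnd i \<equiv> q i * degree (P i)"

definition e :: "nat \<Rightarrow> nat" where "e k = (\<Prod>i<k. q (Suc i))"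
definition fdeg :: "nat \<Rightarrow> nat" where "fdeg k = (\<Prod>i<k. degree (P (Suc i)))"
definition d :: "nat \<Rightarrow> nat" where "d k = e k * fdeg k"

definition hx :: "nat \<Rightarrow> 'k fps \<Rightarrow> 'l fps" where "hx k a = fps_embed \<iota> a oo px k"

lemma px_0: "fps_nth (px k) 0 = 0"
  by (induction k) simp_all

lemma hom_hx: "ring_hom_fun (hx k)"
  unfolding hx_def
  by (intro ring_hom_fun_comp[OF ring_hom_fun_fps_embed[OF emb] ring_hom_fun_fps_compose]) (rule px_0)

lemma pb_eq: "pb k A = poly_subst (hx k) (py k) A"
proof -
  have "pb k A = poly_subst (\<lambda>a. a oo px k) (py k) (map_poly (fps_embed \<iota>) A)"
    by (simp add: pullback_def subst_xy_def poly_subst_def)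
  also have "map_poly (fps_embed \<iota>) A = poly_subst (fps_embed \<iota>) [:0, 1:] A"
    by (rule map_poly_conv_poly_subst)
  also have "poly_subst (\<lambda>a. a oo px k) (py k) (poly_subst (fps_embed \<iota>) [:0, 1:] A) =
      poly_subst (hx k) (py k) A"
    using ring_hom_fun_fps_compose[OF px_0[of k]]
    by (simp add: poly_subst_poly_subst[OF ring_hom_fun_fps_embed[OF emb]] poly_subst_var hx_def[abs_def])
  finally show ?thesis .
qed

lemma hom_pb: "ring_hom_fun (pb k)"
proof -
  have "pb k = poly_subst (hx k) (py k)" by (rule ext) (rule pb_eq)
  then show ?thesis using ring_hom_fun_poly_subst[OF hom_hx] by simp
qed

lemma coeff_0_pb: "coeff (pb k A) 0 = poly (map_poly (hx k) A) (coeff (py k) 0)"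
  by (simp add: pb_eq coeff_0_poly_subst)

lemma min_poly_props:
  assumes "j \<le> k0"
  shows "lead_coeff (\<phi> j) = 1" "irreducible (\<phi> j)" "prime_elem (\<phi> j)" "coeff (pb j (\<phi> j)) 0 = 0"
proof -
  show 1: "lead_coeff (\<phi> j) = 1" "irreducible (\<phi> j)" "coeff (pb j (\<phi> j)) 0 = 0"
    using min_poly[OF assms]
    by (auto simp: is_minimal_polynomial_def coeff_0_pb S_series_def hx_def[abs_def])
  show "prime_elem (\<phi> j)" by (rule irreducible_imp_prime_elem[OF 1(2)])
qed

lemma step_props:
  assumes "Suc k \<le> g"
  shows "q (Suc k) > 0" "irreducible_over (T k) (P (Suc k))" "lead_coeff (P (Suc k)) = 1"
    "degree (P (Suc k)) > 0" "poly (P (Suc k)) (z (Suc k)) = 0" "N k > 1"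
    "int (q (Suc k)) * s (Suc k) - t (Suc k) * int (m (Suc k)) = 1"
    "edge_data (T k) (H k) (q (Suc k)) (m (Suc k)) (P (Suc k)) (N (Suc k))"
  using step_edge[of "Suc k"] step_z[of "Suc k"] step_N[of "Suc k"] step_st[of "Suc k"] assms
  by (auto simp: edge_data_def irreducible_over_def)

lemma sx_0: "Suc k \<le> g \<Longrightarrow> fps_nth (sx (Suc k)) 0 = 0"
  using step_props(1)[of k] by (simp add: sigma_x_def)

lemma hom_sx: "Suc k \<le> g \<Longrightarrow> ring_hom_fun (\<lambda>a. a oo sx (Suc k))"
  by (intro ring_hom_fun_fps_compose sx_0)

lemma subst_xy_eq: "subst_xy X Y A = poly_subst (\<lambda>a. a oo X) Y A"
  by (simp add: subst_xy_def poly_subst_def)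

lemma pb_Suc:
  assumes "Suc k \<le> g"
  shows "pb (Suc k) A = subst_xy (sx (Suc k)) (sy (Suc k)) (pb k A)"
proof -
  have "hx (Suc k) = (\<lambda>a. hx k a oo sx (Suc k))"
    by (rule ext) (simp add: hx_def fps_compose_assoc[OF sx_0[OF assms] px_0])
  then show ?thesis
    by (simp add: pb_eq subst_xy_eq poly_subst_poly_subst[OF hom_hx hom_sx[OF assms]])
qed

lemma e_pos: "k \<le> g \<Longrightarrow> e k > 0"
  unfolding e_def by (intro prod_pos) (auto simp: step_props(1))

lemma fdeg_pos: "k \<le> g \<Longrightarrow> fdeg k > 0"
  unfolding fdeg_def by (intro prod_pos) (auto simp: step_props(4))

lemma d_pos: "k \<le> g \<Longrightarrow> d k > 0"
  by (simp add: d_def e_pos fdeg_pos)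

lemma d_Suc: "d (Suc k) = d k * bnd (Suc k)"
  by (simp add: d_def e_def fdeg_def mult_ac)

lemma of_nat_nonzero:
  assumes "0 < n" "n \<le> degree F" shows "(of_nat n :: 'l) \<noteq> 0"
proof -
  have "\<not> CHAR('k) dvd n" using char assms by (auto dest: dvd_imp_le)
  then have "(of_nat n :: 'k) \<noteq> 0" by (simp add: of_nat_eq_0_iff_char_dvd)
  then have "\<iota> (of_nat n) \<noteq> 0" using ring_hom_fun_inj[OF emb] by blast
  then show ?thesis by (simp add: ring_hom_fun_of_nat[OF emb])
qed

text \<open>Quantifying over all monic \<open>A\<close> is what lets the bound pass from one level
  to the next, although it is applied at level \<open>k\<close> to \<phi>_k.\<close>

definition drop_bound :: "nat \<Rightarrow> bool" where
  "drop_bound k \<longleftrightarrow> (\<forall>A. lead_coeff A = 1 \<longrightarrow>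
     (\<exists>v W. pb k A = smult (fps_X ^ v) W \<and> red W \<noteq> 0 \<and> order 0 (red W) * d k \<le> degree A))"

text \<open>The invariants that the step needs together. The bound of \<open>N k\<close> by the
  degree of \<open>F\<close> keeps q and the degree of P at the next level invertible in the
  field.\<close>

definition level :: "nat \<Rightarrow> bool" where
  "level k \<longleftrightarrow>
     subfield_set (T k) \<and> range \<iota> \<subseteq> T k \<and>
     H k \<in> polys_over (fps_over (T k)) \<and> weierstrass (H k) \<and> degree (H k) = N k \<and> N k \<le> degree F \<and>
     (\<exists>\<mu>\<in>T k. \<mu> \<noteq> 0 \<and> px k = fps_const \<mu> * fps_X ^ e k) \<and>
     py k \<in> polys_over (fps_over (T k)) \<and>
     spanned_by \<iota> (T k) (fdeg k) \<and>
     (\<exists>v V. pb k F = smult (fps_X ^ v) (H k * V) \<and> coeff (red V) 0 \<noteq> 0) \<and>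
     drop_bound k"

text \<open>\<open>vv\<close> is the vector V with finite entries. Position \<open>Suc k\<close>,
  which carries \<phi>_k, is the only one with a factor y.\<close>

definition shaped :: "nat \<Rightarrow> bool" where
  "shaped k \<longleftrightarrow> (\<exists>vv U.
     (\<forall>p\<le>Suc k. has_shape (pb k (Phi \<phi> p)) (vv p) (if p = Suc k then 1 else 0) (U p) \<and>
        coeff (red (U p)) 0 \<in> T k) \<and>
     free_products \<iota> bnd k vv (\<lambda>p. coeff (red (U p)) 0))"

lemma pb_in_polys_over:
  assumes "level k" "k \<le> g" shows "pb k A \<in> polys_over (fps_over (T k))"
proof -
  have K: "subfield_set (T k)" "range \<iota> \<subseteq> T k" "py k \<in> polys_over (fps_over (T k))"
    using assms by (auto simp: level_def)
  obtain \<mu> where \<mu>: "\<mu> \<in> T k" "px k = fps_const \<mu> * fps_X ^ e k" using assms by (auto simp: level_def)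
  note S = subfield_setD(1)[OF K(1)]
  have "hx k a \<in> fps_over (T k)" for a
    unfolding hx_def \<mu>(2)
    using K(2) by (intro fps_compose_monomial_in_fps_over[OF S e_pos[OF assms(2)] \<mu>(1)])
      (auto simp: fps_over_def)
  moreover have "A \<in> polys_over UNIV" by (simp add: polys_over_def)
  ultimately show ?thesis
    unfolding pb_eq by (intro poly_subst_in_polys_over[OF hom_hx subring_fps_over[OF S] _ K(3)])
qed

lemma hx_eq_0_iff:
  assumes "level k" "k \<le> g" shows "hx k a = 0 \<longleftrightarrow> a = 0"
proof
  assume 0: "hx k a = 0"
  obtain \<mu> where \<mu>: "\<mu> \<noteq> 0" "px k = fps_const \<mu> * fps_X ^ e k" using assms by (auto simp: level_def)
  have "fps_nth a n = 0" for n
  proof -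
    have "fps_nth (hx k a) (e k * n) = \<iota> (fps_nth a n) * \<mu> ^ n"
      using e_pos[OF assms(2)] by (simp add: hx_def \<mu>(2) fps_nth_compose_monomial)
    then have "\<iota> (fps_nth a n) = 0" using 0 \<mu>(1) by simp
    then show ?thesis using ring_hom_fun_inj[OF emb] by blast
  qed
  then show "a = 0" by (simp add: fps_eq_iff)
qed (simp add: ring_hom_funD(1)[OF hom_hx])

section \<open>Polynomials vanishing at S_k and the minimal polynomial\<close>

lemma root_mult: "coeff (pb k (A * B)) 0 = coeff (pb k A) 0 * coeff (pb k B) 0"
  by (simp add: ring_hom_funD(4)[OF hom_pb] coeff_0_mult)

lemma root_add: "coeff (pb k (A + B)) 0 = coeff (pb k A) 0 + coeff (pb k B) 0"
  by (simp add: ring_hom_funD(3)[OF hom_pb])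

lemma pb_const: "pb k [:a:] = [:hx k a:]"
  by (simp add: pb_eq poly_subst_const[OF hom_hx])

lemma pb_smult: "pb k (smult a A) = smult (hx k a) (pb k A)"
  by (simp add: pb_eq poly_subst_smult[OF hom_hx])

text \<open>\<open>coeff (pb k A) 0\<close> is the value of \<open>A\<close> at (\<mu>_k x^(e_k),
  S_k). The leading coefficient of \<open>A\<close> need not be a unit, so \<phi>_k is
  pseudo-divided by \<open>A\<close>. A nonzero remainder is a smaller instance. Otherwise the prime
  \<phi>_k divides \<open>A\<close> or the quotient, and in the latter case \<open>A\<close> is
  constant, which contradicts injectivity of \<open>hx k\<close>.\<close>

lemma degree_phi_minimal:
  assumes lev: "level k" "k \<le> k0" and A: "coeff (pb k A) 0 = 0" "A \<noteq> 0"
  shows "degree (\<phi> k) \<le> degree A"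
  using A
proof (induction "degree A" arbitrary: A rule: less_induct)
  case less
  note phi = min_poly_props[OF lev(2)]
  obtain Q R where QR: "pseudo_divmod (\<phi> k) A = (Q, R)" by fastforce
  define a where "a = lead_coeff A ^ (Suc (degree (\<phi> k)) - degree A)"
  have a: "a \<noteq> 0" using less.prems by (simp add: a_def)
  have eq: "smult a (\<phi> k) = A * Q + R" and R: "R = 0 \<or> degree R < degree A"
    using pseudo_divmod[OF less.prems(2) QR] by (simp_all add: a_def)
  have "coeff (pb k (smult a (\<phi> k))) 0 = 0" by (simp add: pb_smult phi(4))
  then have "coeff (pb k R) 0 = 0" using less.prems(1) by (simp add: eq root_add root_mult)
  show ?case
  proof (cases "R = 0")
    case False
    then show ?thesis using R less.hyps[OF _ \<open>coeff (pb k R) 0 = 0\<close> False] by simp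
  next
    case True
    then have AQ: "A * Q = smult a (\<phi> k)" using eq by simp
    then have "\<phi> k dvd A * Q" by (simp add: dvd_smult)
    then consider "\<phi> k dvd A" | "\<phi> k dvd Q" using phi(3) prime_elem_dvd_multD by blast
    then show ?thesis
    proof cases
      case 1
      then show ?thesis using less.prems(2) by (rule dvd_imp_degree_le)
    next
      case 2
      then obtain Q' where "Q = \<phi> k * Q'" by (rule dvdE)
      then have "\<phi> k * (A * Q') = \<phi> k * [:a:]" using AQ by (simp add: mult_ac)
      moreover have "\<phi> k \<noteq> 0" using phi(3) by auto
      ultimately have "A * Q' = [:a:]" by (metis mult_cancel_left)
      moreover from this have "Q' \<noteq> 0" using a by auto
      ultimately have "degree A = 0"
        using less.prems(2) by (metis add_is_0 degree_mult_eq degree_pCons_0)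
      then obtain b where b: "A = [:b:]" by (rule degree_eq_zeroE)
      then have "hx k b = 0" using less.prems(1) by (simp add: pb_const)
      then have "b = 0" using hx_eq_0_iff[OF lev(1)] lev(2) k0 by simp
      then show ?thesis using b less.prems(2) by simp
    qed
  qed
qed

lemma phi_dvd:
  assumes lev: "level k" "k \<le> k0" and A: "coeff (pb k A) 0 = 0"
  shows "\<phi> k dvd A"
proof -
  note phi = min_poly_props[OF lev(2)]
  obtain Q R where QR: "A = \<phi> k * Q + R" "R = 0 \<or> degree R < degree (\<phi> k)"
    using monic_division[OF phi(1)] by blast
  have "coeff (pb k R) 0 = 0" using A by (simp add: QR(1) root_add root_mult phi(4))
  then have "R = 0" using degree_phi_minimal[OF lev, of R] QR(2) by fastforce
  then show ?thesis by (simp add: QR(1))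
qed

lemma degree_phi_le:
  assumes lev: "level k" "k \<le> k0" shows "degree (\<phi> k) \<le> d k"
proof -
  have kg: "k \<le> g" using lev(2) k0 by simp
  obtain \<mu> where \<mu>: "\<mu> \<in> T k" "\<mu> \<noteq> 0" "px k = fps_const \<mu> * fps_X ^ e k"
    using lev by (auto simp: level_def)
  have K: "subfield_set (T k)" "spanned_by \<iota> (T k) (fdeg k)" "coeff (py k) 0 \<in> fps_over (T k)"
    using lev by (auto simp: level_def polys_over_def)
  obtain A where A: "A \<noteq> 0" "degree A \<le> e k * fdeg k"
    "poly (map_poly (\<lambda>a. fps_embed \<iota> a oo (fps_const \<mu> * fps_X ^ e k)) A) (coeff (py k) 0) = 0"
    by (rule algebraic_relation[OF emb K(1,2) \<mu>(1,2) e_pos[OF kg] K(3)])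
  have "coeff (pb k A) 0 = 0" using A(3) by (simp add: coeff_0_pb hx_def[abs_def] \<mu>(3))
  then show ?thesis using degree_phi_minimal[OF lev _ A(1)] A(2) by (simp add: d_def)
qed

text \<open>The root S_k puts a factor y into the transform. The y-order at x = 0 times d_k is at
  most the degree of \<phi>_k, hence at most d_k, so there is no second factor and the cofactor is a
  unit.\<close>

lemma phi_shape:
  assumes lev: "level k" "k \<le> k0"
  obtains v U where "has_shape (pb k (\<phi> k)) v 1 U" "coeff (red U) 0 \<in> T k"
proof -
  note phi = min_poly_props[OF lev(2)]
  have kg: "k \<le> g" using lev(2) k0 by simp
  obtain v W where W: "pb k (\<phi> k) = smult (fps_X ^ v) W" "red W \<noteq> 0"
    "order 0 (red W) * d k \<le> degree (\<phi> k)"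
    using lev(1) phi(1) unfolding level_def drop_bound_def by blast
  have "order 0 (red W) * d k \<le> 1 * d k" using order.trans[OF W(3) degree_phi_le[OF lev]] by simp
  then have ord: "order 0 (red W) \<le> 1" using d_pos[OF kg] by (simp only: mult_le_cancel2)
  have "coeff W 0 = 0" using phi(4) by (simp add: W(1))
  then obtain U where U: "W = pCons 0 U" by (cases W) auto
  then have "red U \<noteq> 0" using W(2) by auto
  then have "order 0 (red U) = 0" using ord by (simp add: U order_0_pCons_0)
  then have "poly (red U) 0 \<noteq> 0" using \<open>red U \<noteq> 0\<close> by (simp add: order_root)
  then have U0: "coeff (red U) 0 \<noteq> 0" by (simp add: poly_0_coeff_0)
  have "W = monom 1 1 * U" by (simp add: U monom_altdef)
  then have 1: "has_shape (pb k (\<phi> k)) v 1 U" using W(1) U0 by (simp add: has_shape_def)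
  have "smult (fps_X ^ v) W \<in> polys_over (fps_over (T k))"
    using pb_in_polys_over[OF lev(1) kg] by (simp flip: W(1))
  then have "W \<in> polys_over (fps_over (T k))" by (rule smult_fps_X_power_in_polys_over)
  then have "U \<in> polys_over (fps_over (T k))" by (simp add: U pCons_in_polys_over)
  then have "coeff (red U) 0 \<in> T k" by (simp add: polys_over_def fps_over_def)
  with 1 show ?thesis by (rule that)
qed

text \<open>Otherwise \<open>\<phi>\<^sub>k\<^sup>2\<close> would divide \<open>F\<close>.\<close>

lemma H_not_monomial:
  assumes lev: "level k" "k \<le> k0" and N: "N k > 1"
  shows "H k \<noteq> monom 1 (N k)"
proof
  assume H: "H k = monom 1 (N k)"
  note phi = min_poly_props[OF lev(2)]
  obtain v V where V: "pb k F = smult (fps_X ^ v) (H k * V)" using lev(1) by (auto simp: level_def)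
  \<comment> \<open>Writing N_k = n + 2 displays two factors y. One is cancelled against \<phi>_k,
    the other forces the cofactor \<open>Q\<close> to vanish at S_k as well.\<close>
  define n where "n = N k - 2"
  have n: "N k = Suc (Suc n)" using N by (simp add: n_def)
  obtain v' U where U: "has_shape (pb k (\<phi> k)) v' 1 U" by (rule phi_shape[OF lev])
  have "coeff (pb k F) 0 = 0" by (simp add: V H n coeff_0_mult coeff_monom)
  then obtain Q where Q: "F = \<phi> k * Q" using phi_dvd[OF lev] by (metis dvdE)
  have "pb k F = smult (fps_X ^ v') (monom 1 1 * U) * pb k Q"
    using U by (simp add: Q ring_hom_funD(4)[OF hom_pb] has_shape_def)
  also have "\<dots> = monom 1 1 * smult (fps_X ^ v') (U * pb k Q)" by (simp add: mult.assoc)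
  finally have "monom 1 1 * smult (fps_X ^ v') (U * pb k Q) = smult (fps_X ^ v) (monom 1 (Suc (Suc n)) * V)"
    by (simp add: V H n)
  also have "monom (1 :: 'l fps) (Suc (Suc n)) = monom 1 1 * monom 1 (Suc n)" by (simp add: mult_monom)
  finally have "monom 1 1 * smult (fps_X ^ v') (U * pb k Q) = monom 1 1 * smult (fps_X ^ v) (monom 1 (Suc n) * V)"
    by (simp add: mult.assoc)
  moreover have "monom (1 :: 'l fps) 1 \<noteq> 0" by (simp add: monom_eq_0_iff)
  ultimately have "smult (fps_X ^ v') (U * pb k Q) = smult (fps_X ^ v) (monom 1 (Suc n) * V)"
    by (rule mult_left_cancel[THEN iffD1, rotated])
  then have "coeff (smult (fps_X ^ v') (U * pb k Q)) 0 = 0" by (simp add: coeff_0_mult coeff_monom)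
  moreover have "coeff U 0 \<noteq> 0" using U by (auto simp: has_shape_def)
  ultimately have "coeff (pb k Q) 0 = 0" by (simp add: coeff_0_mult)
  then have "\<phi> k dvd Q" by (rule phi_dvd[OF lev])
  then have "(\<phi> k)\<^sup>2 dvd F" by (auto simp: Q power2_eq_square)
  then have "\<phi> k dvd 1" using squarefree_F unfolding squarefree_def by blast
  then show False using phi(2) by (simp add: irreducible_def)
qed

text \<open>Provides the hypotheses of \<open>order_red_sigma_transform\<close>. The slope and z are
  nonzero because H_k is not a power of y. By q l N_(k+1) = N_k all three factors are at most the
  degree of \<open>F\<close>. A zero of P' at z would force P' = 0 by minimality of P, but its top
  coefficient is the degree of P, which is invertible.\<close>

lemma step_regular:
  assumes lev: "level k" "Suc k \<le> k0"
  shows "m (Suc k) > 0" "z (Suc k) \<noteq> 0" "poly (pderiv (P (Suc k))) (z (Suc k)) \<noteq> 0"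
    "of_nat (q (Suc k)) \<noteq> (0 :: 'l)" "0 < N (Suc k)" "N (Suc k) \<le> degree F"
proof -
  have kg: "Suc k \<le> g" using lev(2) k0 by simp
  note step = step_props[OF kg]
  have K: "subfield_set (T k)" and H: "weierstrass (H k)" "degree (H k) = N k" "N k \<le> degree F"
    using lev(1) by (auto simp: level_def)
  have "H k \<noteq> monom 1 (degree (H k))" using H_not_monomial[OF lev(1)] lev(2) step(6) H(2) by simp
  note e = edge_data_weierstrass[OF step(8) H(1) this subfield_setD(1)[OF K]]
  show "m (Suc k) > 0" by (rule e)
  have prod: "q (Suc k) * degree (P (Suc k)) * N (Suc k) = N k" using e(3) H(2) by simp
  then show "0 < N (Suc k)" using step(6) by (metis gr0I less_zeroE mult_0_right not_less_zero)
  have "q (Suc k) dvd N k" "degree (P (Suc k)) dvd N k" "N (Suc k) dvd N k" by (simp_all flip: prod)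
  then have le: "q (Suc k) \<le> degree F" "degree (P (Suc k)) \<le> degree F" "N (Suc k) \<le> degree F"
    using H(3) step(6) by (auto dest!: dvd_imp_le)
  show "N (Suc k) \<le> degree F" by (rule le)
  show "z (Suc k) \<noteq> 0" using step(5) e(2) by (metis poly_0_coeff_0)
  show "of_nat (q (Suc k)) \<noteq> (0 :: 'l)" using of_nat_nonzero step(1) le by blast
  show "poly (pderiv (P (Suc k))) (z (Suc k)) \<noteq> 0"
  proof
    assume 0: "poly (pderiv (P (Suc k))) (z (Suc k)) = 0"
    have "pderiv (P (Suc k)) \<in> polys_over (T k)"
      using step(2) subring_setD(4)[OF subfield_setD(1)[OF K]] subring_set_of_nat[OF subfield_setD(1)[OF K]]
      by (auto simp: irreducible_over_def range_coeff_subset_iff polys_over_def coeff_pderiv simp del: of_nat_Suc)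
    moreover have "degree (pderiv (P (Suc k))) \<le> degree (P (Suc k)) - 1"
      by (rule degree_le) (auto simp: coeff_pderiv coeff_eq_0)
    then have "degree (pderiv (P (Suc k))) < degree (P (Suc k))" using step(4) by simp
    ultimately have "pderiv (P (Suc k)) = 0"
      using irreducible_over_min_degree[OF K step(2,5)] 0 by blast
    moreover have "coeff (pderiv (P (Suc k))) (degree (P (Suc k)) - 1) = of_nat (degree (P (Suc k)))"
      using step(3,4) by (simp add: coeff_pderiv del: of_nat_Suc)
    ultimately show False using of_nat_nonzero[OF step(4) le(2)] by simp
  qed
qed

end

declare tower.simps(2) [simp del]

context phi_sequence
begin

section \<open>Induction along the tower\<close>

lemma hom_embed: "ring_hom_fun (fps_embed \<iota>)"
  by (rule ring_hom_fun_fps_embed[OF emb])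

lemma fps_embed_eq_0_iff: "fps_embed \<iota> a = 0 \<longleftrightarrow> a = 0"
  by (simp add: fps_eq_iff ring_hom_fun_inj[OF emb])

lemma pb_0: "pb 0 A = map_poly (fps_embed \<iota>) A \<circ>\<^sub>p [:c 0, 1:]"
  by (simp add: pullback_def subst_xy_def map_poly_idI)

lemma c_0_0: "fps_nth (c 0) 0 = 0"
  using weierstrass_F degree_F
  by (simp add: c_0 tschirnhaus_def weierstrass_def ring_hom_funD(1)[OF emb])

lemma degree_map_embed: "degree (map_poly (fps_embed \<iota>) A) = degree A"
  by (rule degree_map_poly) (simp add: fps_embed_eq_0_iff)

lemma lead_coeff_map_embed: "lead_coeff A = 1 \<Longrightarrow> lead_coeff (map_poly (fps_embed \<iota>) A) = 1"
  by (simp add: degree_map_embed coeff_map_poly ring_hom_funD[OF hom_embed])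

lemma level_0: "level 0"
proof -
  have K: "subfield_set (T 0)" using subfield_range[OF emb] by simp
  note SK = subfield_setD(1)[OF K]
  have c0: "[:c 0, 1:] \<in> polys_over (fps_over (T 0))"
  proof -
    have "c 0 \<in> fps_over (T 0)" by (simp add: c_0 fps_over_def)
    then show ?thesis
      using subring_setD(1)[OF subring_fps_over[OF SK]] subring_set_0[OF subring_polys_over[OF subring_fps_over[OF SK]]]
      by (simp add: pCons_in_polys_over)
  qed
  have "weierstrass (map_poly (fps_embed \<iota>) F)"
    using weierstrass_F lead_coeff_map_embed[of F]
    by (simp add: weierstrass_def degree_map_embed coeff_map_poly ring_hom_funD(1)[OF hom_embed] ring_hom_funD(1)[OF emb])
  then have H: "weierstrass (H 0)" "degree (H 0) = degree F"
    unfolding H_0 using weierstrass_pcompose_translate[OF _ c_0_0] degree_map_embed by simp_all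
  have "H 0 \<in> polys_over (fps_over (T 0))"
  proof -
    have "poly_subst (fps_embed \<iota>) [:c 0, 1:] F \<in> polys_over (fps_over (T 0))"
      by (rule poly_subst_in_polys_over[OF hom_embed subring_fps_over[OF SK] _ c0, of UNIV])
        (auto simp: fps_over_def polys_over_def)
    then show ?thesis by (simp add: H_0 poly_subst_def)
  qed
  moreover have "px 0 = fps_const 1 * fps_X ^ e 0" by (simp add: e_def)
  moreover have "spanned_by \<iota> (T 0) (fdeg 0)" using spanned_by_range[OF emb] by (simp add: fdeg_def)
  moreover have "pb 0 F = smult (fps_X ^ 0) (H 0 * 1)" "coeff (red (1 :: 'l fps poly)) 0 \<noteq> 0"
    by (simp_all add: pb_0 H_0)
  moreover have "drop_bound 0"
    unfolding drop_bound_def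
  proof (intro allI impI)
    fix A :: "'k fps poly" assume A: "lead_coeff A = 1"
    let ?W = "pb 0 A"
    have deg: "degree ?W = degree A" by (simp add: pb_0 degree_pcompose degree_map_embed)
    \<comment> \<open>At level 0 the transform of \<open>A\<close> is monic of the same degree, so
      its reduction is nonzero and its order at 0 cannot exceed that degree. Here d_0 = 1.\<close>
    have "lead_coeff ?W = 1"
      unfolding pb_0 using lead_coeff_map_embed[OF A] by (subst lead_coeff_comp) auto
    then have "coeff (red ?W) (degree A) \<noteq> 0" by (simp add: deg)
    then have nz: "red ?W \<noteq> 0" by (metis coeff_0)
    have "degree (red ?W) \<le> degree A" by (rule degree_le) (simp add: deg coeff_eq_0)
    then have "order 0 (red ?W) \<le> degree A" using order_degree[OF nz, of 0] by simp
    then show "\<exists>v W. pb 0 A = smult (fps_X ^ v) W \<and> red W \<noteq> 0 \<and> order 0 (red W) * d 0 \<le> degree A"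
      using nz by (intro exI[of _ 0] exI[of _ ?W]) (simp add: d_def e_def fdeg_def)
  qed
  moreover have "1 \<in> T 0" by (rule subring_setD(1)[OF SK])
  ultimately show ?thesis
    unfolding level_def using K H c0 N_0
    by (intro conjI bexI[of _ 1] exI[of _ 0] exI[of _ 1]) simp_all
qed

text \<open>In x^v H_k V the substitution \<sigma> turns H_k into x^M H_(k+1) times a unit, by
  \<open>step_G\<close> followed by the translation by c, and it keeps the unit V a unit. The
  multiplicity bound combines \<open>order_red_sigma_transform\<close> with
  \<open>d_Suc\<close>.\<close>

lemma level_Suc:
  assumes lev: "level k" and k: "Suc k \<le> k0"
  shows "level (Suc k)"
proof -
  have kg: "Suc k \<le> g" using k k0 by simp
  have k': "k \<le> k0" "k \<le> g" using k k0 by auto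
  note step = step_props[OF kg] and reg = step_regular[OF lev k]
  have K: "subfield_set (T k)" "range \<iota> \<subseteq> T k" using lev by (auto simp: level_def)
  note SK = subfield_setD(1)[OF K(1)]
  define \<zeta> where "\<zeta> = z (Suc k) powi t (Suc k)"
  have K': "subfield_set (T (Suc k))" using subfield_adjoin[OF K(1) step(2,5)] by (simp add: tower.simps(2))
  note SK' = subfield_setD(1)[OF K'] and SF' = subring_fps_over[OF subfield_setD(1)[OF K']]
  have sub: "T k \<subseteq> T (Suc k)" using adjoin_base[OF SK] by (simp add: tower.simps(2))
  have zT: "z (Suc k) \<in> T (Suc k)" using adjoin_generator[OF SK] by (simp add: tower.simps(2))
  have \<zeta>T: "\<zeta> \<in> T (Suc k)" "\<zeta> \<noteq> 0" using subfield_set_powi[OF K' zT] reg(2) by (auto simp: \<zeta>_def)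
  have sx: "sx (Suc k) = fps_const \<zeta> * fps_X ^ q (Suc k)" by (simp add: sigma_x_def \<zeta>_def)
  have hom: "ring_hom_fun (\<lambda>a. a oo sx (Suc k))" by (rule hom_sx[OF kg])
  have over: "a oo sx (Suc k) \<in> fps_over (T (Suc k))" if "a \<in> fps_over (T k)" for a
    unfolding sx using that sub
    by (intro fps_compose_monomial_in_fps_over[OF SK' step(1) \<zeta>T(1)]) (auto simp: fps_over_def)
  from step_G[of "Suc k"] kg obtain V where
    G: "weierstrass (G (Suc k))" "degree (G (Suc k)) = N (Suc k)" "G (Suc k) \<in> polys_over (fps_over (T (Suc k)))"
    and V: "unit_over (T (Suc k)) V"
    and GV: "fps_of_poly (subst_xy (sx (Suc k))
          [:fps_X ^ m (Suc k) * fps_const (z (Suc k) powi s (Suc k)), fps_X ^ m (Suc k):] (H k)) =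
        fps_const (fps_X ^ (q (Suc k) * m (Suc k) * degree (P (Suc k)) * N (Suc k))) * fps_of_poly (G (Suc k)) * V"
    by (auto simp: poly_over_iff sigma_x_def)
  have cT: "c (Suc k) \<in> fps_over (T (Suc k))"
  proof -
    have "- 1 / of_nat (N (Suc k)) \<in> T (Suc k)"
      by (intro subfield_set_divide[OF K'] subring_setD(1,2)[OF SK'] subring_set_of_nat[OF SK'])
    then show ?thesis
      using G(3) step_c[of "Suc k"] kg
      by (auto simp: tschirnhaus_def polys_over_def intro!: subring_setD(4)[OF SF'] fps_const_in_fps_over[OF SK'])
  qed
  \<comment> \<open>\<open>N (Suc k)\<close> is positive, so the coefficient with index
    \<open>N (Suc k) - 1\<close> lies below the leading one and vanishes at x = 0.\<close>
  have c0: "fps_nth (c (Suc k)) 0 = 0"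
    using step_c[of "Suc k"] kg G(1,2) reg(5) by (simp add: tschirnhaus_def weierstrass_def)
  have H_eq: "H (Suc k) = G (Suc k) \<circ>\<^sub>p [:c (Suc k), 1:]" using step_H[of "Suc k"] kg by simp
  have H: "weierstrass (H (Suc k))" "degree (H (Suc k)) = N (Suc k)"
    unfolding H_eq using weierstrass_pcompose_translate[OF G(1) c0] G(2) by simp_all
  have HT: "H (Suc k) \<in> polys_over (fps_over (T (Suc k)))"
    unfolding H_eq pcompose_conv_poly_subst[of "G (Suc k)"]
    using cT subring_setD(1)[OF SF'] subring_set_0[OF subring_polys_over[OF SF']]
    by (intro poly_subst_in_polys_over[OF ring_hom_fun_id SF' _ _ G(3)]) (auto simp: pCons_in_polys_over)
  obtain \<mu> where \<mu>: "\<mu> \<in> T k" "\<mu> \<noteq> 0" "px k = fps_const \<mu> * fps_X ^ e k" using lev by (auto simp: level_def)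
  have px: "px (Suc k) = fps_const (\<mu> * \<zeta> ^ e k) * fps_X ^ e (Suc k)"
    by (simp add: \<mu>(3) sx fps_compose_monomial_compose_monomial[OF step(1)] e_def)
  have \<mu>T: "\<mu> * \<zeta> ^ e k \<in> T (Suc k)" "\<mu> * \<zeta> ^ e k \<noteq> 0"
    using \<mu> \<zeta>T sub by (auto intro!: subring_setD(4)[OF SK'] subring_set_power[OF SK'])
  have syT: "sy (Suc k) \<in> polys_over (fps_over (T (Suc k)))"
    using cT subfield_set_powi[OF K' zT] subring_set_0[OF subring_polys_over[OF SF']]
    by (auto simp: sigma_y_def pCons_in_polys_over intro!: subring_setD(3,4)[OF SF']
        fps_X_power_in_fps_over[OF SK'] fps_const_in_fps_over[OF SK'])
  have py: "py (Suc k) \<in> polys_over (fps_over (T (Suc k)))"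
  proof -
    have "poly_subst (\<lambda>a. a oo sx (Suc k)) (sy (Suc k)) (py k) \<in> polys_over (fps_over (T (Suc k)))"
      by (rule poly_subst_in_polys_over[OF hom SF' over syT]) (use lev in \<open>auto simp: level_def\<close>)
    then show ?thesis by (simp add: subst_xy_eq)
  qed
  have span: "spanned_by \<iota> (T (Suc k)) (fdeg (Suc k))"
    using spanned_by_adjoin[OF K(1) step(2,5), of \<iota> "fdeg k"] lev fdeg_pos[OF k'(2)]
    by (simp add: level_def fdeg_def mult.commute tower.simps(2))
  have red_sx: "fps_nth (a oo sx (Suc k)) 0 = fps_nth a 0" for a by simp
  define M where "M = q (Suc k) * m (Suc k) * degree (P (Suc k)) * N (Suc k)"
  define Y where "Y = [:fps_X ^ m (Suc k) * fps_const (z (Suc k) powi s (Suc k)), fps_X ^ m (Suc k) :: 'l fps:]"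
  \<comment> \<open>The power x^M is first absorbed into the cofactor, since the division applies to
    the full right-hand side. It is removed again in \<open>V1\<close>, which has the coefficients
    of \<open>V\<close>.\<close>
  obtain W where W: "fps_const (fps_X ^ M) * V = fps_of_poly W" "subst_xy (sx (Suc k)) Y (H k) = G (Suc k) * W"
  proof (rule weierstrass_cofactor_polynomial[OF G(1)])
    show "fps_of_poly (subst_xy (sx (Suc k)) Y (H k)) = fps_of_poly (G (Suc k)) * (fps_const (fps_X ^ M) * V)"
      using GV by (simp add: Y_def M_def mult_ac)
  qed
  define V1 where "V1 = map_poly (fps_shift M) W"
  have coeffW: "coeff W i = fps_X ^ M * fps_nth V i" for i
    by (metis W(1) fps_mult_left_const_nth fps_of_poly_nth)
  have coeffV1: "coeff V1 i = fps_nth V i" for i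
    by (rule fps_ext) (simp add: V1_def coeff_map_poly coeffW fps_X_power_mult_nth)
  have WV1: "W = smult (fps_X ^ M) V1" by (rule poly_eqI) (simp add: coeffW coeffV1)
  obtain V' where "V * V' = 1" using V by (auto simp: unit_over_def)
  then have "fps_nth (fps_nth (V * V') 0) 0 = fps_nth (fps_nth 1 0) 0" by simp
  then have V1: "coeff (red V1) 0 \<noteq> 0" by (auto simp: coeffV1)
  have sy_Y: "sy (Suc k) = Y \<circ>\<^sub>p [:c (Suc k), 1:]"
    by (simp add: sigma_y_def Y_def pcompose_pCons algebra_simps)
  have "subst_xy (sx (Suc k)) (sy (Suc k)) (H k) = subst_xy (sx (Suc k)) Y (H k) \<circ>\<^sub>p [:c (Suc k), 1:]"
    by (simp add: sy_Y subst_xy_def pcompose_assoc)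
  also have "\<dots> = smult (fps_X ^ M) (H (Suc k) * (V1 \<circ>\<^sub>p [:c (Suc k), 1:]))"
    by (simp add: W(2) WV1 pcompose_mult pcompose_smult H_eq)
  finally have substH: "subst_xy (sx (Suc k)) (sy (Suc k)) (H k) =
      smult (fps_X ^ M) (H (Suc k) * (V1 \<circ>\<^sub>p [:c (Suc k), 1:]))" .
  obtain v V2 where V2: "pb k F = smult (fps_X ^ v) (H k * V2)" "coeff (red V2) 0 \<noteq> 0"
    using lev by (auto simp: level_def)
  define V3 where "V3 = smult (fps_const (\<zeta> ^ v)) ((V1 \<circ>\<^sub>p [:c (Suc k), 1:]) * subst_xy (sx (Suc k)) (sy (Suc k)) V2)"
  have sxv: "fps_X ^ v oo sx (Suc k) = fps_const (\<zeta> ^ v) * fps_X ^ (q (Suc k) * v)"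
    using fps_X_power_compose[OF sx_0[OF kg]] by (simp add: sx fps_monomial_power)
  have pbF: "pb (Suc k) F = smult (fps_X ^ (q (Suc k) * v + M)) (H (Suc k) * V3)"
  proof -
    have "pb (Suc k) F = smult (fps_X ^ v oo sx (Suc k))
        (subst_xy (sx (Suc k)) (sy (Suc k)) (H k) * subst_xy (sx (Suc k)) (sy (Suc k)) V2)"
      by (simp add: pb_Suc[OF kg] V2(1) subst_xy_eq poly_subst_smult[OF hom] poly_subst_mult[OF hom])
    then show ?thesis by (simp add: substH sxv V3_def power_add mult_ac)
  qed
  \<comment> \<open>As m is positive, \<sigma> contracts x = 0 to the origin. A substituted
    polynomial thus reduces to its value at the origin, and units remain units.\<close>
  have red_sy: "red (sy (Suc k)) = 0" using reg(1) by (simp add: sigma_y_def)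
  have "coeff (red (V1 \<circ>\<^sub>p [:c (Suc k), 1:])) 0 = coeff (red V1) 0"
    using c0 by (simp only: red_pcompose red_pCons c0) (simp add: pcompose_idR)
  moreover have "coeff (red (subst_xy (sx (Suc k)) (sy (Suc k)) V2)) 0 = coeff (red V2) 0"
    unfolding subst_xy_eq red_poly_subst[OF hom red_sx] red_sy by (simp add: pcompose_0')
  ultimately have V3: "coeff (red V3) 0 \<noteq> 0"
    using V1 V2(2) \<zeta>T(2) unfolding V3_def red_smult red_mult coeff_smult coeff_0_mult by simp
  have drop: "drop_bound (Suc k)"
    unfolding drop_bound_def
  proof (intro allI impI)
    fix A :: "'k fps poly" assume A: "lead_coeff A = 1"
    obtain v W where W: "pb k A = smult (fps_X ^ v) W" "red W \<noteq> 0" "order 0 (red W) * d k \<le> degree A"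
      using lev A unfolding level_def drop_bound_def by blast
    have "smult (fps_X ^ v) W \<in> polys_over (fps_over (T k))"
      using pb_in_polys_over[OF lev k'(2)] by (simp flip: W(1))
    then have WT: "W \<in> polys_over (fps_over (T k))" by (rule smult_fps_X_power_in_polys_over)
    obtain w W1 where W1: "subst_xy (sx (Suc k)) (sy (Suc k)) W = smult (fps_X ^ w) W1" "red W1 \<noteq> 0"
      "order 0 (red W1) * bnd (Suc k) \<le> order 0 (red W)"
      unfolding sigma_x_def sigma_y_def
      by (rule order_red_sigma_transform[OF K(1) WT W(2) step(2,5) reg(3,2) step(1) reg(4,1) step(7) c0])
    have sxv: "fps_X ^ v oo sx (Suc k) = fps_const (\<zeta> ^ v) * fps_X ^ (q (Suc k) * v)"
      using fps_X_power_compose[OF sx_0[OF kg]] by (simp add: sx fps_monomial_power)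
    have "pb (Suc k) A = smult (fps_X ^ (q (Suc k) * v + w)) (smult (fps_const (\<zeta> ^ v)) W1)"
      using W1(1) by (simp add: pb_Suc[OF kg] W(1) subst_xy_eq poly_subst_smult[OF hom] sxv power_add mult_ac)
    moreover have "red (smult (fps_const (\<zeta> ^ v)) W1) = smult (\<zeta> ^ v) (red W1)" by (simp add: red_smult)
    moreover have "order 0 (red W1) * d (Suc k) \<le> degree A"
    proof -
      have "order 0 (red W1) * d (Suc k) = order 0 (red W1) * bnd (Suc k) * d k" by (simp add: d_Suc)
      also have "\<dots> \<le> order 0 (red W) * d k" using W1(3) by (rule mult_right_mono) simp
      finally show ?thesis using W(3) by simp
    qed
    ultimately show "\<exists>v W. pb (Suc k) A = smult (fps_X ^ v) W \<and> red W \<noteq> 0 \<and> order 0 (red W) * d (Suc k) \<le> degree A"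
      using W1(2) \<zeta>T(2) by (metis order_smult power_not_zero smult_eq_0_iff)
  qed
  show ?thesis
    unfolding level_def
  proof (intro conjI)
    show "range \<iota> \<subseteq> T (Suc k)" using K(2) sub by blast
    show "\<exists>\<mu>\<in>T (Suc k). \<mu> \<noteq> 0 \<and> px (Suc k) = fps_const \<mu> * fps_X ^ e (Suc k)" using px \<mu>T by blast
    show "\<exists>v V. pb (Suc k) F = smult (fps_X ^ v) (H (Suc k) * V) \<and> coeff (red V) 0 \<noteq> 0"
      using pbF V3 by blast
  qed (fact K' HT H reg(6) py span drop)+
qed

lemma has_shape_coeff_0:
  assumes "has_shape B v b U" shows "coeff (red U) 0 \<noteq> 0"
  using assms by (simp add: has_shape_def)

lemma shaped_0: "shaped 0"
proof -
  obtain v U where U: "has_shape (pb 0 (\<phi> 0)) v 1 U" "coeff (red U) 0 \<in> T 0"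
    using phi_shape[OF level_0] by blast
  have "pb 0 [:fps_X:] = [:fps_X:]"
  proof -
    have "fps_embed \<iota> fps_X = (fps_X :: 'l fps)"
      by (rule fps_ext) (simp add: fps_X_def ring_hom_funD[OF emb])
    then show ?thesis by (simp add: pb_const hx_def)
  qed
  then have X: "has_shape (pb 0 [:fps_X:]) 1 0 1" by (simp add: has_shape_def one_pCons)
  have K: "1 \<in> T 0" using ring_hom_funD(2)[OF emb] by (metis rangeI tower.simps(1))
  define vv where "vv p = (if p = 0 then 1 else v)" for p :: nat
  define UU where "UU p = (if p = 0 then 1 else U)" for p :: nat
  have "has_shape (pb 0 (Phi \<phi> p)) (vv p) (if p = Suc 0 then 1 else 0) (UU p)" "coeff (red (UU p)) 0 \<in> T 0"
    if "p \<le> Suc 0" for p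
    using that U X K by (cases p; simp add: vv_def UU_def)+
  moreover have "free_products \<iota> bnd 0 vv (\<lambda>p. coeff (red (UU p)) 0)"
    using has_shape_coeff_0[OF U(1)]
    by (intro free_products_0[OF emb]) (simp_all add: vv_def UU_def)
  ultimately show ?thesis unfolding shaped_def by blast
qed

text \<open>Under \<sigma> the variable y becomes x^m (y + \<eta> + c), which is x^m times a unit
  because \<eta> is nonzero. So the factor y of \<phi>_k dissolves: a shape x^v y^b U becomes x^(q v
  + m b) times a unit with value \<zeta>^v \<eta>^b U(0,0) at the origin. The entry for the new
  \<phi>_(k+1) comes from \<open>phi_shape\<close>.\<close>

lemma shaped_Suc:
  assumes lev: "level k" "level (Suc k)" and k: "Suc k \<le> k0" and sh: "shaped k"
  shows "shaped (Suc k)"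
proof -
  have kg: "Suc k \<le> g" using k k0 by simp
  note step = step_props[OF kg] and reg = step_regular[OF lev(1) k]
  define \<zeta> \<eta> where "\<zeta> = z (Suc k) powi t (Suc k)" and "\<eta> = z (Suc k) powi s (Suc k)"
  have K: "subfield_set (T k)" "range \<iota> \<subseteq> T k" "subfield_set (T (Suc k))" using lev by (auto simp: level_def)
  note SK' = subfield_setD(1)[OF K(3)]
  have sub: "T k \<subseteq> T (Suc k)" using adjoin_base[OF subfield_setD(1)[OF K(1)]] by (simp add: tower.simps(2))
  have zT: "z (Suc k) \<in> T (Suc k)" using adjoin_generator[OF subfield_setD(1)[OF K(1)]] by (simp add: tower.simps(2))
  have \<zeta>\<eta>: "\<zeta> \<in> T (Suc k)" "\<eta> \<in> T (Suc k)" "\<zeta> \<noteq> 0" "\<eta> \<noteq> 0"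
    using subfield_set_powi[OF K(3) zT] reg(2) by (auto simp: \<zeta>_def \<eta>_def)
  have sx: "sx (Suc k) = fps_const \<zeta> * fps_X ^ q (Suc k)" by (simp add: sigma_x_def \<zeta>_def)
  have hom: "ring_hom_fun (\<lambda>a. a oo sx (Suc k))" by (rule hom_sx[OF kg])
  have c0: "fps_nth (c (Suc k)) 0 = 0"
    using step_c[of "Suc k"] step_G[of "Suc k"] kg reg(5) by (auto simp: tschirnhaus_def weierstrass_def)
  have red_sx: "fps_nth (a oo sx (Suc k)) 0 = fps_nth a 0" for a by simp
  have red_sy: "red (sy (Suc k)) = 0" using reg(1) by (simp add: sigma_y_def)
  obtain vv U where U: "\<And>p. p \<le> Suc k \<Longrightarrow> has_shape (pb k (Phi \<phi> p)) (vv p) (if p = Suc k then 1 else 0) (U p)"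
    "\<And>p. p \<le> Suc k \<Longrightarrow> coeff (red (U p)) 0 \<in> T k"
    and free: "free_products \<iota> bnd k vv (\<lambda>p. coeff (red (U p)) 0)"
    using sh unfolding shaped_def by blast
  obtain v V where V: "has_shape (pb (Suc k) (\<phi> (Suc k))) v 1 V" "coeff (red V) 0 \<in> T (Suc k)"
    using phi_shape[OF lev(2) k] by blast
  define b where "b p = (if p = Suc k then 1 else 0 :: nat)" for p
  define vv' where "vv' p = (if p = Suc (Suc k) then v else q (Suc k) * vv p + m (Suc k) * b p)" for p
  define U' where "U' p = (if p = Suc (Suc k) then V else
      smult (fps_const (\<zeta> ^ vv p))
        ([:fps_const \<eta> + c (Suc k), 1:] ^ b p * subst_xy (sx (Suc k)) (sy (Suc k)) (U p)))" for p
  have U'0: "coeff (red (U' p)) 0 = \<zeta> ^ vv p * \<eta> ^ b p * coeff (red (U p)) 0" if "p \<le> Suc k" for p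
  proof -
    have "coeff (red (subst_xy (sx (Suc k)) (sy (Suc k)) (U p))) 0 = coeff (red (U p)) 0"
      unfolding subst_xy_eq red_poly_subst[OF hom red_sx] red_sy by (simp add: pcompose_0')
    moreover have "coeff (red [:fps_const \<eta> + c (Suc k), 1:]) 0 = \<eta>" using c0 by simp
    ultimately show ?thesis
      using that unfolding U'_def
      by (simp add: red_smult red_mult red_power coeff_0_mult coeff_0_power del: coeff_red)
  qed
  have shape: "has_shape (pb (Suc k) (Phi \<phi> p)) (vv' p) (if p = Suc (Suc k) then 1 else 0) (U' p)"
    "coeff (red (U' p)) 0 \<in> T (Suc k)" if "p \<le> Suc (Suc k)" for p
  proof -
    have "has_shape (pb (Suc k) (Phi \<phi> p)) (vv' p) (if p = Suc (Suc k) then 1 else 0) (U' p) \<and>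
        coeff (red (U' p)) 0 \<in> T (Suc k)"
    proof (cases "p = Suc (Suc k)")
      case True
      then show ?thesis using V by (simp add: vv'_def U'_def)
    next
      case False
      then have p: "p \<le> Suc k" using that by simp
      have sxv: "fps_X ^ vv p oo sx (Suc k) = fps_const (\<zeta> ^ vv p) * fps_X ^ (q (Suc k) * vv p)"
        using fps_X_power_compose[OF sx_0[OF kg]] by (simp add: sx fps_monomial_power)
      have monom_b: "poly_subst (\<lambda>a. a oo sx (Suc k)) (sy (Suc k)) (monom 1 (b p)) = sy (Suc k) ^ b p"
        by (simp add: b_def monom_altdef poly_subst_1[OF hom] poly_subst_var[OF hom])
      have syb: "sy (Suc k) ^ b p = smult (fps_X ^ (m (Suc k) * b p)) ([:fps_const \<eta> + c (Suc k), 1:] ^ b p)"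
        by (simp add: b_def sigma_y_def \<eta>_def)
      have "pb k (Phi \<phi> p) = smult (fps_X ^ vv p) (monom 1 (b p) * U p)"
        using U(1)[OF p] by (simp add: has_shape_def b_def)
      then have "pb (Suc k) (Phi \<phi> p) = smult (fps_X ^ vv p oo sx (Suc k))
          (sy (Suc k) ^ b p * subst_xy (sx (Suc k)) (sy (Suc k)) (U p))"
        by (simp add: pb_Suc[OF kg] subst_xy_eq poly_subst_smult[OF hom] poly_subst_mult[OF hom] monom_b)
      also have "\<dots> = smult (fps_X ^ vv' p) (U' p)"
        using False unfolding sxv syb by (simp add: vv'_def U'_def power_add mult_ac)
      finally have "pb (Suc k) (Phi \<phi> p) = smult (fps_X ^ vv' p) (U' p)" .
      moreover have "coeff (red (U p)) 0 \<noteq> 0" using U(1)[OF p] by (rule has_shape_coeff_0)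
      ultimately have "has_shape (pb (Suc k) (Phi \<phi> p)) (vv' p) 0 (U' p)"
        unfolding has_shape_def U'0[OF p] using \<zeta>\<eta> by simp
      moreover have "coeff (red (U' p)) 0 \<in> T (Suc k)"
        unfolding U'0[OF p] using U(2)[OF p] sub \<zeta>\<eta>
        by (intro subring_setD(4)[OF SK'] subring_set_power[OF SK']) auto
      ultimately show ?thesis using False by simp
    qed
    then show "has_shape (pb (Suc k) (Phi \<phi> p)) (vv' p) (if p = Suc (Suc k) then 1 else 0) (U' p)"
      "coeff (red (U' p)) 0 \<in> T (Suc k)" by blast+
  qed
  have "free_products \<iota> bnd (Suc k) vv' (\<lambda>p. coeff (red (U' p)) 0)"
  proof (rule free_products_Suc[OF emb K(1,2) step(2,5) reg(2) _ free refl step(1,7)])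
    show "coeff (red (U p)) 0 \<in> T k" if "p \<le> Suc k" for p by (rule U(2)[OF that])
    show "vv' p = q (Suc k) * vv p + m (Suc k) * (if p = Suc k then 1 else 0)" if "p \<le> Suc k" for p
      using that by (simp add: vv'_def b_def)
    show "coeff (red (U' p)) 0 = (z (Suc k) powi t (Suc k)) ^ vv p *
        (z (Suc k) powi s (Suc k)) ^ (if p = Suc k then 1 else 0) * coeff (red (U p)) 0" if "p \<le> Suc k" for p
      using U'0[OF that] by (simp add: \<zeta>_def \<eta>_def b_def)
    show "coeff (red (U' (Suc (Suc k)))) 0 \<noteq> 0"
      using has_shape_coeff_0[OF V(1)] by (simp add: U'_def)
  qed
  then show ?thesis unfolding shaped_def using shape by blast
qed

lemma level_shaped: "k \<le> k0 \<Longrightarrow> level k \<and> shaped k"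
proof (induction k)
  case 0
  then show ?case using level_0 shaped_0 by simp
next
  case (Suc k)
  then show ?case using level_Suc shaped_Suc by simp
qed

end

section \<open>The Newton polygon\<close>

context phi_sequence
begin

text \<open>x is mapped to a series without constant term, so divisibility by powers of x is
  preserved. This is how tails of an x-adically convergent sum are discarded after the
  pullback.\<close>

lemma pb_dvd:
  assumes "[:fps_X ^ n:] dvd A" "j < n" shows "fps_nth (coeff (pb k A) i) j = 0"
proof -
  obtain A' where A': "A = [:fps_X ^ n:] * A'" using assms(1) by (rule dvdE)
  have X: "fps_embed \<iota> fps_X = (fps_X :: 'l fps)"
    by (rule fps_ext) (simp add: fps_X_def ring_hom_funD[OF emb])
  have "px k = fps_X * fps_shift 1 (px k)"
    by (rule fps_ext) (simp add: px_0 not_less_eq_eq)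
  then have px: "px k ^ n = fps_X ^ n * fps_shift 1 (px k) ^ n" by (metis power_mult_distrib)
  have "hx k (fps_X ^ n) = px k ^ n"
    by (simp add: ring_hom_fun_power[OF hom_hx]) (simp add: hx_def X px_0)
  then have "pb k A = smult (fps_X ^ n * fps_shift 1 (px k) ^ n) (pb k A')"
    by (simp add: A' pb_smult px)
  then show ?thesis using assms(2) by (simp add: mult.assoc fps_X_power_mult_nth)
qed

lemma pb_scalar: "pb k (smult (fps_const a) A) = smult (fps_const (\<iota> a)) (pb k A)"
proof -
  have "fps_embed \<iota> (fps_const a) = fps_const (\<iota> a)"
    by (rule fps_ext) (simp add: ring_hom_funD[OF emb])
  then show ?thesis by (simp add: pb_smult hx_def)
qed

lemma has_shape_Phi_power:
  assumes "\<And>p. p \<le> Suc k \<Longrightarrow> has_shape (pb k (Phi \<phi> p)) (vv p) (if p = Suc k then 1 else 0) (U p)"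
  shows "has_shape (pb k (Phi_power \<phi> k B)) (\<Sum>p\<le>Suc k. B p * vv p) (B (Suc k)) (\<Prod>p\<le>Suc k. U p ^ B p)"
proof -
  have pb: "pb k (Phi_power \<phi> k B) = (\<Prod>p\<le>Suc k. pb k (Phi \<phi> p) ^ B p)"
    by (simp only: Phi_power_def ring_hom_fun_prod[OF hom_pb] ring_hom_fun_power[OF hom_pb])
  have "has_shape (\<Prod>p\<le>Suc k. pb k (Phi \<phi> p) ^ B p) (\<Sum>p\<le>Suc k. B p * vv p)
      (\<Sum>p\<le>Suc k. B p * (if p = Suc k then 1 else 0)) (\<Prod>p\<le>Suc k. U p ^ B p)"
    by (intro has_shape_prod has_shape_power assms) simp
  moreover have "(\<Sum>p\<le>Suc k. B p * (if p = Suc k then 1 else 0)) = B (Suc k)" by simp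
  ultimately show ?thesis by (simp only: pb)
qed

text \<open>Terms divisible by x^(j+1) cannot reach the coefficient of x^j, hence the
  \<open>Suc j\<close> in the definition of \<open>I\<close>. The infinite expansion thus becomes a
  finite sum for each coefficient.\<close>

lemma coeff_pb_expansion:
  assumes "is_Phi_adic_expansion q P \<phi> k f A"
  defines "I j \<equiv> {B \<in> multi_indices q P k.
    \<not> [:fps_X ^ Suc j:] dvd smult (fps_const (f B)) (Phi_power \<phi> k B)}"
  shows "finite (I j)"
    "fps_nth (coeff (pb k A) i) j = (\<Sum>B\<in>I j. \<iota> (f B) * fps_nth (coeff (pb k (Phi_power \<phi> k B)) i) j)"
proof -
  let ?S = "\<Sum>B\<in>I j. smult (fps_const (f B)) (Phi_power \<phi> k B)"
  show "finite (I j)"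
    using assms(1) unfolding is_Phi_adic_expansion_def x_adic_has_sum_def I_def by blast
  have "[:fps_X ^ Suc j:] dvd A - ?S"
    using assms(1) unfolding is_Phi_adic_expansion_def x_adic_has_sum_def I_def by blast
  then have "fps_nth (coeff (pb k (A - ?S)) i) j = 0" by (rule pb_dvd) simp
  then have "fps_nth (coeff (pb k A) i) j = fps_nth (coeff (pb k ?S) i) j"
    by (simp add: ring_hom_fun_diff[OF hom_pb])
  also have "\<dots> = (\<Sum>B\<in>I j. \<iota> (f B) * fps_nth (coeff (pb k (Phi_power \<phi> k B)) i) j)"
    by (simp add: ring_hom_fun_sum[OF hom_pb] pb_scalar coeff_sum fps_sum_nth)
  finally show "fps_nth (coeff (pb k A) i) j =
    (\<Sum>B\<in>I j. \<iota> (f B) * fps_nth (coeff (pb k (Phi_power \<phi> k B)) i) j)" .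
qed

definition expansion_points :: "nat \<Rightarrow> ((nat \<Rightarrow> nat) \<Rightarrow> 'k) \<Rightarrow> (nat \<Rightarrow> nat) \<Rightarrow> (nat \<times> nat) set" where
  "expansion_points k f vv =
     {(B (Suc k), \<Sum>p\<le>Suc k. B p * vv p) | B. B \<in> multi_indices q P k \<and> f B \<noteq> 0}"

text \<open>Each term has its support in the quadrant with corner (b_k, weight), so a nonzero
  coefficient of the sum lies in the quadrant of some term that occurs.\<close>

lemma support_dominates_expansion:
  assumes shape: "\<And>p. p \<le> Suc k \<Longrightarrow> has_shape (pb k (Phi \<phi> p)) (vv p) (if p = Suc k then 1 else 0) (U p)"
    and f: "is_Phi_adic_expansion q P \<phi> k f A"
  shows "dominates (support (pb k A)) (expansion_points k f vv)"
  unfolding dominates_def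
proof (intro allI impI)
  fix i j assume "(i, j) \<in> support (pb k A)"
  then have "fps_nth (coeff (pb k A) i) j \<noteq> 0" by (simp add: support_def)
  then obtain B where B: "B \<in> multi_indices q P k"
    "\<iota> (f B) * fps_nth (coeff (pb k (Phi_power \<phi> k B)) i) j \<noteq> 0"
    unfolding coeff_pb_expansion(2)[OF f] by (rule sum.not_neutral_contains_not_neutral) blast
  have "f B \<noteq> 0" using B(2) ring_hom_funD(1)[OF emb] by auto
  moreover have "B (Suc k) \<le> i \<and> (\<Sum>p\<le>Suc k. B p * vv p) \<le> j"
  proof (rule ccontr)
    assume "\<not> (B (Suc k) \<le> i \<and> (\<Sum>p\<le>Suc k. B p * vv p) \<le> j)"
    moreover have "has_shape (pb k (Phi_power \<phi> k B)) (\<Sum>p\<le>Suc k. B p * vv p) (B (Suc k)) (\<Prod>p\<le>Suc k. U p ^ B p)"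
      by (rule has_shape_Phi_power[OF shape])
    ultimately have "fps_nth (coeff (pb k (Phi_power \<phi> k B)) i) j = 0" by (simp only: coeff_has_shape if_False)
    then show False using B(2) by simp
  qed
  ultimately show "\<exists>a b. (a, b) \<in> expansion_points k f vv \<and> a \<le> i \<and> b \<le> j"
    using B(1) unfolding expansion_points_def by blast
qed

text \<open>At a minimal point only the multi-indices of that exact weight contribute, and freeness excludes cancellation.\<close>

lemma expansion_dominates_support:
  assumes shape: "\<And>p. p \<le> Suc k \<Longrightarrow> has_shape (pb k (Phi \<phi> p)) (vv p) (if p = Suc k then 1 else 0) (U p)"
    and free: "free_products \<iota> bnd k vv (\<lambda>p. coeff (red (U p)) 0)"
    and f: "is_Phi_adic_expansion q P \<phi> k f A"
  shows "dominates (expansion_points k f vv) (support (pb k A))"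
proof (rule dominates_if_minimal_in)
  fix i j
  assume ij: "(i, j) \<in> expansion_points k f vv"
    and min: "\<And>a b. (a, b) \<in> expansion_points k f vv \<Longrightarrow> a \<le> i \<Longrightarrow> b \<le> j \<Longrightarrow> a = i \<and> b = j"
  define wt where "wt B = (\<Sum>p\<le>Suc k. B p * vv p)" for B :: "nat \<Rightarrow> nat"
  define lam where "lam p = coeff (red (U p)) 0" for p
  define I where "I = {B \<in> multi_indices q P k.
    \<not> [:fps_X ^ Suc j:] dvd smult (fps_const (f B)) (Phi_power \<phi> k B)}"
  define J where "J = {B \<in> I. B (Suc k) = i \<and> wt B = j}"
  have cf: "fps_nth (coeff (pb k (Phi_power \<phi> k B)) a) b =
    (if B (Suc k) \<le> a \<and> wt B \<le> b
     then fps_nth (coeff (\<Prod>p\<le>Suc k. U p ^ B p) (a - B (Suc k))) (b - wt B) else 0)" for B a b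
    unfolding wt_def by (rule coeff_has_shape[OF has_shape_Phi_power[OF shape]])
  have top: "fps_nth (coeff (\<Prod>p\<le>Suc k. U p ^ B p) 0) 0 = (\<Prod>p\<le>Suc k. lam p ^ B p)" for B
  proof -
    have "fps_nth (\<Prod>p\<le>Suc k. coeff (U p) 0 ^ B p) 0 = (\<Prod>p\<le>Suc k. fps_nth (coeff (U p) 0 ^ B p) 0)"
      by (rule ring_hom_fun_prod[OF ring_hom_fun_fps_nth_0])
    then show ?thesis
      by (simp only: coeff_0_prod coeff_0_power lam_def coeff_red fps_power_zeroth)
  qed
  have fin: "finite I" unfolding I_def by (rule coeff_pb_expansion(1)[OF f])
  have "fps_nth (coeff (pb k A) i) j = (\<Sum>B\<in>I. \<iota> (f B) * fps_nth (coeff (pb k (Phi_power \<phi> k B)) i) j)"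
    unfolding I_def by (rule coeff_pb_expansion(2)[OF f])
  also have "\<dots> = (\<Sum>B\<in>J. \<iota> (f B) * (\<Prod>p\<le>Suc k. lam p ^ B p))"
  proof (rule sum.mono_neutral_cong_right[OF fin])
    show "J \<subseteq> I" by (auto simp: J_def)
    show "\<forall>B\<in>I - J. \<iota> (f B) * fps_nth (coeff (pb k (Phi_power \<phi> k B)) i) j = 0"
    proof
      fix B assume B: "B \<in> I - J"
      show "\<iota> (f B) * fps_nth (coeff (pb k (Phi_power \<phi> k B)) i) j = 0"
      proof (cases "f B = 0")
        case True
        then show ?thesis by (simp add: ring_hom_funD(1)[OF emb])
      next
        case False
        then have "(B (Suc k), wt B) \<in> expansion_points k f vv"
          using B unfolding expansion_points_def wt_def I_def by blast
        then have "\<not> (B (Suc k) \<le> i \<and> wt B \<le> j)" using min B by (auto simp: J_def)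
        then show ?thesis by (simp only: cf if_False mult_zero_right)
      qed
    qed
    show "\<iota> (f B) * fps_nth (coeff (pb k (Phi_power \<phi> k B)) i) j =
        \<iota> (f B) * (\<Prod>p\<le>Suc k. lam p ^ B p)" if "B \<in> J" for B
    proof -
      have "B (Suc k) = i" "wt B = j" using that by (auto simp: J_def)
      then show ?thesis unfolding cf using top[of B] by simp
    qed
  qed
  finally have eq: "fps_nth (coeff (pb k A) i) j = (\<Sum>B\<in>J. \<iota> (f B) * (\<Prod>p\<le>Suc k. lam p ^ B p))" .
  obtain B0 where B0: "B0 \<in> multi_indices q P k" "f B0 \<noteq> 0" "B0 (Suc k) = i" "wt B0 = j"
    using ij unfolding expansion_points_def wt_def by blast
  have lam: "lam p \<noteq> 0" if "p \<le> Suc k" for p using shape[OF that] by (simp add: lam_def has_shape_def)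
  \<comment> \<open>\<open>I\<close> keeps only the terms not divisible by x^(j+1).
    \<open>B0\<close> qualifies since its own transform has a nonzero coefficient at (i, j).\<close>
  have "B0 \<in> I"
  proof -
    have "fps_nth (coeff (pb k (smult (fps_const (f B0)) (Phi_power \<phi> k B0))) i) j =
        \<iota> (f B0) * (\<Prod>p\<le>Suc k. lam p ^ B0 p)"
      using B0 top[of B0] by (simp only: pb_scalar coeff_smult fps_mult_left_const_nth cf) simp
    moreover have "(\<Prod>p\<le>Suc k. lam p ^ B0 p) \<noteq> 0" using lam by simp
    moreover have "\<iota> (f B0) \<noteq> 0" using B0(2) ring_hom_fun_inj[OF emb] by blast
    ultimately have "fps_nth (coeff (pb k (smult (fps_const (f B0)) (Phi_power \<phi> k B0))) i) j \<noteq> 0"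
      by simp
    then have "\<not> [:fps_X ^ Suc j:] dvd smult (fps_const (f B0)) (Phi_power \<phi> k B0)"
      using pb_dvd[of "Suc j"] by blast
    then show ?thesis using B0(1) by (simp add: I_def)
  qed
  then have "B0 \<in> J" using B0 by (simp add: J_def)
  have "fps_nth (coeff (pb k A) i) j \<noteq> 0"
  proof
    assume "fps_nth (coeff (pb k A) i) j = 0"
    then have 0: "(\<Sum>B\<in>J. \<iota> (f B) * (\<Prod>p\<le>Suc k. lam p ^ B p)) = 0" by (simp only: eq)
    have "f B0 = 0"
    proof (rule free_productsD[OF free[folded lam_def[abs_def]] _ _ _ _ _ 0 \<open>B0 \<in> J\<close>])
      show "finite J" using fin by (simp add: J_def)
      show "B a < bnd a" if "B \<in> J" "1 \<le> a" "a \<le> k" for B a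
        using that by (simp add: J_def I_def multi_indices_def)
      show "B (Suc k) = i" if "B \<in> J" for B using that by (simp add: J_def)
      show "(\<Sum>p\<le>Suc k. B p * vv p) = j" if "B \<in> J" for B using that by (auto simp: J_def wt_def)
      show "B = B'" if "B \<in> J" "B' \<in> J" "\<And>p. p \<le> Suc k \<Longrightarrow> B p = B' p" for B B'
      proof
        fix p show "B p = B' p"
          using that by (cases "p \<le> Suc k") (simp_all add: J_def I_def multi_indices_def)
      qed
    qed
    then show False using B0(2) by simp
  qed
  then show "(i, j) \<in> support (pb k A)" by (simp add: support_def)
qed

text \<open>Both sides are compared through exponent sets shifted up by v = v_k(F): the support of
  x^v H_k and the points of the expansion. Mutual domination of these sets is carried over to the
  column minima that define the two hulls.\<close>

lemma newton_polygon_H: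
  assumes f: "is_Phi_adic_expansion q P \<phi> k0 f F"
    and w: "\<And>i. w i =
      ereal_of_enat (INF B\<in>{B \<in> multi_indices q P k0. B (Suc k0) = i \<and> f B \<noteq> 0}.
        \<Sum>j\<le>Suc k0. of_nat (B j) * val_k q m z s t c \<iota> k0 (Phi \<phi> j))
      - ereal_of_enat (val_k q m z s t c \<iota> k0 F)"
  shows "newton_polygon (H k0) = lower_convex_hull (finite_points (N k0) w)"
proof -
  define k where "k = k0"
  have lev: "level k" and "shaped k" using level_shaped[of k] by (auto simp: k_def)
  then obtain vv U where shape:
    "\<And>p. p \<le> Suc k \<Longrightarrow> has_shape (pb k (Phi \<phi> p)) (vv p) (if p = Suc k then 1 else 0) (U p)"
    and free: "free_products \<iota> bnd k vv (\<lambda>p. coeff (red (U p)) 0)"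
    unfolding shaped_def by blast
  obtain v V where V: "pb k F = smult (fps_X ^ v) (H k * V)" "coeff (red V) 0 \<noteq> 0"
    using lev by (auto simp: level_def)
  have H: "weierstrass (H k)" "degree (H k) = N k" using lev by (auto simp: level_def)
  define n where "n = N k"
  define SH where "SH = support (smult (fps_X ^ v) (H k))"
  define SB where "SB = expansion_points k f vv"
  have pbF: "pb k F = smult (fps_X ^ v) (H k) * V" by (simp add: V(1))
  \<comment> \<open>The cofactor \<open>V\<close> is nonzero at the origin, so multiplying by it
    keeps the minimal support points.\<close>
  have "dominates SH (support (pb k F))" "dominates (support (pb k F)) SH"
    unfolding SH_def pbF by (rule dominates_support_mult_right[OF V(2)], rule dominates_support_mult_left)
  then have HB: "dominates SH SB" and BH: "dominates SB SH"
    using support_dominates_expansion[OF shape] expansion_dominates_support[OF shape free] f dominates_trans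
    unfolding SB_def k_def by blast+
  have SH: "(a, b) \<in> SH \<longleftrightarrow> v \<le> b \<and> fps_nth (coeff (H k) a) (b - v) \<noteq> 0" for a b
    by (auto simp: SH_def support_def fps_X_power_mult_nth)
  have SB_ge: "v \<le> x" if "(b, x) \<in> SB" for b x
    using BH that SH unfolding dominates_def by (meson order.trans)
  have Hn: "coeff (H k) n = 1" using H by (simp add: weierstrass_def n_def)
  have Hlow: "fps_nth (coeff (H k) a) 0 = 0" if "a < n" for a using H that by (simp add: weierstrass_def n_def)
  have "(n, v) \<in> SH" using Hn by (simp add: SH)
  \<comment> \<open>Following the domination from (n, v) into \<open>SB\<close> and back leads to a
    point (a, v) of \<open>SH\<close> with a \<le> n. Since H_k is Weierstrass, a column with a term
    at this height is not below n. So a = n, and the intermediate point is (n, v) itself.\<close>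
  then obtain b x where bx: "(b, x) \<in> SB" "b \<le> n" "x \<le> v" using HB unfolding dominates_def by blast
  then obtain a y where ay: "(a, y) \<in> SH" "a \<le> b" "y \<le> x" using BH unfolding dominates_def by blast
  have "y = v" using ay bx SH by force
  then have "fps_nth (coeff (H k) a) 0 \<noteq> 0" using ay(1) SH by simp
  then have "\<not> a < n" using Hlow by blast
  then have "b = n" using ay bx by simp
  moreover have "x = v" using bx SB_ge by force
  ultimately have nv: "(n, v) \<in> SB" using bx by simp

  have valF: "val_k q m z s t c \<iota> k F = enat v"
  proof -
    have "red V \<noteq> 0" using V(2) by (metis coeff_0)
    then have "red (H k * V) \<noteq> 0" by (simp add: red_mult weierstrass_red[OF H(1)] monom_eq_0_iff)
    then show ?thesis unfolding val_k_def V(1) by (rule poly_val_smult_fps_X_power)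
  qed
  have valPhi: "val_k q m z s t c \<iota> k (Phi \<phi> p) = enat (vv p)" if "p \<le> Suc k" for p
    unfolding val_k_def by (rule has_shape_poly_val[OF shape[OF that]])
  define wt where "wt B = (\<Sum>p\<le>Suc k. B p * vv p)" for B :: "nat \<Rightarrow> nat"
  define M where "M i = {B \<in> multi_indices q P k. B (Suc k) = i \<and> f B \<noteq> 0}" for i
  have "(\<Sum>j\<le>Suc k. of_nat (B j) * val_k q m z s t c \<iota> k (Phi \<phi> j)) = enat (wt B)" for B
  proof -
    have "(\<Sum>j\<le>Suc k. of_nat (B j) * val_k q m z s t c \<iota> k (Phi \<phi> j)) = (\<Sum>j\<le>Suc k. of_nat (B j * vv j))"
      by (intro sum.cong refl) (simp add: valPhi of_nat_eq_enat)
    also have "\<dots> = of_nat (wt B)" by (simp only: wt_def of_nat_sum)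
    finally show ?thesis by (simp only: of_nat_eq_enat)
  qed
  then have w': "w i = ereal_of_enat (INF B\<in>M i. enat (wt B)) - ereal (real v)" for i
    using w[of i] valF by (simp add: k_def M_def del: sum.atMost_Suc)
  have w_ne: "\<exists>B\<in>M i. w i = ereal (real (wt B) - real v) \<and> (\<forall>B'\<in>M i. wt B \<le> wt B')" if ne: "M i \<noteq> {}" for i
  proof -
    obtain B where B: "B \<in> M i" "\<And>B'. B' \<in> M i \<Longrightarrow> wt B \<le> wt B'"
      using ex_has_least_nat[of "\<lambda>B. B \<in> M i" _ wt] ne by blast
    have "(INF B\<in>M i. enat (wt B)) = enat (wt B)"
    proof (rule antisym)
      show "(INF B\<in>M i. enat (wt B)) \<le> enat (wt B)" by (rule INF_lower[OF B(1)])
      show "enat (wt B) \<le> (INF B\<in>M i. enat (wt B))" by (rule INF_greatest) (simp add: B(2))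
    qed
    then show ?thesis using B w'[of i] by auto
  qed
  \<comment> \<open>An infimum in \<open>enat\<close> over the empty set is the top element, and
    subtracting the finite v leaves infinity, so such columns give no point.\<close>
  have w_empty: "w i = \<infinity>" if "M i = {}" for i
    using that w'[of i] by (simp add: top_enat_def)
  have SB_iff: "(b, x) \<in> SB \<longleftrightarrow> (\<exists>B\<in>M b. x = wt B)" for b x
    by (auto simp: SB_def expansion_points_def M_def wt_def)

  define A where "A = finite_points n (\<lambda>i. ereal_of_enat (fps_val (coeff (H k) i)))"
  define B where "B = finite_points n w"
  have A: "A = {(real i, real (subdegree (coeff (H k) i))) | i. i \<le> n \<and> coeff (H k) i \<noteq> 0}"
    by (simp add: A_def finite_points_coeffs)
  have B_elim: "\<exists>i' x. i = real i' \<and> i' \<le> n \<and> (i', x) \<in> SB \<and> r = real x - real v" if ir: "(i, r) \<in> B" for i r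
  proof -
    obtain i' where i': "i = real i'" "i' \<le> n" "w i' = ereal r" using ir by (auto simp: B_def finite_points_def)
    then have "M i' \<noteq> {}" using w_empty by force
    then obtain C where "C \<in> M i'" "w i' = ereal (real (wt C) - real v)" using w_ne by blast
    then show ?thesis using i' SB_iff by auto
  qed
  \<comment> \<open>A column of \<open>B\<close> keeps only the lowest point of the same column of
    \<open>SB\<close>, which is still at height at least v before the shift.\<close>
  have B_intro: "\<exists>r. (real b, r) \<in> B \<and> 0 \<le> r \<and> r \<le> real x - real v" if bx: "(b, x) \<in> SB" "b \<le> n" for b x
  proof -
    obtain C where C: "C \<in> M b" "x = wt C" using bx SB_iff by blast
    then obtain C' where C': "C' \<in> M b" "w b = ereal (real (wt C') - real v)" "wt C' \<le> wt C"
      using w_ne[of b] by blast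
    have "v \<le> wt C'" using SB_ge SB_iff C'(1) by blast
    then show ?thesis using C' C(2) bx(2)
      by (intro exI[of _ "real (wt C') - real v"]) (auto simp: B_def finite_points_def)
  qed
  have nA: "(real n, 0) \<in> A" using Hn by (force simp: A)
  have nB: "(real n, 0) \<in> B" using B_intro[OF nv] by force
  have "lower_convex_hull A = lower_convex_hull B"
  proof (rule lower_convex_hull_eqI)
    show "A \<subseteq> upward (convex hull B)"
    proof (rule dominated_subset_upward[OF nB])
      fix i r assume "(i, r) \<in> A"
      then obtain i' where i': "i = real i'" "r = real (subdegree (coeff (H k) i'))" "i' \<le> n" "coeff (H k) i' \<noteq> 0"
        by (auto simp: A)
      have "(i', subdegree (coeff (H k) i') + v) \<in> SH" using i'(4) by (simp add: SH)
      then obtain b x where bx: "(b, x) \<in> SB" "b \<le> i'" "x \<le> subdegree (coeff (H k) i') + v"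
        using HB unfolding dominates_def by blast
      \<comment> \<open>The dominating point lies weakly to the left of column i', so it survives
        the cut at column n.\<close>
      then obtain y where y: "(real b, y) \<in> B" "0 \<le> y" "y \<le> real x - real v"
        using B_intro[of b x] i'(3) by auto
      have "real x \<le> real (subdegree (coeff (H k) i')) + real v" using bx(3) by linarith
      then have "y \<le> r" using y(3) i'(2) by linarith
      then show "i \<le> real n \<and> 0 \<le> r \<and> (\<exists>a b. (a, b) \<in> B \<and> a \<le> i \<and> b \<le> r \<and> 0 \<le> b)"
        using y i' bx(2) by (intro conjI exI[of _ "real b"] exI[of _ y]) auto
    qed
    show "B \<subseteq> upward (convex hull A)"
    proof (rule dominated_subset_upward[OF nA])
      fix i r assume "(i, r) \<in> B"
      then obtain i' x where i': "i = real i'" "i' \<le> n" "(i', x) \<in> SB" "r = real x - real v"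
        using B_elim by blast
      obtain a y where ay: "(a, y) \<in> SH" "a \<le> i'" "y \<le> x" using BH i'(3) unfolding dominates_def by blast
      then have a: "v \<le> y" "fps_nth (coeff (H k) a) (y - v) \<noteq> 0" using SH by auto
      then have "subdegree (coeff (H k) a) \<le> y - v" by (intro subdegree_leI)
      then have "real (subdegree (coeff (H k) a)) \<le> r" using a(1) ay(3) i'(4) by linarith
      moreover have "(real a, real (subdegree (coeff (H k) a))) \<in> A"
        using a(2) ay(2) i'(2) by (auto simp: A)
      ultimately show "i \<le> real n \<and> 0 \<le> r \<and> (\<exists>a b. (a, b) \<in> A \<and> a \<le> i \<and> b \<le> r \<and> 0 \<le> b)"
        using i' ay(2) SB_ge[OF i'(3)]
        by (intro conjI exI[of _ "real a"] exI[of _ "real (subdegree (coeff (H k) a))"]) auto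
    qed
  qed
  then show ?thesis unfolding newton_polygon_def A_def B_def by (simp add: k_def n_def H(2)[unfolded k_def])
qed

end

theorem theorem2:
  fixes \<iota> :: "'k::field \<Rightarrow> 'l::field"
    and F :: "'k fps poly"
    and g k :: nat
    and q m N :: "nat \<Rightarrow> nat"
    and P :: "nat \<Rightarrow> 'l poly"
    and z :: "nat \<Rightarrow> 'l"
    and s t :: "nat \<Rightarrow> int"
    and G H :: "nat \<Rightarrow> 'l fps poly"
    and c :: "nat \<Rightarrow> 'l fps"
    and \<phi> :: "nat \<Rightarrow> 'k fps poly"
    and f :: "(nat \<Rightarrow> nat) \<Rightarrow> 'k"
    and w :: "nat \<Rightarrow> ereal"
  assumes "field_embedding \<iota>"
    and "perfect_field TYPE('k)"
    and "weierstrass F" and "squarefree F"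
    and "CHAR('k) = 0 \<or> CHAR('k) > degree F"
    and "H_sequence \<iota> F g q m N P z s t G H c"
    and "k \<le> g" and "N k > 1"
    and "\<And>j. j \<le> k \<Longrightarrow> is_minimal_polynomial q m z s t c \<iota> j (\<phi> j)"
    and "is_Phi_adic_expansion q P \<phi> k f F"
    and "\<And>i. w i =
      ereal_of_enat (INF B\<in>{B \<in> multi_indices q P k. B (Suc k) = i \<and> f B \<noteq> 0}.
        \<Sum>j\<le>Suc k. of_nat (B j) * val_k q m z s t c \<iota> k (Phi \<phi> j))
      - ereal_of_enat (val_k q m z s t c \<iota> k F)"
  shows "newton_polygon (H k) = lower_convex_hull (finite_points (N k) w)"
proof -
  interpret H_sequence \<iota> F g q m N P z s t G H c by fact
  have "0 < degree F"
    \<comment> \<open>The degree of \<open>F\<close> is N_0. This exceeds 1 by assumption if k = 0,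
      and by the rule for the first step otherwise. Positivity makes c_0 vanish at x = 0.\<close>
    using N_0 step_N[of 1] assms(7,8) by (cases "k = 0") auto
  interpret phi_sequence \<iota> F g q m N P z s t G H c \<phi> k
    by unfold_locales (use assms \<open>0 < degree F\<close> field_embedding_ring_hom_fun in auto)
  show ?thesis by (rule newton_polygon_H[OF assms(10,11)])
qed

end
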